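(* Let $N\ge 1$, let $\Omega\subset\mathbb{R}^N$ be a bounded domain, and let $1<q<p<\infty$. Let $m,a\in L^\gamma(\Omega)$, where $\gamma>N/p$ (for some such $\gamma$) if $N\ge p$ and $\gamma=1$ if $N<p$, with $m_+\not\equiv 0$, $a\not\equiv 0$. Assume that $a\ge 0$ a.e. in $\Omega$. Then for any $\varepsilon>0$ there exists $f\in C_0^\infty(\Omega)\setminus\{0\}$ satisfying $f\ge 0$ in $\Omega$ such that the problem $$-\Delta_p u=\lambda\,m(x)|u|^{p-2}u+\eta\,a(x)|u|^{q-2}u+f(x)\ \text{ in }\Omega,\qquad u=0\ \text{ on }\partial\Omega,$$ has no nonnegative solution and no negative solution provided $\lambda\ge\lambda_1(m)+\varepsilon$ and $\eta\ge 0$.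
   Context: Notation: $w_\pm=\max\{\pm w,0\}$; $\Delta_p u=\mathrm{div}(|\nabla u|^{p-2}\nabla u)$; $C_0^\infty(\Omega)$ is the set of smooth functions with compact support in $\Omega$. A solution is a function $u\in W_0^{1,p}(\Omega)$ with $\int_\Omega|\nabla u|^{p-2}\nabla u\cdot\nabla\xi\,dx=\lambda\int_\Omega m|u|^{p-2}u\xi\,dx+\eta\int_\Omega a|u|^{q-2}u\xi\,dx+\int_\Omega f\xi\,dx$ for all $\xi\in W_0^{1,p}(\Omega)$. Solutions are continuous in $\Omega$ (continuous representative); nonnegative means $u\ge0$ in $\Omega$, negative means $u<0$ in $\Omega$. The first positive eigenvalue is $$\lambda_1(m)=\inf\left\{\frac{\int_\Omega|\nabla u|^p\,dx}{\int_\Omega m|u|^p\,dx}:\ u\in W_0^{1,p}(\Omega),\ \int_\Omega m|u|^p\,dx>0\right\}.$$ *)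

theory Defs
  imports "HOL-Analysis.Analysis"
begin

text \<open>A function on an open set \<open>\<Omega>\<close> is represented by a total function whose values outside \<open>\<Omega>\<close>
  are ignored, except for test functions, which are extended by zero to the whole space.\<close>

definition bounded_domain :: "'a::euclidean_space set \<Rightarrow> bool" where
  "bounded_domain \<Omega> \<longleftrightarrow> open \<Omega> \<and> connected \<Omega> \<and> \<Omega> \<noteq> {} \<and> bounded \<Omega>"

text \<open>In finite dimension, a function is of class \<open>C\<^sup>k\<^sup>+\<^sup>1\<close> iff it is differentiable and all its
  directional derivatives are of class \<open>C\<^sup>k\<close>.\<close>

primrec C_class :: "nat \<Rightarrow> ('a::euclidean_space \<Rightarrow> real) \<Rightarrow> bool" where
  "C_class 0 f \<longleftrightarrow> continuous_on UNIV f"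
| "C_class (Suc k) f \<longleftrightarrow> (\<forall>x. f differentiable (at x)) \<and>
     (\<forall>v. C_class k (\<lambda>x. frechet_derivative f (at x) v))"

definition smooth :: "('a::euclidean_space \<Rightarrow> real) \<Rightarrow> bool" where
  "smooth f \<longleftrightarrow> (\<forall>k. C_class k f)"

definition test_functions :: "'a::euclidean_space set \<Rightarrow> ('a \<Rightarrow> real) set" where
  "test_functions \<Omega> = {f. smooth f \<and> compact (closure {x. f x \<noteq> 0}) \<and> closure {x. f x \<noteq> 0} \<subseteq> \<Omega>}"

definition Lp :: "real \<Rightarrow> 'a::euclidean_space set \<Rightarrow> ('a \<Rightarrow> 'b::euclidean_space) set" where
  "Lp r \<Omega> = {g \<in> borel_measurable (lebesgue_on \<Omega>).
     integrable (lebesgue_on \<Omega>) (\<lambda>x. norm (g x) powr r)}"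

definition locally_integrable :: "'a::euclidean_space set \<Rightarrow> ('a \<Rightarrow> 'b::euclidean_space) \<Rightarrow> bool" where
  "locally_integrable \<Omega> g \<longleftrightarrow> (\<forall>K. compact K \<and> K \<subseteq> \<Omega> \<longrightarrow> integrable (lebesgue_on K) g)"

definition is_weak_gradient ::
    "'a::euclidean_space set \<Rightarrow> ('a \<Rightarrow> real) \<Rightarrow> ('a \<Rightarrow> 'a) \<Rightarrow> bool" where
  "is_weak_gradient \<Omega> u g \<longleftrightarrow> locally_integrable \<Omega> u \<and> locally_integrable \<Omega> g \<and>
     (\<forall>\<phi>\<in>test_functions \<Omega>. \<forall>b\<in>Basis.
        (LINT x|lebesgue_on \<Omega>. u x * frechet_derivative \<phi> (at x) b) =
        - (LINT x|lebesgue_on \<Omega>. (g x \<bullet> b) * \<phi> x))"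

text \<open>A weak gradient is unique only up to a null set; \<open>weak_gradient\<close> picks a representative.\<close>

definition weak_gradient :: "'a::euclidean_space set \<Rightarrow> ('a \<Rightarrow> real) \<Rightarrow> 'a \<Rightarrow> 'a" where
  "weak_gradient \<Omega> u = (SOME g. is_weak_gradient \<Omega> u g)"

definition W1p :: "real \<Rightarrow> 'a::euclidean_space set \<Rightarrow> ('a \<Rightarrow> real) set" where
  "W1p p \<Omega> = {u \<in> Lp p \<Omega>. \<exists>g \<in> Lp p \<Omega>. is_weak_gradient \<Omega> u g}"

definition W1p_norm :: "real \<Rightarrow> 'a::euclidean_space set \<Rightarrow> ('a \<Rightarrow> real) \<Rightarrow> real" where
  "W1p_norm p \<Omega> u =
     ((LINT x|lebesgue_on \<Omega>. \<bar>u x\<bar> powr p) +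
      (LINT x|lebesgue_on \<Omega>. norm (weak_gradient \<Omega> u x) powr p)) powr (1 / p)"

definition W01p :: "real \<Rightarrow> 'a::euclidean_space set \<Rightarrow> ('a \<Rightarrow> real) set" where
  "W01p p \<Omega> = {u \<in> W1p p \<Omega>.
     \<forall>e>0. \<exists>\<phi>\<in>test_functions \<Omega>. W1p_norm p \<Omega> (\<lambda>x. \<phi> x - u x) < e}"

definition lambda1 :: "real \<Rightarrow> 'a::euclidean_space set \<Rightarrow> ('a \<Rightarrow> real) \<Rightarrow> real" where
  "lambda1 p \<Omega> m =
     Inf {(LINT x|lebesgue_on \<Omega>. norm (weak_gradient \<Omega> u x) powr p) /
          (LINT x|lebesgue_on \<Omega>. m x * \<bar>u x\<bar> powr p) | u.
          u \<in> W01p p \<Omega> \<and> (LINT x|lebesgue_on \<Omega>. m x * \<bar>u x\<bar> powr p) > 0}"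

text \<open>Since \<open>0 powr r = 0\<close>, the expressions \<open>|s|\<^sup>r\<^sup>-\<^sup>2 s\<close> below vanish at \<open>s = 0\<close>, as they should for
  \<open>r > 1\<close>, also when \<open>r < 2\<close>.\<close>

definition weak_solution ::
    "'a::euclidean_space set \<Rightarrow> real \<Rightarrow> real \<Rightarrow> ('a \<Rightarrow> real) \<Rightarrow> ('a \<Rightarrow> real) \<Rightarrow> ('a \<Rightarrow> real) \<Rightarrow>
     real \<Rightarrow> real \<Rightarrow> ('a \<Rightarrow> real) \<Rightarrow> bool" where
  "weak_solution \<Omega> p q m a f lam eta u \<longleftrightarrow> u \<in> W01p p \<Omega> \<and>
     (\<forall>\<xi>\<in>W01p p \<Omega>.
        (LINT x|lebesgue_on \<Omega>. norm (weak_gradient \<Omega> u x) powr (p - 2) *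
            (weak_gradient \<Omega> u x \<bullet> weak_gradient \<Omega> \<xi> x)) =
        lam * (LINT x|lebesgue_on \<Omega>. m x * \<bar>u x\<bar> powr (p - 2) * u x * \<xi> x) +
        eta * (LINT x|lebesgue_on \<Omega>. a x * \<bar>u x\<bar> powr (q - 2) * u x * \<xi> x) +
        (LINT x|lebesgue_on \<Omega>. f x * \<xi> x))"

text \<open>Every weak solution agrees almost everywhere with one that is continuous in \<open>\<Omega>\<close>, and its sign
  is understood as that of this representative.\<close>

definition solution ::
    "'a::euclidean_space set \<Rightarrow> real \<Rightarrow> real \<Rightarrow> ('a \<Rightarrow> real) \<Rightarrow> ('a \<Rightarrow> real) \<Rightarrow> ('a \<Rightarrow> real) \<Rightarrow>
     real \<Rightarrow> real \<Rightarrow> ('a \<Rightarrow> real) \<Rightarrow> bool" where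
  "solution \<Omega> p q m a f lam eta u \<longleftrightarrow>
     weak_solution \<Omega> p q m a f lam eta u \<and> continuous_on \<Omega> u"

end

theory Submission
  imports Defs
begin

text \<open>
  Both nonexistence claims come from one inequality. Let \<open>v \<ge> 0\<close> satisfy
  \<open>- \<Delta>\<^sub>p v \<ge> \<lambda> m v\<^sup>p\<^sup>-\<^sup>1\<close> weakly, and let \<open>\<phi>\<close> be a bounded nonnegative function with compact
  support. Testing with \<open>\<phi>\<^sup>p / (v + \<delta>)\<^sup>p\<^sup>-\<^sup>1\<close> and applying Young's inequality pointwise (this is
  Picone's inequality, \<open>picone_inequality\<close>) bounds
  \<open>\<lambda> \<integral> m \<phi>\<^sup>p (v / (v + \<delta>))\<^sup>p\<^sup>-\<^sup>1\<close> by \<open>\<integral> |\<nabla>\<phi>|\<^sup>p\<close>. If \<open>v > 0\<close> almost everywhere, then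
  \<open>\<delta> \<rightarrow> 0\<close> gives \<open>\<lambda> \<integral> m \<phi>\<^sup>p \<le> \<integral> |\<nabla>\<phi>|\<^sup>p\<close> (\<open>supersolution_eigenvalue_bound\<close>). This is
  impossible once the Rayleigh quotient of \<open>\<phi>\<close> lies below \<open>\<lambda>\<^sub>1(m) + \<epsilon> \<le> \<lambda>\<close>, and such a
  \<open>\<phi>\<close>, of the form \<open>T \<circ> \<psi>\<close> with a test function \<open>\<psi>\<close> and a truncation \<open>T\<close>, exists
  by the definition of \<open>\<lambda>\<^sub>1(m)\<close> (\<open>rayleigh_near_lambda1\<close>).

  The source \<open>f\<close> is a bump function placed in \<open>\<Omega>\<close> outside the support of \<open>\<psi>\<close>; there is room
  for it because a bounded nonempty open set is not compact. If \<open>u < 0\<close> is a solution, then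
  \<open>v = - u\<close> is a positive supersolution except for the source \<open>- f\<close>, which has the wrong sign
  but is not seen by test functions supported in the support of \<open>\<psi>\<close>. If \<open>u \<ge> 0\<close> is a solution,
  then \<open>v = u\<close> is a supersolution without any reservation, and it remains to exclude zeros of \<open>u\<close>.

  This is the strong maximum principle (\<open>strong_maximum_principle\<close>): either \<open>u = 0\<close> in
  \<open>\<Omega>\<close>, which contradicts \<open>f \<noteq> 0\<close>, or \<open>u > 0\<close> almost everywhere. Its proof
  rests on the logarithmic energy. Keeping half of the absorbed term in Young's
  inequality shows that \<open>ln (1 + u / \<delta>)\<close> has locally a gradient bounded in \<open>L\<^sup>p\<close>, uniformly in
  \<open>\<delta>\<close>. Hence its averages over two nearby balls differ by a bounded amount
  (\<open>bump_transport\<close>). On a ball where \<open>u\<close> is bounded below by a positive constant the average is asymptotic to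
  \<open>ln (1 / \<delta>)\<close>; on the other ball the zero set of \<open>u\<close> contributes nothing, so for \<open>\<delta> \<rightarrow> 0\<close>
  that zero set must be null. Connectedness does the rest.

  Everything else is the calculus of Sobolev functions behind these computations: existence of
  enough test functions, uniqueness of weak gradients, and the rule
  \<open>W01p_product_compose\<close> saying that \<open>G(\<psi>) F(u)\<close> is an admissible test function. The weight
  \<open>m\<close> is always multiplied by bounded functions, because the Rayleigh quotients are truncated
  (\<open>rayleigh_quotient_test_function\<close>).
\<close>

section \<open>Smooth functions\<close>

lemma C_class_differentiable: "C_class (Suc k) f \<Longrightarrow> f differentiable (at x)"
  by simp

lemma C_class_has_derivative:
  "C_class (Suc k) f \<Longrightarrow> (f has_derivative frechet_derivative f (at x)) (at x)"
  using frechet_derivative_works C_class_differentiable by blast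

lemma C_class_SucD: "C_class (Suc k) f \<Longrightarrow> C_class k f"
proof (induction k arbitrary: f)
  case 0
  then show ?case
    by (auto intro!: continuous_at_imp_continuous_on differentiable_imp_continuous_within)
next
  case (Suc k)
  then show ?case by (metis C_class.simps(2))
qed

lemma C_class_const [simp]: "C_class k (\<lambda>x::'a::euclidean_space. c)"
  by (induction k arbitrary: c) auto

lemma C_class_bounded_linear: "bounded_linear f \<Longrightarrow> C_class k f"
proof (cases k)
  case (Suc l)
  assume f: "bounded_linear f"
  then have "frechet_derivative f (at x) = f" for x
    by (metis bounded_linear_imp_has_derivative frechet_derivative_at)
  then show ?thesis using f Suc by (auto simp: bounded_linear_imp_differentiable)
qed (auto intro: linear_continuous_on)

lemma C_class_add:
  "C_class k f \<Longrightarrow> C_class k g \<Longrightarrow> C_class k (\<lambda>x. f x + g x)"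
proof (induction k arbitrary: f g)
  case 0
  then show ?case by (auto intro: continuous_on_add)
next
  case (Suc k)
  have "((\<lambda>x. f x + g x) has_derivative
      (\<lambda>v. frechet_derivative f (at x) v + frechet_derivative g (at x) v)) (at x)" for x
    using has_derivative_add[OF C_class_has_derivative[OF Suc.prems(1)] C_class_has_derivative[OF Suc.prems(2)]] .
  then have "frechet_derivative (\<lambda>x. f x + g x) (at x) =
      (\<lambda>v. frechet_derivative f (at x) v + frechet_derivative g (at x) v)" for x
    by (rule frechet_derivative_at[symmetric])
  with Suc show ?case by auto
qed

lemma C_class_mult:
  "C_class k f \<Longrightarrow> C_class k g \<Longrightarrow> C_class k (\<lambda>x. f x * g x)"
proof (induction k arbitrary: f g)
  case 0
  then show ?case by (auto intro: continuous_on_mult)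
next
  case (Suc k)
  have "((\<lambda>x. f x * g x) has_derivative
      (\<lambda>v. f x * frechet_derivative g (at x) v + frechet_derivative f (at x) v * g x)) (at x)" for x
    using has_derivative_mult[OF C_class_has_derivative[OF Suc.prems(1)] C_class_has_derivative[OF Suc.prems(2)]] .
  then have *: "frechet_derivative (\<lambda>x. f x * g x) (at x) =
      (\<lambda>v. f x * frechet_derivative g (at x) v + frechet_derivative f (at x) v * g x)" for x
    by (rule frechet_derivative_at[symmetric])
  have "C_class k f" "C_class k g" using Suc.prems C_class_SucD by blast+
  with Suc show ?case unfolding C_class.simps * by (auto intro!: C_class_add)
qed

lemma smooth_const [simp]: "smooth (\<lambda>x::'a::euclidean_space. c)"
  by (simp add: smooth_def)

lemma smooth_add: "smooth f \<Longrightarrow> smooth g \<Longrightarrow> smooth (\<lambda>x. f x + g x)"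
  by (simp add: smooth_def C_class_add)

lemma smooth_mult: "smooth f \<Longrightarrow> smooth g \<Longrightarrow> smooth (\<lambda>x. f x * g x)"
  by (simp add: smooth_def C_class_mult)

lemma smooth_minus: "smooth f \<Longrightarrow> smooth (\<lambda>x. - f x)"
  using smooth_mult[OF smooth_const[of "-1"]] by simp

lemma smooth_diff: "smooth f \<Longrightarrow> smooth g \<Longrightarrow> smooth (\<lambda>x. f x - g x)"
  using smooth_add[of f "\<lambda>x. - g x"] smooth_minus[of g] by simp

lemma smooth_sum: "(\<And>i. i \<in> I \<Longrightarrow> smooth (f i)) \<Longrightarrow> smooth (\<lambda>x. \<Sum>i\<in>I. f i x)"
  by (induction I rule: infinite_finite_induct) (auto intro: smooth_add)

lemma smooth_power: "smooth f \<Longrightarrow> smooth (\<lambda>x. f x ^ n)"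
  by (induction n) (auto intro: smooth_mult)

lemma smooth_bounded_linear: "bounded_linear f \<Longrightarrow> smooth f"
  by (simp add: smooth_def C_class_bounded_linear)

lemma smooth_polynomial: "real_polynomial_function P \<Longrightarrow> smooth f \<Longrightarrow> smooth (\<lambda>x. P (f x))"
  unfolding real_polynomial_function_iff_sum
  by (auto intro!: smooth_sum smooth_mult smooth_power)

lemma smooth_dist_square: "smooth (\<lambda>x. (dist x c)\<^sup>2)"
proof -
  have eq: "(dist x c)\<^sup>2 = (\<Sum>b\<in>Basis. ((x - c) \<bullet> b) ^ 2)" for x :: 'a
    by (simp only: dist_norm power2_norm_eq_inner euclidean_inner[of "x - c" "x - c"]) (simp add: power2_eq_square)
  have "smooth (\<lambda>x. (x \<bullet> b - c \<bullet> b)^2)" for b :: 'a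
    by (intro smooth_power smooth_diff smooth_bounded_linear smooth_const bounded_linear_inner_left)
  then show ?thesis unfolding eq by (auto intro!: smooth_sum simp: inner_diff_left)
qed

text \<open>The classical flat function \<open>exp (- 1 / t)\<close> on the positive half line. The whole family
  \<open>t \<mapsto> t\<^sup>-\<^sup>j exp (- 1 / t)\<close> is considered at once because it is, up to linear combinations, closed
  under differentiation; this is what makes an induction on the order of smoothness work.\<close>

definition flat :: "nat \<Rightarrow> real \<Rightarrow> real" where
  "flat j t = (if t > 0 then exp (- 1 / t) / t ^ j else 0)"

lemma flat_tendsto_0: "(flat j \<longlongrightarrow> 0) (at 0)"
proof -
  have "((\<lambda>t::real. exp (- 1 / t) / t ^ j) \<longlongrightarrow> 0) (at_right 0)"
  proof -
    have "((\<lambda>s::real. s ^ j / exp s) \<longlongrightarrow> 0) at_top"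
      by (rule tendsto_power_div_exp_0)
    then have "((\<lambda>t::real. inverse t ^ j / exp (inverse t)) \<longlongrightarrow> 0) (at_right 0)"
      using filterlim_compose[OF _ filterlim_inverse_at_top_right] by blast
    then show ?thesis by (simp add: exp_minus field_simps)
  qed
  then have "(flat j \<longlongrightarrow> 0) (at_right 0)"
    by (rule Lim_transform_eventually)
      (auto simp: flat_def eventually_at_right_less intro!: eventually_mono[OF eventually_at_right_less])
  moreover have "(flat j \<longlongrightarrow> 0) (at_left 0)"
    by (rule tendsto_eventually) (auto simp: flat_def eventually_at_filter)
  ultimately show ?thesis using filterlim_split_at by blast
qed

lemma flat_has_derivative:
  "(flat j has_real_derivative (flat (j + 2) t - real j * flat (Suc j) t)) (at t)"
proof (cases "t = 0")
  case True
  have "(flat j has_real_derivative 0) (at 0)"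
  proof -
    have "((\<lambda>y. (flat j y - flat j 0) / (y - 0)) \<longlongrightarrow> 0) (at 0)"
      using flat_tendsto_0[of "Suc j"]
      by (rule Lim_transform_eventually) (auto simp: flat_def eventually_at_filter)
    then show ?thesis by (simp add: has_field_derivative_iff)
  qed
  then show ?thesis using True by (simp add: flat_def)
next
  case False
  show ?thesis
  proof (cases "t > 0")
    case True
    have "((\<lambda>t. exp (- 1 / t) / t ^ j) has_real_derivative
        (flat (j + 2) t - real j * flat (Suc j) t)) (at t)"
    proof -
      have "((\<lambda>t. exp (- 1 / t) / t ^ j) has_real_derivative
        (exp (- 1 / t) * (1 / t^2) * t ^ j - exp (- 1 / t) * (real j * t ^ (j - 1))) / (t ^ j * t ^ j)) (at t)"
        using True by (auto intro!: derivative_eq_intros simp: power2_eq_square field_simps)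
      moreover have "(exp (- 1 / t) * (1 / t^2) * t ^ j - exp (- 1 / t) * (real j * t ^ (j - 1))) / (t ^ j * t ^ j)
         = flat (j + 2) t - real j * flat (Suc j) t"
        using True by (cases j) (auto simp: flat_def power2_eq_square field_simps)
      ultimately show ?thesis by simp
    qed
    then show ?thesis
      by (rule has_field_derivative_transform_within_open[where S="{0<..}"]) (use True in \<open>auto simp: flat_def\<close>)
  next
    case F: False
    have "((\<lambda>t. 0) has_real_derivative 0) (at t)" by simp
    then have "(flat j has_real_derivative 0) (at t)"
      by (rule has_field_derivative_transform_within_open[where S="{..<0}"]) (use F False in \<open>auto simp: flat_def\<close>)
    then show ?thesis using F by (simp add: flat_def)
  qed
qed

lemma C_class_flat_compose: "C_class k s \<Longrightarrow> C_class k (\<lambda>x. flat j (s x))"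
proof (induction k arbitrary: j)
  case 0
  have "continuous_on UNIV (flat j)"
    using DERIV_continuous[OF flat_has_derivative] continuous_at_imp_continuous_on by blast
  with 0 show ?case by (auto intro: continuous_on_compose2[of UNIV "flat j"])
next
  case (Suc k)
  define d where "d x = flat (j + 2) (s x) - real j * flat (Suc j) (s x)" for x
  have "((\<lambda>x. flat j (s x)) has_derivative (\<lambda>v. d x * frechet_derivative s (at x) v)) (at x)" for x
  proof -
    have "(flat j has_derivative (\<lambda>v. d x * v)) (at (s x))"
      using flat_has_derivative[of j "s x"] by (simp add: d_def has_field_derivative_def)
    moreover have "(s has_derivative frechet_derivative s (at x)) (at x)"
      using C_class_has_derivative[OF Suc.prems] .
    ultimately show ?thesis using has_derivative_compose[of s _ x UNIV] by auto
  qed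
  then have *: "frechet_derivative (\<lambda>x. flat j (s x)) (at x) = (\<lambda>v. d x * frechet_derivative s (at x) v)"
    and **: "(\<lambda>x. flat j (s x)) differentiable (at x)" for x
    by (rule frechet_derivative_at[symmetric], auto simp: differentiable_def)
  have s: "C_class k s" using Suc.prems C_class_SucD by blast
  have "C_class k (\<lambda>x. flat (j + 2) (s x) + (- real j) * flat (Suc j) (s x))"
    by (intro C_class_add C_class_mult C_class_const Suc.IH s)
  then have "C_class k d" unfolding d_def[abs_def] by simp
  with Suc.prems show ?case unfolding C_class.simps using * ** by (auto intro!: C_class_mult)
qed

text \<open>The square of the distance is used since it is smooth at the centre, whereas the distance is
  not.\<close>

definition bump :: "'a::euclidean_space \<Rightarrow> real \<Rightarrow> 'a \<Rightarrow> real" where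
  "bump c r x = flat 0 (r\<^sup>2 - (dist x c)\<^sup>2)"

lemma smooth_bump: "smooth (bump c r)"
proof -
  have "smooth (\<lambda>x. r\<^sup>2 - (dist x c)\<^sup>2)" by (intro smooth_diff smooth_const smooth_dist_square)
  then show ?thesis
    unfolding smooth_def bump_def[abs_def] by (auto intro: C_class_flat_compose)
qed

lemma bump_nonneg: "bump c r x \<ge> 0" and bump_le_1: "bump c r x \<le> 1"
  by (auto simp: bump_def flat_def)

lemma bump_pos_iff:
  assumes "r > 0"
  shows "bump c r x > 0 \<longleftrightarrow> x \<in> ball c r"
proof -
  have "(dist x c)\<^sup>2 < r\<^sup>2 \<longleftrightarrow> dist x c < r"
    using assms power_mono_iff[of r "dist x c" 2] by (auto simp: not_le[symmetric])
  then show ?thesis by (simp add: bump_def flat_def dist_commute)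
qed

lemma bump_nonzero_iff: "r > 0 \<Longrightarrow> bump c r x \<noteq> 0 \<longleftrightarrow> x \<in> ball c r"
  using bump_pos_iff[of r c x] bump_nonneg[of c r x] by linarith

lemma bump_in_test_functions:
  assumes "r > 0" "cball c r \<subseteq> \<Omega>"
  shows "bump c r \<in> test_functions \<Omega>"
proof -
  have "{x. bump c r x \<noteq> 0} = ball c r"
    using bump_nonzero_iff[OF assms(1)] by blast
  then show ?thesis using assms by (auto simp: test_functions_def smooth_bump)
qed

text \<open>The exact support is irrelevant for membership: any compact set outside of which the
  function vanishes will do.\<close>

lemma test_functionsI:
  assumes "smooth f" "compact K" "K \<subseteq> \<Omega>" "\<And>x. x \<notin> K \<Longrightarrow> f x = 0"
  shows "f \<in> test_functions \<Omega>"
proof -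
  have "{x. f x \<noteq> 0} \<subseteq> K" using assms by auto
  then have "closure {x. f x \<noteq> 0} \<subseteq> K"
    by (simp add: assms(2) closure_minimal compact_imp_closed)
  then show ?thesis
    using assms closed_Int_compact[OF closed_closure, of K "{x. f x \<noteq> 0}"]
    by (auto simp: test_functions_def Int_absorb2)
qed

lemma test_functionsE:
  assumes "f \<in> test_functions \<Omega>"
  obtains K where "smooth f" "compact K" "K \<subseteq> \<Omega>" "\<And>x. x \<notin> K \<Longrightarrow> f x = 0"
proof
  show "smooth f" "compact (closure {x. f x \<noteq> 0})" "closure {x. f x \<noteq> 0} \<subseteq> \<Omega>"
    using assms unfolding test_functions_def by blast+
  show "x \<notin> closure {x. f x \<noteq> 0} \<Longrightarrow> f x = 0" for x
    using closure_subset[of "{x. f x \<noteq> 0}"] by blast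
qed

section \<open>Gradients of continuously differentiable functions\<close>

text \<open>Composites such as \<open>|\<psi>|\<^sup>p\<close> with \<open>\<psi>\<close> smooth are continuously differentiable but in
  general not smooth, so integration by parts is needed for this larger class.\<close>

definition C1_gradient :: "('a::euclidean_space \<Rightarrow> real) \<Rightarrow> ('a \<Rightarrow> 'a) \<Rightarrow> bool" where
  "C1_gradient f f' \<longleftrightarrow> (\<forall>x. (f has_derivative (\<lambda>v. f' x \<bullet> v)) (at x)) \<and> continuous_on UNIV f'"

definition gradient :: "('a::euclidean_space \<Rightarrow> real) \<Rightarrow> 'a \<Rightarrow> 'a" where
  "gradient f x = (\<Sum>b\<in>Basis. frechet_derivative f (at x) b *\<^sub>R b)"

lemma gradient_inner:
  assumes "f differentiable (at x)"
  shows "gradient f x \<bullet> v = frechet_derivative f (at x) v"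
proof -
  have lin: "linear (frechet_derivative f (at x))"
    using assms linear_frechet_derivative by blast
  have "frechet_derivative f (at x) v = frechet_derivative f (at x) (\<Sum>b\<in>Basis. (v \<bullet> b) *\<^sub>R b)"
    by (simp add: euclidean_representation)
  also have "\<dots> = (\<Sum>b\<in>Basis. (v \<bullet> b) * frechet_derivative f (at x) b)"
    using lin by (simp add: linear_sum linear_scale)
  finally show ?thesis
    by (simp add: gradient_def inner_sum_left inner_commute[of v] mult.commute)
qed

lemma smooth_C1: assumes "smooth f" shows "C1_gradient f (gradient f)"
proof -
  have c: "C_class (Suc 0) f" using assms by (simp add: smooth_def)
  have d: "f differentiable (at x)" for x using c by simp
  have "(f has_derivative (\<lambda>v. gradient f x \<bullet> v)) (at x)" for x
    using d[of x] by (simp add: gradient_inner frechet_derivative_works eta_contract_eq)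
  moreover have "continuous_on UNIV (\<lambda>x. frechet_derivative f (at x) b)" for b
    using c by simp
  then have "continuous_on UNIV (gradient f)"
    unfolding gradient_def[abs_def] by (intro continuous_on_sum continuous_on_scaleR continuous_on_const)
  ultimately show ?thesis by (simp add: C1_gradient_def)
qed

lemma C1_has_derivative: "C1_gradient f f' \<Longrightarrow> (f has_derivative (\<lambda>v. f' x \<bullet> v)) (at x)"
  by (simp add: C1_gradient_def)

lemma C1_frechet: "C1_gradient f f' \<Longrightarrow> frechet_derivative f (at x) v = f' x \<bullet> v"
  using frechet_derivative_at[OF C1_has_derivative, of f f' x] by metis

lemma C1_continuous: "C1_gradient f f' \<Longrightarrow> continuous_on UNIV f"
  by (meson C1_has_derivative continuous_at_imp_continuous_on has_derivative_continuous)

lemma C1_continuous_gradient: "C1_gradient f f' \<Longrightarrow> continuous_on UNIV f'"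
  by (simp add: C1_gradient_def)

lemma smooth_continuous: "smooth f \<Longrightarrow> continuous_on UNIV f"
  using C1_continuous smooth_C1 by blast

lemma C1_mult:
  assumes "C1_gradient f f'" "C1_gradient g g'"
  shows "C1_gradient (\<lambda>x. f x * g x) (\<lambda>x. f x *\<^sub>R g' x + g x *\<^sub>R f' x)"
proof -
  have "((\<lambda>x. f x * g x) has_derivative (\<lambda>v. f x * (g' x \<bullet> v) + (f' x \<bullet> v) * g x)) (at x)" for x
    using has_derivative_mult[OF C1_has_derivative[OF assms(1)] C1_has_derivative[OF assms(2)]] .
  then have "((\<lambda>x. f x * g x) has_derivative (\<lambda>v. (f x *\<^sub>R g' x + g x *\<^sub>R f' x) \<bullet> v)) (at x)" for x
    by (simp add: inner_add_left mult.commute)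
  then show ?thesis
    using assms C1_continuous[OF assms(1)] C1_continuous[OF assms(2)] unfolding C1_gradient_def
    by (auto intro!: continuous_intros)
qed

lemma C1_chain:
  assumes "C1_gradient f f'" "\<And>t. (F has_real_derivative F' t) (at t)" "continuous_on UNIV F'"
  shows "C1_gradient (\<lambda>x. F (f x)) (\<lambda>x. F' (f x) *\<^sub>R f' x)"
proof -
  have "((\<lambda>x. F (f x)) has_derivative (\<lambda>v. F' (f x) * (f' x \<bullet> v))) (at x)" for x
    using has_derivative_compose[OF C1_has_derivative[OF assms(1)], of F "\<lambda>v. F' (f x) * v" x] assms(2)[of "f x"]
    by (simp add: has_field_derivative_def)
  moreover have "continuous_on UNIV (\<lambda>x. F' (f x))"
    using continuous_on_compose2[OF assms(3) C1_continuous[OF assms(1)]] by simp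
  ultimately show ?thesis
    using assms(1) unfolding C1_gradient_def by (auto intro!: continuous_intros simp: inner_scaleR_left[abs_def])
qed

lemma gradient_vanishes:
  assumes "C1_gradient f f'" "closed K" "\<And>x. x \<notin> K \<Longrightarrow> f x = 0" "x \<notin> K"
  shows "f' x = 0"
proof -
  have "((\<lambda>x. 0) has_derivative (\<lambda>v. f' x \<bullet> v)) (at x)"
    by (rule has_derivative_transform_within_open[OF C1_has_derivative[OF assms(1)], where s="- K"])
      (use assms in auto)
  moreover have "((\<lambda>x::'a. 0::real) has_derivative (\<lambda>v. 0)) (at x)" by simp
  ultimately have "(\<lambda>v. f' x \<bullet> v) = (\<lambda>v. 0)" by (rule has_derivative_unique)
  then show ?thesis by (metis inner_eq_zero_iff)
qed

lemma compact_support_bounded: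
  fixes f :: "'a::euclidean_space \<Rightarrow> 'b::euclidean_space"
  assumes "continuous_on UNIV f" "compact K" "\<And>x. x \<notin> K \<Longrightarrow> f x = 0"
  obtains B where "B > 0" "\<And>x. norm (f x) \<le> B"
proof -
  have "bounded (f ` K)"
    using assms(1,2) by (meson compact_continuous_image compact_imp_bounded continuous_on_subset subset_UNIV)
  then obtain B where B: "B > 0" "\<And>x. x \<in> K \<Longrightarrow> norm (f x) \<le> B"
    by (auto simp: bounded_pos)
  then have "norm (f x) \<le> B" for x by (cases "x \<in> K") (auto simp: assms(3))
  with B(1) show ?thesis using that by blast
qed

lemma continuous_borel:
  fixes f :: "'a::euclidean_space \<Rightarrow> 'b::euclidean_space"
  shows "continuous_on UNIV f \<Longrightarrow> f \<in> borel_measurable borel"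
    "continuous_on UNIV f \<Longrightarrow> f \<in> borel_measurable lebesgue"
    "continuous_on UNIV f \<Longrightarrow> f \<in> borel_measurable (lebesgue_on S)"
  by (auto intro!: borel_measurable_continuous_onI measurable_completion measurable_restrict_space1)

lemma integrable_indicator_compact:
  "compact K \<Longrightarrow> integrable lebesgue (\<lambda>x::'a::euclidean_space. indicator K x * (B::real))"
  using lmeasurable_compact[of K]
  by (auto simp: fmeasurable_def intro!: integrable_mult_left integrable_real_indicator)

lemma integrable_compact_support:
  fixes f :: "'a::euclidean_space \<Rightarrow> 'b::euclidean_space"
  assumes "continuous_on UNIV f" "compact K" "\<And>x. x \<notin> K \<Longrightarrow> f x = 0"
  shows "integrable lebesgue f"
proof -
  obtain B where "B > 0" "\<And>x. norm (f x) \<le> B" using compact_support_bounded[OF assms] by blast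
  then have "norm (f x) \<le> norm (indicator K x * B)" for x
    by (cases "x \<in> K") (auto simp: assms(3))
  then show ?thesis
    using Bochner_Integration.integrable_bound[OF integrable_indicator_compact[OF assms(2), of B]
        continuous_borel(2)[OF assms(1)]] by blast
qed

lemma integral_translate:
  fixes f :: "'a::euclidean_space \<Rightarrow> real"
  assumes "continuous_on UNIV f"
  shows "(LINT x|lebesgue. f (x + h)) = (LINT x|lebesgue. f x)"
proof -
  have c: "continuous_on UNIV (\<lambda>x. f (x + h))"
    by (rule continuous_on_compose2[OF assms]) (auto intro: continuous_intros)
  have "(LINT x|lborel. f x) = (LINT x|distr lborel borel ((+) h). f x)"
    by (simp add: lborel_distr_plus)
  also have "\<dots> = (LINT x|lborel. f (x + h))"
    by (subst integral_distr) (auto simp: continuous_borel assms add.commute)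
  finally show ?thesis
    using c assms by (simp add: integral_completion continuous_borel)
qed

text \<open>The fundamental theorem of calculus enters only in this form: the difference quotients of
  \<open>f\<close> have integral zero by translation invariance, and they converge boundedly.\<close>

lemma integral_gradient_zero:
  fixes f :: "'a::euclidean_space \<Rightarrow> real"
  assumes f: "C1_gradient f f'" and K: "compact K" "\<And>x. x \<notin> K \<Longrightarrow> f x = 0"
  shows "(LINT x|lebesgue. f' x \<bullet> v) = 0"
proof -
  note fc = C1_continuous[OF f]
  have f'0: "\<And>x. x \<notin> K \<Longrightarrow> f' x = 0"
    using gradient_vanishes[OF f compact_imp_closed] K by blast
  obtain B where B: "B > 0" "\<And>x. norm (f' x) \<le> B"
    using compact_support_bounded[OF C1_continuous_gradient[OF f] K(1) f'0] by blast
  define t where "t n = 1 / real (Suc n)" for n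
  have t: "t n > 0" "t n \<le> 1" for n by (auto simp: t_def)
  define D where "D n x = (f (x + t n *\<^sub>R v) - f x) / t n" for n x
  define K' where "K' = {x + y |x y. x \<in> K \<and> y \<in> cball 0 (norm v)}"
  have K': "compact K'" unfolding K'_def by (intro compact_sums K compact_cball)
  have D_bound: "norm (D n x) \<le> indicator K' x * (B * norm v)" for n x
  proof (cases "x \<in> K'")
    case True
    have "norm (f (x + t n *\<^sub>R v) - f x) \<le> B * norm (x + t n *\<^sub>R v - x)"
    proof (rule differentiable_bound[of UNIV])
      show "(f has_derivative (\<lambda>v. f' x \<bullet> v)) (at x within UNIV)" for x
        using C1_has_derivative[OF f] by simp
      show "onorm (\<lambda>v. f' x \<bullet> v) \<le> B" for x
      proof (rule onorm_bound)
        show "norm (f' x \<bullet> y) \<le> B * norm y" for y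
          using Cauchy_Schwarz_ineq2[of "f' x" y] mult_right_mono[OF B(2)[of x], of "norm y"] by simp
      qed (use B in simp)
    qed auto
    then have "norm (f (x + t n *\<^sub>R v) - f x) \<le> (B * norm v) * t n"
      using t[of n] by (simp add: mult.commute mult.left_commute)
    then show ?thesis
      using t[of n] True by (simp add: D_def pos_divide_le_eq)
  next
    case False
    have "x \<notin> K" using False by (force simp: K'_def)
    moreover have "x + t n *\<^sub>R v \<notin> K"
    proof
      assume a: "x + t n *\<^sub>R v \<in> K"
      have "norm (- (t n *\<^sub>R v)) \<le> norm v" using t[of n] by (simp add: mult_left_le_one_le)
      with a have "x \<in> K'" unfolding K'_def
        by (intro CollectI exI[of _ "x + t n *\<^sub>R v"] exI[of _ "- (t n *\<^sub>R v)"]) auto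
      then show False using False by simp
    qed
    ultimately show ?thesis using False by (simp add: D_def K)
  qed
  have fshift: "continuous_on UNIV (\<lambda>x. f (x + t n *\<^sub>R v))" for n
    by (rule continuous_on_compose2[OF fc]) (auto intro: continuous_intros)
  have Dm: "D n \<in> borel_measurable lebesgue" for n
    unfolding D_def[abs_def] using t[of n]
    by (intro continuous_borel continuous_on_divide continuous_on_diff fshift continuous_on_const fc) auto
  have "(\<lambda>n. LINT x|lebesgue. D n x) \<longlonglongrightarrow> (LINT x|lebesgue. f' x \<bullet> v)"
  proof (rule integral_dominated_convergence[where w="\<lambda>x. indicator K' x * (B * norm v)"])
    show "(\<lambda>x. f' x \<bullet> v) \<in> borel_measurable lebesgue"
      by (intro continuous_borel continuous_intros C1_continuous_gradient[OF f])
    show "D n \<in> borel_measurable lebesgue" for n by (rule Dm)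
    show "integrable lebesgue (\<lambda>x. indicator K' x * (B * norm v))"
      by (rule integrable_indicator_compact[OF K'])
    show "AE x in lebesgue. (\<lambda>n. D n x) \<longlonglongrightarrow> f' x \<bullet> v"
    proof (rule AE_I2)
      fix x
      have "((\<lambda>s. f (x + s *\<^sub>R v)) has_real_derivative (f' x \<bullet> v)) (at 0)"
      proof -
        have "((\<lambda>s. x + s *\<^sub>R v) has_derivative (\<lambda>s. s *\<^sub>R v)) (at 0)"
          by (auto intro!: derivative_eq_intros)
        then have "((\<lambda>s. f (x + s *\<^sub>R v)) has_derivative (\<lambda>s. f' x \<bullet> (s *\<^sub>R v))) (at 0)"
          by (rule has_derivative_compose) (simp add: C1_has_derivative[OF f])
        then show ?thesis by (simp add: has_field_derivative_def mult.commute[of _ "f' x \<bullet> v"])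
      qed
      then have "((\<lambda>s. (f (x + s *\<^sub>R v) - f x) / s) \<longlongrightarrow> f' x \<bullet> v) (at 0)"
        by (simp add: has_field_derivative_iff)
      moreover have "filterlim t (at 0) sequentially"
        unfolding filterlim_at t_def using LIMSEQ_inverse_real_of_nat by (auto simp: inverse_eq_divide)
      ultimately show "(\<lambda>n. D n x) \<longlonglongrightarrow> f' x \<bullet> v"
        unfolding D_def by (rule filterlim_compose)
    qed
    show "AE x in lebesgue. norm (D n x) \<le> indicator K' x * (B * norm v)" for n
      using D_bound by auto
  qed
  moreover have "(LINT x|lebesgue. D n x) = 0" for n
  proof -
    have i: "integrable lebesgue f" by (rule integrable_compact_support[OF fc K])
    have i2: "integrable lebesgue (\<lambda>x. f (x + t n *\<^sub>R v))"
    proof -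
      have "integrable lebesgue (\<lambda>x. t n * D n x + f x)"
      proof (intro Bochner_Integration.integrable_add integrable_mult_right i)
        show "integrable lebesgue (D n)"
        proof (rule Bochner_Integration.integrable_bound[OF integrable_indicator_compact[OF K', of "B * norm v"] Dm])
          show "AE x in lebesgue. norm (D n x) \<le> norm (indicator K' x * (B * norm v))"
            using order_trans[OF D_bound abs_ge_self] by (auto intro!: AE_I2)
        qed
      qed
      then show ?thesis using t[of n] by (simp add: D_def)
    qed
    show ?thesis
      unfolding D_def using i i2 integral_translate[OF fc, of "t n *\<^sub>R v"] by simp
  qed
  ultimately show ?thesis
    by (simp add: LIMSEQ_const_iff)
qed

section \<open>Test functions and weak gradients\<close>

lemma test_functions_smooth: "\<phi> \<in> test_functions \<Omega> \<Longrightarrow> smooth \<phi>"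
  by (auto simp: test_functions_def)

lemma test_functions_C1: "\<phi> \<in> test_functions \<Omega> \<Longrightarrow> C1_gradient \<phi> (gradient \<phi>)"
  by (simp add: smooth_C1 test_functions_smooth)

lemma test_functions_support:
  assumes "f \<in> test_functions \<Omega>"
  obtains K where "compact K" "K \<subseteq> \<Omega>" "\<And>x. x \<notin> K \<Longrightarrow> f x = 0"
  by (rule test_functionsE[OF assms]) (rule that)

lemma test_functions_mult:
  assumes "\<phi> \<in> test_functions \<Omega>" "smooth f"
  shows "(\<lambda>x. \<phi> x * f x) \<in> test_functions \<Omega>"
proof -
  obtain K where K: "compact K" "K \<subseteq> \<Omega>" "\<And>x. x \<notin> K \<Longrightarrow> \<phi> x = 0"
    by (rule test_functions_support[OF assms(1)]) (rule that)
  show ?thesis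
    by (rule test_functionsI[OF smooth_mult[OF test_functions_smooth[OF assms(1)] assms(2)] K(1,2)]) (simp add: K(3))
qed

lemma test_functions_bounded:
  assumes "\<phi> \<in> test_functions \<Omega>"
  obtains B where "B > 0" "\<And>x. \<bar>\<phi> x\<bar> \<le> B" "\<And>x. norm (gradient \<phi> x) \<le> B"
proof -
  obtain K where K: "compact K" "K \<subseteq> \<Omega>" "\<And>x. x \<notin> K \<Longrightarrow> \<phi> x = 0"
    by (rule test_functions_support[OF assms]) (rule that)
  note c = test_functions_C1[OF assms]
  obtain B1 where B1: "B1 > 0" "\<And>x. norm (\<phi> x) \<le> B1"
    using compact_support_bounded[OF C1_continuous[OF c] K(1,3)] by blast
  have "\<And>x. x \<notin> K \<Longrightarrow> gradient \<phi> x = 0"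
    using gradient_vanishes[OF c compact_imp_closed[OF K(1)] K(3)] by blast
  then obtain B2 where B2: "B2 > 0" "\<And>x. norm (gradient \<phi> x) \<le> B2"
    using compact_support_bounded[OF C1_continuous_gradient[OF c] K(1)] by blast
  show ?thesis
  proof (rule that[of "max B1 B2"])
    show "\<bar>\<phi> x\<bar> \<le> max B1 B2" "norm (gradient \<phi> x) \<le> max B1 B2" for x
      using B1(2)[of x] B2(2)[of x] by (simp_all add: le_max_iff_disj)
  qed (use B1 in simp)
qed

lemma test_functions_measurable:
  assumes "\<phi> \<in> test_functions \<Omega>"
  shows "\<phi> \<in> borel_measurable (lebesgue_on S)" "gradient \<phi> \<in> borel_measurable (lebesgue_on S)"
  using C1_continuous[OF test_functions_C1[OF assms]] C1_continuous_gradient[OF test_functions_C1[OF assms]]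
  by (auto intro: continuous_borel)

lemma integral_lebesgue_on_cong_support:
  fixes f :: "'a::euclidean_space \<Rightarrow> 'b::euclidean_space"
  assumes "S \<in> sets lebesgue" "T \<in> sets lebesgue" "S \<subseteq> T" "\<And>x. x \<in> T - S \<Longrightarrow> f x = 0"
  shows "(LINT x|lebesgue_on T. f x) = (LINT x|lebesgue_on S. f x)"
    and "integrable (lebesgue_on T) f \<longleftrightarrow> integrable (lebesgue_on S) f"
proof -
  have eq: "(\<lambda>x. if x \<in> T then f x else 0) = (\<lambda>x. if x \<in> S then f x else 0)"
    using assms(3,4) by (intro ext) (metis DiffI subsetD)
  show "(LINT x|lebesgue_on T. f x) = (LINT x|lebesgue_on S. f x)"
    using Lebesgue_Measure.integral_restrict_UNIV[OF assms(1), of f] Lebesgue_Measure.integral_restrict_UNIV[OF assms(2), of f] eq by simp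
  show "integrable (lebesgue_on T) f \<longleftrightarrow> integrable (lebesgue_on S) f"
    using Lebesgue_Measure.integrable_restrict_UNIV[OF assms(1), of f] Lebesgue_Measure.integrable_restrict_UNIV[OF assms(2), of f] eq by simp
qed

lemma integrable_lebesgue_on_subset:
  fixes f :: "'a::euclidean_space \<Rightarrow> 'b::euclidean_space"
  assumes "integrable (lebesgue_on T) f" "S \<in> sets lebesgue" "T \<in> sets lebesgue" "S \<subseteq> T"
  shows "integrable (lebesgue_on S) f"
proof -
  have "set_integrable lebesgue T f"
    using assms by (simp add: set_integrable_def integrable_restrict_space)
  then have "set_integrable lebesgue S f"
    using assms set_integrable_subset by blast
  then show ?thesis using assms by (simp add: set_integrable_def integrable_restrict_space)
qed

lemma compact_lebesgue_sets: "compact K \<Longrightarrow> K \<in> sets lebesgue"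
  by (simp add: compact_imp_closed)

lemma integrable_mult_bounded:
  fixes h \<phi> :: "'a \<Rightarrow> real"
  assumes "integrable M h" "\<phi> \<in> borel_measurable M" "AE x in M. \<bar>\<phi> x\<bar> \<le> B"
  shows "integrable M (\<lambda>x. h x * \<phi> x)"
proof (rule Bochner_Integration.integrable_bound)
  show "integrable M (\<lambda>x. B * h x)" using assms by simp
  show "(\<lambda>x. h x * \<phi> x) \<in> borel_measurable M" using assms by auto
  show "AE x in M. norm (h x * \<phi> x) \<le> norm (B * h x)"
    using assms(3)
  proof eventually_elim
    case (elim x)
    then have "\<bar>\<phi> x\<bar> \<le> \<bar>B\<bar>" by simp
    from mult_left_mono[OF this, of "\<bar>h x\<bar>"] show ?case by (simp add: abs_mult mult.commute)
  qed
qed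

locale bounded_open_set =
  fixes \<Omega> :: "'a::euclidean_space set"
  assumes open_\<Omega>: "open \<Omega>" and bounded_\<Omega>: "bounded \<Omega>"
begin

abbreviation M :: "'a measure" where "M \<equiv> lebesgue_on \<Omega>"

lemma sets_\<Omega> [simp]: "\<Omega> \<in> sets lebesgue"
  by (simp add: open_\<Omega>)

lemma finite_measure_M: "finite_measure M"
  using bounded_\<Omega> open_\<Omega> by (intro finite_measure_lebesgue_on lmeasurable_open)

lemma integrable_const_M: "integrable M (\<lambda>x. c::real)"
  using finite_measure.integrable_const[OF finite_measure_M] .

lemma integrable_bounded_M:
  fixes f :: "'a \<Rightarrow> 'b::euclidean_space"
  assumes "f \<in> borel_measurable M" "AE x in M. norm (f x) \<le> B"
  shows "integrable M f"
  using assms by (intro Bochner_Integration.integrable_bound[OF integrable_const_M[of B]]) auto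

lemma locally_integrableI: "integrable M u \<Longrightarrow> locally_integrable \<Omega> u"
  for u :: "'a \<Rightarrow> 'b::euclidean_space"
  unfolding locally_integrable_def
  using integrable_lebesgue_on_subset[OF _ compact_lebesgue_sets sets_\<Omega>] by blast

lemma locally_integrable_test:
  assumes "locally_integrable \<Omega> (h::'a \<Rightarrow> real)" "\<phi> \<in> borel_measurable lebesgue" "\<And>x. \<bar>\<phi> x\<bar> \<le> B"
    "compact K" "K \<subseteq> \<Omega>" "\<And>x. x \<notin> K \<Longrightarrow> \<phi> x = 0"
  shows "integrable M (\<lambda>x. h x * \<phi> x)"
    and "(LINT x|M. h x * \<phi> x) = (LINT x|lebesgue_on K. h x * \<phi> x)"
proof -
  have "integrable (lebesgue_on K) h" using assms by (simp add: locally_integrable_def)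
  then have "integrable (lebesgue_on K) (\<lambda>x. h x * \<phi> x)"
    using assms by (intro integrable_mult_bounded[of _ _ _ B]) (auto intro: measurable_restrict_space1)
  then show "integrable M (\<lambda>x. h x * \<phi> x)"
    and "(LINT x|M. h x * \<phi> x) = (LINT x|lebesgue_on K. h x * \<phi> x)"
    using integral_lebesgue_on_cong_support[of K \<Omega> "\<lambda>x. h x * \<phi> x"] assms
    by (auto simp: compact_lebesgue_sets)
qed

text \<open>A weak gradient is only required to be locally integrable; this makes the integrals in its
  definition genuine ones.\<close>

lemma locally_integrable_test_function:
  assumes "locally_integrable \<Omega> (h::'a \<Rightarrow> real)" "\<phi> \<in> test_functions \<Omega>"
  shows "integrable M (\<lambda>x. h x * \<phi> x)"
proof -
  obtain K where K: "compact K" "K \<subseteq> \<Omega>" "\<And>x. x \<notin> K \<Longrightarrow> \<phi> x = 0"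
    by (rule test_functions_support[OF assms(2)]) (rule that)
  obtain B where B: "\<And>x. \<bar>\<phi> x\<bar> \<le> B" by (rule test_functions_bounded[OF assms(2)]) (rule that)
  have "\<phi> \<in> borel_measurable lebesgue"
    using test_functions_measurable(1)[OF assms(2), of UNIV] by (simp add: lebesgue_on_UNIV_eq)
  then show ?thesis by (rule locally_integrable_test(1)[OF assms(1) _ B K])
qed

text \<open>A smooth substitute for Urysohn's lemma: a test function that is positive exactly near a
  given compact set.\<close>

lemma test_function_near_compact:
  assumes "compact T" "r > 0" "\<And>t. t \<in> T \<Longrightarrow> cball t r \<subseteq> \<Omega>"
  obtains b where "b \<in> test_functions \<Omega>" "\<And>x. 0 \<le> b x" "\<And>x. b x \<le> 1" "\<And>x. x \<in> T \<Longrightarrow> b x > 0"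
    "\<And>x. b x \<noteq> 0 \<Longrightarrow> \<exists>t\<in>T. dist t x < r"
proof -
  have "T \<subseteq> (\<Union>t\<in>T. ball t r)" using assms(2) by auto
  then obtain D where D: "D \<subseteq> T" "finite D" "T \<subseteq> (\<Union>t\<in>D. ball t r)"
    using compactE_image[OF assms(1), of T "\<lambda>t. ball t r"] by auto
  define s where "s x = (\<Sum>t\<in>D. bump t r x)" for x
  define b where "b x = s x * (1 / (1 + real (card D)))" for x
  have s0: "s x \<ge> 0" for x by (auto simp: s_def bump_nonneg intro!: sum_nonneg)
  have s1: "s x \<le> real (card D)" for x
    using sum_bounded_above[of D "\<lambda>t. bump t r x" 1, OF bump_le_1] by (simp add: s_def)
  have snz: "\<exists>t\<in>D. x \<in> ball t r" if "s x \<noteq> 0" for x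
  proof (rule ccontr)
    assume "\<not> ?thesis"
    then have "bump t r x = 0" if "t \<in> D" for t using that bump_nonzero_iff[OF assms(2), of t x] by blast
    then have "s x = 0" by (simp add: s_def)
    with that show False by simp
  qed
  show ?thesis
  proof (rule that[of b])
    show "b \<in> test_functions \<Omega>"
    proof (rule test_functionsI[of b "\<Union>t\<in>D. cball t r"])
      show "smooth b" unfolding b_def[abs_def] s_def by (intro smooth_mult smooth_sum smooth_bump smooth_const)
      show "compact (\<Union>t\<in>D. cball t r)" using D by auto
      show "(\<Union>t\<in>D. cball t r) \<subseteq> \<Omega>" using D assms by blast
      show "b x = 0" if "x \<notin> (\<Union>t\<in>D. cball t r)" for x
      proof (rule ccontr)
        assume "b x \<noteq> 0"
        then have "s x \<noteq> 0" by (auto simp: b_def)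
        with snz[of x] that show False by force
      qed
    qed
    show "0 \<le> b x" for x using s0 by (simp add: b_def)
    show "b x \<le> 1" for x using s1[of x] by (simp add: b_def)
    show "b x > 0" if x: "x \<in> T" for x
    proof -
      obtain t where t: "t \<in> D" "x \<in> ball t r" using D x by blast
      then have "bump t r x > 0" using bump_pos_iff assms by blast
      then have "s x > 0" unfolding s_def
        using t D by (intro sum_pos2[of D t]) (auto simp: bump_nonneg)
      then show ?thesis by (simp add: b_def)
    qed
    show "\<exists>t\<in>T. dist t x < r" if "b x \<noteq> 0" for x
    proof -
      have "s x \<noteq> 0" using that by (auto simp: b_def)
      with snz D show ?thesis by fastforce
    qed
  qed
qed

text \<open>If \<open>b\<close> is a test function with values in \<open>[0, 1]\<close>, then so is
  \<open>1 - (1 - b)\<^sup>N\<close>, and it tends to the indicator function of \<open>{b > 0}\<close>. Letting these sets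
  shrink to \<open>T\<close> transfers the sign of the integrals from test functions to \<open>T\<close>. Powers of test
  functions have the same limit; the exponent \<open>1\<close> serves the uniqueness of weak gradients, the
  exponent \<open>p\<close> the weight of the eigenvalue problem.\<close>

lemma integral_compact_nonpos:
  fixes h :: "'a \<Rightarrow> real"
  assumes h: "locally_integrable \<Omega> h"
    and test: "\<And>\<phi>. \<phi> \<in> test_functions \<Omega> \<Longrightarrow> (\<And>x. 0 \<le> \<phi> x) \<Longrightarrow> (\<And>x. \<phi> x \<le> 1) \<Longrightarrow> (LINT x|M. h x * \<phi> x powr q) \<le> 0"
    and q: "q > 0"
    and T: "compact T" "T \<subseteq> \<Omega>"
  shows "(LINT x|lebesgue_on T. h x) \<le> 0"
proof -
  obtain r where r: "r > 0" "(\<Union>t\<in>T. cball t r) \<subseteq> \<Omega>"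
    using compact_subset_open_imp_cball_epsilon_subset[OF T(1) open_\<Omega> T(2)] by blast
  define K where "K = (\<Union>t\<in>T. cball t r)"
  have K: "compact K" "K \<subseteq> \<Omega>" "T \<subseteq> K"
  proof -
    have "K = {x + y |x y. x \<in> T \<and> y \<in> cball 0 r}"
    proof (intro set_eqI iffI)
      fix z assume "z \<in> K"
      then obtain t where t: "t \<in> T" "z \<in> cball t r" by (auto simp: K_def)
      then show "z \<in> {x + y |x y. x \<in> T \<and> y \<in> cball 0 r}"
        by (intro CollectI exI[of _ t] exI[of _ "z - t"]) (auto simp: dist_norm norm_minus_commute)
    next
      fix z assume "z \<in> {x + y |x y. x \<in> T \<and> y \<in> cball 0 r}"
      then obtain x y where "z = x + y" "x \<in> T" "norm y \<le> r" by auto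
      then show "z \<in> K" unfolding K_def by (intro UN_I[of x]) (auto simp: dist_norm)
    qed
    then show "compact K" using compact_sums[OF T(1) compact_cball[of 0 r]] by simp
    show "K \<subseteq> \<Omega>" using r by (simp add: K_def)
    show "T \<subseteq> K" unfolding K_def using r by force
  qed
  have hK: "integrable (lebesgue_on K) h" using h K by (simp add: locally_integrable_def)
  define rr where "rr j = r / real (Suc j)" for j
  have rr: "rr j > 0" "rr j \<le> r" for j using r by (auto simp: rr_def field_simps)
  have "\<exists>b. b \<in> test_functions \<Omega> \<and> (\<forall>x. 0 \<le> b x \<and> b x \<le> 1 \<and> (x \<in> T \<longrightarrow> b x > 0) \<and>
      (b x \<noteq> 0 \<longrightarrow> (\<exists>t\<in>T. dist t x < rr j)))" for j
  proof -
    have "cball t (rr j) \<subseteq> \<Omega>" if "t \<in> T" for t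
      using r(2) that rr(2)[of j] subset_cball[of "rr j" r t] by blast
    then obtain b where "b \<in> test_functions \<Omega>" "\<And>x. 0 \<le> b x" "\<And>x. b x \<le> 1" "\<And>x. x \<in> T \<Longrightarrow> b x > 0"
      "\<And>x. b x \<noteq> 0 \<Longrightarrow> \<exists>t\<in>T. dist t x < rr j"
      using test_function_near_compact[OF T(1) rr(1)[of j]] by metis
    then show ?thesis by blast
  qed
  then obtain b where b: "\<And>j. b j \<in> test_functions \<Omega>" "\<And>j x. 0 \<le> b j x" "\<And>j x. b j x \<le> 1"
    "\<And>j x. x \<in> T \<Longrightarrow> b j x > 0" "\<And>j x. b j x \<noteq> 0 \<Longrightarrow> \<exists>t\<in>T. dist t x < rr j"
    by metis
  have bK: "b j x = 0" if "x \<notin> K" for j x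
  proof (rule ccontr)
    assume "b j x \<noteq> 0"
    then obtain t where "t \<in> T" "dist t x < rr j" using b(5) by blast
    then have "x \<in> K" using rr(2)[of j] by (force simp: K_def)
    with that show False by simp
  qed
  define W where "W j = {x. b j x > 0}" for j
  have bm: "b j \<in> borel_measurable (lebesgue_on S)" for j S
    by (rule test_functions_measurable(1)[OF b(1)])
  have Wm: "(indicator (W j) :: 'a \<Rightarrow> real) \<in> borel_measurable (lebesgue_on K)" for j
  proof -
    have "(\<lambda>x. if b j x > 0 then 1 else 0 :: real) \<in> borel_measurable (lebesgue_on K)"
      using bm[of j K] by measurable
    moreover have "(indicator (W j) :: 'a \<Rightarrow> real) = (\<lambda>x. if b j x > 0 then 1 else 0)"
      by (auto simp: W_def)
    ultimately show ?thesis by simp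
  qed
  have W: "(LINT x|lebesgue_on K. h x * indicator (W j) x) \<le> 0" for j
  proof -
    \<comment> \<open>The geometric sum is \<open>1 - (1 - b)\<^sup>N\<close>; in this form compact support is evident.\<close>
    define \<phi> where "\<phi> N x = b j x * (\<Sum>i<N. (1 - b j x) ^ i)" for N x
    have \<phi>: "\<phi> N x = 1 - (1 - b j x) ^ N" for N x
      using one_diff_power_eq[of "1 - b j x" N] by (simp add: \<phi>_def)
    have \<phi>_test: "\<phi> N \<in> test_functions \<Omega>" for N
      unfolding \<phi>_def[abs_def]
      by (intro test_functions_mult b smooth_sum smooth_power smooth_diff smooth_const test_functions_smooth[OF b(1)])
    have \<phi>01: "0 \<le> \<phi> N x" "\<phi> N x \<le> 1" for N x
      using b(2,3)[of j x] power_le_one[of "1 - b j x" N] by (auto simp: \<phi>)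
    have \<phi>q01: "0 \<le> \<phi> N x powr q" "\<phi> N x powr q \<le> 1" for N x
      using \<phi>01[of N x] q powr_mono2[of q "\<phi> N x" 1] by auto
    have \<phi>K: "\<phi> N x = 0" if "x \<notin> K" for N x using bK[OF that] by (simp add: \<phi>_def)
    have \<phi>m: "\<phi> N \<in> borel_measurable (lebesgue_on S)" for N S
      by (rule test_functions_measurable(1)[OF \<phi>_test])
    have "(\<lambda>N. LINT x|lebesgue_on K. h x * \<phi> N x powr q) \<longlonglongrightarrow> (LINT x|lebesgue_on K. h x * indicator (W j) x)"
    proof (rule integral_dominated_convergence[where w="\<lambda>x. \<bar>h x\<bar>"])
      show "(\<lambda>x. h x * indicator (W j) x) \<in> borel_measurable (lebesgue_on K)"
        "(\<lambda>x. h x * \<phi> N x powr q) \<in> borel_measurable (lebesgue_on K)" for N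
        using hK Wm \<phi>m[of N K] by measurable
      show "integrable (lebesgue_on K) (\<lambda>x. \<bar>h x\<bar>)" using hK by simp
      show "AE x in lebesgue_on K. (\<lambda>N. h x * \<phi> N x powr q) \<longlonglongrightarrow> h x * indicator (W j) x"
      proof (intro AE_I2 tendsto_mult_left)
        fix x
        show "(\<lambda>N. \<phi> N x powr q) \<longlonglongrightarrow> indicator (W j) x"
        proof (cases "b j x = 0")
          case False
          then have "b j x > 0" using b(2)[of j x] by simp
          then have "(\<lambda>N. (1 - b j x) ^ N) \<longlonglongrightarrow> 0"
            using b(3)[of j x] \<open>b j x > 0\<close> by (intro LIMSEQ_power_zero) (simp add: abs_if)
          then have "(\<lambda>N. 1 - (1 - b j x) ^ N) \<longlonglongrightarrow> 1 - 0" by (rule tendsto_diff[OF tendsto_const])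
          then have "(\<lambda>N. \<phi> N x powr q) \<longlonglongrightarrow> 1 powr q"
            by (intro tendsto_powr tendsto_const) (simp_all add: \<phi>)
          then show ?thesis using \<open>b j x > 0\<close> by (simp add: W_def)
        qed (use q in \<open>simp add: \<phi>_def W_def\<close>)
      qed
      show "AE x in lebesgue_on K. norm (h x * \<phi> N x powr q) \<le> \<bar>h x\<bar>" for N
        using \<phi>q01 by (intro AE_I2) (auto simp: abs_mult intro!: mult_left_le)
    qed
    moreover have "(LINT x|lebesgue_on K. h x * \<phi> N x powr q) \<le> 0" for N
    proof -
      have "(LINT x|M. h x * \<phi> N x powr q) = (LINT x|lebesgue_on K. h x * \<phi> N x powr q)"
      proof (rule locally_integrable_test(2)[OF h _ _ K(1,2), where B=1])
        show "(\<lambda>x. \<phi> N x powr q) \<in> borel_measurable lebesgue"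
          using \<phi>m[of N UNIV] unfolding lebesgue_on_UNIV_eq by measurable
      qed (use \<phi>q01 \<phi>K q in auto)
      then show ?thesis using test[OF \<phi>_test[of N]] \<phi>01 by auto
    qed
    ultimately show ?thesis using LIMSEQ_le_const2 by blast
  qed
  have "(\<lambda>j. LINT x|lebesgue_on K. h x * indicator (W j) x) \<longlonglongrightarrow> (LINT x|lebesgue_on K. h x * indicator T x)"
  proof (rule integral_dominated_convergence[where w="\<lambda>x. \<bar>h x\<bar>"])
    have "T \<in> sets (lebesgue_on K)" using T K by (auto simp: sets_restrict_space_iff compact_lebesgue_sets)
    then have "(indicator T :: 'a \<Rightarrow> real) \<in> borel_measurable (lebesgue_on K)" by simp
    then show "(\<lambda>x. h x * indicator T x) \<in> borel_measurable (lebesgue_on K)"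
      "(\<lambda>x. h x * indicator (W j) x) \<in> borel_measurable (lebesgue_on K)" for j
      using hK Wm by auto
    show "integrable (lebesgue_on K) (\<lambda>x. \<bar>h x\<bar>)" using hK by simp
    show "AE x in lebesgue_on K. (\<lambda>j. h x * indicator (W j) x) \<longlonglongrightarrow> h x * indicator T x"
    proof (intro AE_I2 tendsto_mult_left)
      fix x
      show "(\<lambda>j. indicator (W j) x :: real) \<longlonglongrightarrow> indicator T x"
      proof (cases "x \<in> T")
        case True
        then show ?thesis using b(4) by (simp add: W_def)
      next
        case False
        have "open (- T)" using T compact_imp_closed by blast
        with False obtain e where e: "e > 0" "ball x e \<subseteq> - T"
          using open_contains_ball by (metis Compl_iff)
        have "rr \<longlonglongrightarrow> 0" unfolding rr_def
          using LIMSEQ_inverse_real_of_nat[THEN tendsto_mult_left, of r] by (simp add: divide_inverse)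
        then have "\<forall>\<^sub>F j in sequentially. rr j < e" using e(1) order_tendstoD(2) by blast
        then have "\<forall>\<^sub>F j in sequentially. (indicator (W j) x :: real) = 0"
        proof eventually_elim
          case (elim j)
          have "b j x = 0"
          proof (rule ccontr)
            assume "b j x \<noteq> 0"
            then obtain t where "t \<in> T" "dist t x < rr j" using b(5) by blast
            with e elim show False by (auto simp: dist_commute subset_iff)
          qed
          then show ?case by (simp add: W_def)
        qed
        then show ?thesis using False by (simp add: tendsto_eventually)
      qed
    qed
    show "AE x in lebesgue_on K. norm (h x * indicator (W j) x) \<le> \<bar>h x\<bar>" for j
      by (intro AE_I2) (auto simp: indicator_def)
  qed
  then have "(LINT x|lebesgue_on K. h x * indicator T x) \<le> 0"
    by (rule LIMSEQ_le_const2) (use W in auto)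
  moreover have "(LINT x|lebesgue_on K. h x * indicator T x) = (LINT x|lebesgue_on T. h x * indicator T x)"
    using K T by (intro integral_lebesgue_on_cong_support(1)) (auto simp: compact_lebesgue_sets)
  moreover have "(LINT x|lebesgue_on T. h x * indicator T x) = (LINT x|lebesgue_on T. h x)"
    by (intro Bochner_Integration.integral_cong) auto
  ultimately show ?thesis by simp
qed

text \<open>The fundamental lemma of the calculus of variations in a one-sided form. A set
  \<open>{h > 0}\<close> of positive measure would contain a compact set of positive measure, on which \<open>h\<close>
  would have a positive integral.\<close>

lemma nonpos_if_tests_nonpos:
  fixes h :: "'a \<Rightarrow> real"
  assumes h: "locally_integrable \<Omega> h"
    and test: "\<And>\<phi>. \<phi> \<in> test_functions \<Omega> \<Longrightarrow> (\<And>x. 0 \<le> \<phi> x) \<Longrightarrow> (\<And>x. \<phi> x \<le> 1) \<Longrightarrow> (LINT x|M. h x * \<phi> x powr q) \<le> 0"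
    and q: "q > 0"
  shows "AE x in M. h x \<le> 0"
proof -
  have *: "{x \<in> K. h x > 0} \<in> null_sets lebesgue" if K: "compact K" "K \<subseteq> \<Omega>" for K
  proof -
    define S where "S = {x \<in> K. h x > 0}"
    have hK: "integrable (lebesgue_on K) h" using h K by (simp add: locally_integrable_def)
    then have "{x \<in> space (lebesgue_on K). h x > 0} \<in> sets (lebesgue_on K)" by measurable
    then have S: "S \<in> sets lebesgue"
      using K by (auto simp: S_def sets_restrict_space_iff compact_lebesgue_sets)
    have null: "T \<in> null_sets lebesgue" if T: "closed T" "T \<subseteq> S" for T
    proof -
      have Tc: "compact T" "T \<subseteq> K" using T K by (auto simp: S_def compact_Int_closed compact_eq_bounded_closed intro: bounded_subset)
      then have hT: "integrable (lebesgue_on T) h"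
        using integrable_lebesgue_on_subset[OF hK] K by (simp add: compact_lebesgue_sets)
      have "(LINT x|lebesgue_on T. h x) \<le> 0"
        using integral_compact_nonpos[OF h test q Tc(1)] Tc K by blast
      moreover have pos: "AE x in lebesgue_on T. 0 \<le> h x"
        using T by (intro AE_I2) (auto simp: S_def intro: less_imp_le)
      ultimately have "(LINT x|lebesgue_on T. h x) = 0"
        using integral_nonneg_AE[OF pos] by linarith
      then have "AE x in lebesgue_on T. h x = 0"
        using integral_nonneg_eq_0_iff_AE[OF hT pos] by blast
      moreover have "AE x in lebesgue_on T. h x \<noteq> 0"
        using T by (intro AE_I2) (auto simp: S_def)
      ultimately have "AE x in lebesgue_on T. False" by eventually_elim auto
      then have "AE x in lebesgue. x \<notin> T"
        using Tc by (simp add: AE_restrict_space_iff compact_lebesgue_sets)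
      then show ?thesis using Tc by (simp add: AE_iff_null_sets compact_lebesgue_sets)
    qed
    have "emeasure lebesgue S \<le> ennreal e" if "e > 0" for e
    proof -
      obtain T where T: "closed T" "T \<subseteq> S" "S - T \<in> lmeasurable" "emeasure lebesgue (S - T) < ennreal e"
        using sets_lebesgue_inner_closed[OF S \<open>e > 0\<close>] by blast
      have "emeasure lebesgue S \<le> emeasure lebesgue (S - T)"
        using null[OF T(1,2)] S by (simp add: emeasure_Diff_null_set)
      then show ?thesis using T(4) by simp
    qed
    then have "emeasure lebesgue S = 0"
      by (metis ennreal_0 ennreal_le_epsilon add_0 zero_le order_antisym)
    then show ?thesis using S by (auto simp: S_def null_sets_def)
  qed
  have "\<exists>C::nat \<Rightarrow> 'a set. (\<forall>n. compact (C n)) \<and> (\<forall>n. C n \<subseteq> \<Omega>) \<and> \<Union>(range C) = \<Omega>"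
    by (rule open_Union_compact_subsets[OF open_\<Omega>]) iprover
  then obtain C :: "nat \<Rightarrow> 'a set" where "\<forall>n. compact (C n)" "\<forall>n. C n \<subseteq> \<Omega>"
    and C3: "\<Union>(range C) = \<Omega>"
    by (elim exE conjE)
  then have C: "\<And>n. compact (C n)" "\<And>n. C n \<subseteq> \<Omega>" by auto
  have "(\<Union>n. {x \<in> C n. h x > 0}) \<in> null_sets lebesgue"
    using *[OF C(1,2)] by (intro null_sets_UN) auto
  moreover have "{x \<in> \<Omega>. \<not> h x \<le> 0} \<subseteq> (\<Union>n. {x \<in> C n. h x > 0})" using C3 by auto
  ultimately have "AE x in lebesgue. x \<in> \<Omega> \<longrightarrow> h x \<le> 0"
    by (intro AE_I'[of "\<Union>n. {x \<in> C n. h x > 0}"]) auto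
  then show ?thesis by (simp add: AE_restrict_space_iff)
qed

end

context bounded_open_set
begin

lemma integral_M_eq_lebesgue:
  fixes f :: "'a \<Rightarrow> real"
  assumes "K \<subseteq> \<Omega>" "\<And>x. x \<notin> K \<Longrightarrow> f x = 0"
  shows "(LINT x|M. f x) = (LINT x|lebesgue. f x)" "integrable M f \<longleftrightarrow> integrable lebesgue f"
proof -
  have "f x = 0" if "x \<notin> \<Omega>" for x using assms that by blast
  then show "(LINT x|M. f x) = (LINT x|lebesgue. f x)" "integrable M f \<longleftrightarrow> integrable lebesgue f"
    using integral_lebesgue_on_cong_support[of \<Omega> UNIV f] by (simp_all add: lebesgue_on_UNIV_eq)
qed

lemma integrable_continuous_M:
  fixes f :: "'a \<Rightarrow> 'b::euclidean_space"
  assumes "continuous_on UNIV f"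
  shows "integrable M f"
proof -
  have "bounded (f ` closure \<Omega>)"
    using assms bounded_\<Omega> by (meson bounded_closure closed_closure compact_continuous_image compact_eq_bounded_closed
        compact_imp_bounded continuous_on_subset subset_UNIV)
  then obtain B where B: "\<And>x. x \<in> closure \<Omega> \<Longrightarrow> norm (f x) \<le> B" by (auto simp: bounded_iff)
  show ?thesis
    using B closure_subset by (intro integrable_bounded_M[of _ B] AE_I2 continuous_borel assms) auto
qed

lemma is_weak_gradient_C1:
  assumes f: "C1_gradient f f'"
  shows "is_weak_gradient \<Omega> f f'"
  unfolding is_weak_gradient_def
proof (intro conjI ballI)
  note c = C1_continuous[OF f] C1_continuous_gradient[OF f]
  show "locally_integrable \<Omega> f" "locally_integrable \<Omega> f'"
    by (intro locally_integrableI integrable_continuous_M c)+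
  fix \<phi> :: "'a \<Rightarrow> real" and b :: 'a
  assume \<phi>: "\<phi> \<in> test_functions \<Omega>"
  obtain K where K: "compact K" "K \<subseteq> \<Omega>" "\<And>x. x \<notin> K \<Longrightarrow> \<phi> x = 0"
    by (rule test_functions_support[OF \<phi>]) (rule that)
  note \<phi>C = test_functions_C1[OF \<phi>]
  note c\<phi> = C1_continuous[OF \<phi>C] C1_continuous_gradient[OF \<phi>C]
  have K': "\<And>x. x \<notin> K \<Longrightarrow> gradient \<phi> x = 0"
    by (rule gradient_vanishes[OF \<phi>C compact_imp_closed[OF K(1)] K(3)])
  have "(LINT x|lebesgue. (f x *\<^sub>R gradient \<phi> x + \<phi> x *\<^sub>R f' x) \<bullet> b) = 0"
    by (rule integral_gradient_zero[OF C1_mult[OF f \<phi>C] K(1)]) (simp add: K)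
  then have "0 = (LINT x|M. (f x *\<^sub>R gradient \<phi> x + \<phi> x *\<^sub>R f' x) \<bullet> b)"
    by (subst integral_M_eq_lebesgue(1)[OF K(2)]) (auto simp: K(3) K')
  also have "\<dots> = (LINT x|M. f x * (gradient \<phi> x \<bullet> b) + (f' x \<bullet> b) * \<phi> x)"
    by (simp add: inner_add_left mult.commute)
  also have "\<dots> = (LINT x|M. f x * (gradient \<phi> x \<bullet> b)) + (LINT x|M. (f' x \<bullet> b) * \<phi> x)"
    by (intro Bochner_Integration.integral_add integrable_continuous_M continuous_on_mult continuous_on_inner
        continuous_on_const c c\<phi>)
  finally show "(LINT x|M. f x * frechet_derivative \<phi> (at x) b) = - (LINT x|M. (f' x \<bullet> b) * \<phi> x)"
    by (simp add: C1_frechet[OF \<phi>C])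
qed

lemma locally_integrable_diff:
  fixes u v :: "'a \<Rightarrow> 'b::euclidean_space"
  assumes "locally_integrable \<Omega> u" "locally_integrable \<Omega> v"
  shows "locally_integrable \<Omega> (\<lambda>x. u x - v x)"
  unfolding locally_integrable_def
proof (intro allI impI)
  fix K assume "compact K \<and> K \<subseteq> \<Omega>"
  with assms have "integrable (lebesgue_on K) u" "integrable (lebesgue_on K) v"
    by (simp_all add: locally_integrable_def)
  then show "integrable (lebesgue_on K) (\<lambda>x. u x - v x)" by (rule Bochner_Integration.integrable_diff)
qed

lemma weak_gradient_unique:
  assumes "is_weak_gradient \<Omega> u g" "is_weak_gradient \<Omega> u g'"
  shows "AE x in M. g x = g' x"
proof -
  have le: "AE x in M. (g x - g' x) \<bullet> b \<le> 0"
    if b: "b \<in> Basis" and "is_weak_gradient \<Omega> u g" "is_weak_gradient \<Omega> u g'" for b g g'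
  proof (rule nonpos_if_tests_nonpos[where q=1])
    have loc: "locally_integrable \<Omega> (\<lambda>x. g x \<bullet> b)" "locally_integrable \<Omega> (\<lambda>x. g' x \<bullet> b)"
      using that by (auto simp: is_weak_gradient_def locally_integrable_def)
    show "locally_integrable \<Omega> (\<lambda>x. (g x - g' x) \<bullet> b)"
      unfolding inner_diff_left by (rule locally_integrable_diff[OF loc])
    fix \<phi> assume \<phi>: "\<phi> \<in> test_functions \<Omega>" and \<phi>0: "\<And>x. 0 \<le> \<phi> x"
    have "(LINT x|M. (g x \<bullet> b) * \<phi> x) = (LINT x|M. (g' x \<bullet> b) * \<phi> x)"
    proof -
      have "(LINT x|M. u x * frechet_derivative \<phi> (at x) b) = - (LINT x|M. (g x \<bullet> b) * \<phi> x)"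
        using that(2) \<phi> b by (simp add: is_weak_gradient_def)
      moreover have "(LINT x|M. u x * frechet_derivative \<phi> (at x) b) = - (LINT x|M. (g' x \<bullet> b) * \<phi> x)"
        using that(3) \<phi> b by (simp add: is_weak_gradient_def)
      ultimately show ?thesis by simp
    qed
    moreover have "(LINT x|M. (g x - g' x) \<bullet> b * \<phi> x) = (LINT x|M. (g x \<bullet> b) * \<phi> x) - (LINT x|M. (g' x \<bullet> b) * \<phi> x)"
      using locally_integrable_test_function[OF loc(1) \<phi>] locally_integrable_test_function[OF loc(2) \<phi>]
      by (simp add: inner_diff_left left_diff_distrib)
    ultimately show "(LINT x|M. (g x - g' x) \<bullet> b * \<phi> x powr 1) \<le> 0" using \<phi>0 by simp
  qed simp
  have "AE x in M. \<forall>b\<in>Basis. (g x - g' x) \<bullet> b \<le> 0 \<and> (g' x - g x) \<bullet> b \<le> 0"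
  proof (rule AE_finite_allI)
    fix b :: 'a assume b: "b \<in> Basis"
    show "AE x in M. (g x - g' x) \<bullet> b \<le> 0 \<and> (g' x - g x) \<bullet> b \<le> 0"
      using le[OF b assms] le[OF b assms(2,1)] by eventually_elim simp
  qed simp
  then show ?thesis
  proof eventually_elim
    case (elim x)
    show ?case
    proof (rule euclidean_eqI)
      fix b :: 'a assume "b \<in> Basis"
      with elim have "(g x - g' x) \<bullet> b \<le> 0 \<and> (g' x - g x) \<bullet> b \<le> 0" by blast
      then show "g x \<bullet> b = g' x \<bullet> b" by (simp add: inner_diff_left)
    qed
  qed
qed

lemma weak_gradient_AE:
  assumes "is_weak_gradient \<Omega> u g"
  shows "is_weak_gradient \<Omega> u (weak_gradient \<Omega> u)" "AE x in M. weak_gradient \<Omega> u x = g x"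
proof -
  show *: "is_weak_gradient \<Omega> u (weak_gradient \<Omega> u)"
    unfolding weak_gradient_def by (rule someI[of _ g]) (rule assms)
  show "AE x in M. weak_gradient \<Omega> u x = g x" by (rule weak_gradient_unique[OF * assms])
qed

lemma tendsto_integral_mult_bounded:
  fixes v :: "'a \<Rightarrow> real"
  assumes "\<And>n. integrable M (vn n)" "integrable M v" "(\<lambda>n. LINT x|M. \<bar>vn n x - v x\<bar>) \<longlonglongrightarrow> 0"
    "D \<in> borel_measurable M" "\<And>x. \<bar>D x\<bar> \<le> B"
  shows "(\<lambda>n. LINT x|M. vn n x * D x) \<longlonglongrightarrow> (LINT x|M. v x * D x)"
proof -
  have i: "integrable M (\<lambda>x. vn n x * D x)" "integrable M (\<lambda>x. v x * D x)" for n
    using integrable_mult_bounded[OF assms(1) assms(4), of B] integrable_mult_bounded[OF assms(2,4), of B] assms(5) by auto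
  have "\<bar>(LINT x|M. vn n x * D x) - (LINT x|M. v x * D x)\<bar> \<le> B * (LINT x|M. \<bar>vn n x - v x\<bar>)" for n
  proof -
    have "\<bar>(LINT x|M. vn n x * D x) - (LINT x|M. v x * D x)\<bar> = \<bar>LINT x|M. (vn n x - v x) * D x\<bar>"
      using i by (simp add: left_diff_distrib)
    also have "\<dots> \<le> (LINT x|M. \<bar>(vn n x - v x) * D x\<bar>)" by (rule integral_abs_bound)
    also have "\<dots> \<le> (LINT x|M. B * \<bar>vn n x - v x\<bar>)"
    proof (rule integral_mono')
      show "\<bar>(vn n x - v x) * D x\<bar> \<le> B * \<bar>vn n x - v x\<bar>" for x
        using mult_left_mono[OF assms(5)[of x], of "\<bar>vn n x - v x\<bar>"] by (simp add: abs_mult mult.commute)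
      show "0 \<le> B * \<bar>vn n x - v x\<bar>" for x using order_trans[OF abs_ge_zero assms(5)[of x]] by simp
    qed (use assms in auto)
    finally show ?thesis by simp
  qed
  then have "\<forall>n. norm ((LINT x|M. vn n x * D x) - (LINT x|M. v x * D x)) \<le> B * (LINT x|M. \<bar>vn n x - v x\<bar>)"
    by simp
  moreover have "(\<lambda>n. B * (LINT x|M. \<bar>vn n x - v x\<bar>)) \<longlonglongrightarrow> 0"
    by (rule tendsto_mult_right_zero[OF assms(3)])
  ultimately have "(\<lambda>n. (LINT x|M. vn n x * D x) - (LINT x|M. v x * D x)) \<longlonglongrightarrow> 0"
    by (rule Lim_null_comparison[OF always_eventually])
  then show ?thesis by (rule LIM_zero_cancel)
qed

text \<open>Both sides of the defining identity are continuous with respect to convergence in \<open>L\<^sup>1\<close>,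
  since test functions and their gradients are bounded.\<close>

lemma is_weak_gradient_limit:
  assumes "\<And>n. is_weak_gradient \<Omega> (un n) (gn n)" "\<And>n. integrable M (un n)" "\<And>n. integrable M (gn n)"
    and "integrable M u" "integrable M g"
    and "(\<lambda>n. LINT x|M. \<bar>un n x - u x\<bar>) \<longlonglongrightarrow> 0" "(\<lambda>n. LINT x|M. norm (gn n x - g x)) \<longlonglongrightarrow> 0"
  shows "is_weak_gradient \<Omega> u g"
  unfolding is_weak_gradient_def
proof (intro conjI ballI)
  show "locally_integrable \<Omega> u" "locally_integrable \<Omega> g" by (intro locally_integrableI assms)+
  fix \<phi> :: "'a \<Rightarrow> real" and b :: 'a
  assume \<phi>: "\<phi> \<in> test_functions \<Omega>" and b: "b \<in> Basis"
  obtain B where B: "B > 0" "\<And>x. \<bar>\<phi> x\<bar> \<le> B" "\<And>x. norm (gradient \<phi> x) \<le> B"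
    by (rule test_functions_bounded[OF \<phi>]) (rule that)
  have fr: "frechet_derivative \<phi> (at x) b = gradient \<phi> x \<bullet> b" for x
    by (rule C1_frechet[OF test_functions_C1[OF \<phi>]])
  have m: "(\<lambda>x. frechet_derivative \<phi> (at x) b) \<in> borel_measurable M" "\<phi> \<in> borel_measurable M"
    using test_functions_measurable[OF \<phi>] unfolding fr by auto
  have "\<bar>frechet_derivative \<phi> (at x) b\<bar> \<le> B" for x
    unfolding fr using Basis_le_norm[OF b, of "gradient \<phi> x"] B(3)[of x] by linarith
  then have 1: "(\<lambda>n. LINT x|M. un n x * frechet_derivative \<phi> (at x) b) \<longlonglongrightarrow> (LINT x|M. u x * frechet_derivative \<phi> (at x) b)"
    using tendsto_integral_mult_bounded[OF assms(2,4,6) m(1), of B] by blast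
  have "(\<lambda>n. LINT x|M. \<bar>gn n x \<bullet> b - g x \<bullet> b\<bar>) \<longlonglongrightarrow> 0"
  proof (rule Lim_null_comparison[OF _ assms(7)], intro always_eventually allI)
    fix n
    have "(LINT x|M. \<bar>gn n x \<bullet> b - g x \<bullet> b\<bar>) \<le> (LINT x|M. norm (gn n x - g x))"
      using Basis_le_norm[OF b] assms by (intro integral_mono') (auto simp flip: inner_diff_left)
    then show "norm (LINT x|M. \<bar>gn n x \<bullet> b - g x \<bullet> b\<bar>) \<le> (LINT x|M. norm (gn n x - g x))" by simp
  qed
  then have 2: "(\<lambda>n. LINT x|M. (gn n x \<bullet> b) * \<phi> x) \<longlonglongrightarrow> (LINT x|M. (g x \<bullet> b) * \<phi> x)"
    using assms B(2) m(2) by (intro tendsto_integral_mult_bounded[where B=B]) auto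
  have "(LINT x|M. un n x * frechet_derivative \<phi> (at x) b) = - (LINT x|M. (gn n x \<bullet> b) * \<phi> x)" for n
    using assms(1)[of n] \<phi> b by (simp add: is_weak_gradient_def)
  then show "(LINT x|M. u x * frechet_derivative \<phi> (at x) b) = - (LINT x|M. (g x \<bullet> b) * \<phi> x)"
    using LIMSEQ_unique[OF 1] tendsto_minus[OF 2] by simp
qed

lemma is_weak_gradient_diff:
  assumes "is_weak_gradient \<Omega> u g" "is_weak_gradient \<Omega> v h"
    and "integrable M u" "integrable M g" "integrable M v" "integrable M h"
  shows "is_weak_gradient \<Omega> (\<lambda>x. u x - v x) (\<lambda>x. g x - h x)"
  unfolding is_weak_gradient_def
proof (intro conjI ballI)
  show "locally_integrable \<Omega> (\<lambda>x. u x - v x)" "locally_integrable \<Omega> (\<lambda>x. g x - h x)"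
    using assms by (auto intro: locally_integrableI)
  fix \<phi> :: "'a \<Rightarrow> real" and b :: 'a
  assume \<phi>: "\<phi> \<in> test_functions \<Omega>" and b: "b \<in> Basis"
  obtain B where B: "B > 0" "\<And>x. \<bar>\<phi> x\<bar> \<le> B" "\<And>x. norm (gradient \<phi> x) \<le> B"
    by (rule test_functions_bounded[OF \<phi>]) (rule that)
  have fr: "frechet_derivative \<phi> (at x) b = gradient \<phi> x \<bullet> b" for x
    by (rule C1_frechet[OF test_functions_C1[OF \<phi>]])
  have m: "(\<lambda>x. frechet_derivative \<phi> (at x) b) \<in> borel_measurable M" "\<phi> \<in> borel_measurable M"
    using test_functions_measurable[OF \<phi>] unfolding fr by auto
  have Bd: "\<bar>frechet_derivative \<phi> (at x) b\<bar> \<le> B" for x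
    unfolding fr using Basis_le_norm[OF b, of "gradient \<phi> x"] B(3)[of x] by linarith
  have i: "integrable M (\<lambda>x. w x * frechet_derivative \<phi> (at x) b)" "integrable M (\<lambda>x. w x * \<phi> x)"
    if "integrable M w" for w
    using integrable_mult_bounded[OF that m(1), of B] integrable_mult_bounded[OF that m(2), of B] Bd B(2) by auto
  have i': "integrable M (\<lambda>x. (g x \<bullet> b) * \<phi> x)" "integrable M (\<lambda>x. (h x \<bullet> b) * \<phi> x)"
    using assms by (auto intro: i(2))
  show "(LINT x|M. (u x - v x) * frechet_derivative \<phi> (at x) b) = - (LINT x|M. ((g x - h x) \<bullet> b) * \<phi> x)"
    using assms(1,2) \<phi> b i(1)[OF assms(3)] i(1)[OF assms(5)] i'
    by (simp add: is_weak_gradient_def left_diff_distrib inner_diff_left)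
qed

end

section \<open>Convergence in \<open>L\<^sup>p\<close>\<close>

text \<open>With \<open>\<kappa>\<close> small the factor of \<open>s\<^sup>p\<close> is close to \<open>1\<close>, which is the form in which the continuity
  of the \<open>L\<^sup>p\<close> norm is used later; \<open>\<kappa> = 1\<close> is the quasi-triangle inequality.\<close>

lemma powr_add_le:
  fixes s t \<kappa> p :: real
  assumes "s \<ge> 0" "t \<ge> 0" "\<kappa> > 0" "p > 0"
  shows "(s + t) powr p \<le> (1 + \<kappa>) powr p * s powr p + (1 + 1 / \<kappa>) powr p * t powr p"
proof (cases "t \<le> \<kappa> * s")
  case True
  have "(s + t) powr p \<le> ((1 + \<kappa>) * s) powr p"
    using True assms by (intro powr_mono2) (auto simp: algebra_simps)
  then show ?thesis using assms by (simp add: powr_mult add_increasing2)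
next
  case False
  then have "s \<le> t / \<kappa>" using assms by (simp add: pos_le_divide_eq mult.commute)
  then have "(s + t) powr p \<le> ((1 + 1 / \<kappa>) * t) powr p"
    using assms by (intro powr_mono2) (auto simp: algebra_simps)
  moreover have "((1 + 1 / \<kappa>) * t) powr p = (1 + 1 / \<kappa>) powr p * t powr p"
    using assms by (intro powr_mult)
  moreover have "0 \<le> (1 + \<kappa>) powr p * s powr p" by simp
  ultimately show ?thesis by linarith
qed

lemma norm_add_powr_le:
  fixes a b :: "'a::real_normed_vector"
  assumes "\<kappa> > 0" "p > 0"
  shows "norm (a + b) powr p \<le> (1 + \<kappa>) powr p * norm a powr p + (1 + 1 / \<kappa>) powr p * norm b powr p"
proof -
  have "norm (a + b) powr p \<le> (norm a + norm b) powr p"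
    using assms by (intro powr_mono2 norm_triangle_ineq) auto
  then show ?thesis using powr_add_le[of "norm a" "norm b" \<kappa> p] assms by simp
qed

text \<open>This plays the part of Hoelder's inequality on a finite measure space: an integral of \<open>s\<close> is small if
  that of \<open>s\<^sup>p\<close> is, as \<open>\<kappa>\<close> may be chosen first.\<close>

lemma le_powr_add:
  fixes s \<kappa> p :: real
  assumes "s \<ge> 0" "\<kappa> > 0" "p \<ge> 1"
  shows "s \<le> \<kappa> + \<kappa> powr (1 - p) * s powr p"
proof (cases "s \<le> \<kappa>")
  case False
  have "s = s powr (1 - p) * s powr p"
    using False assms by (simp flip: powr_add)
  also have "\<dots> \<le> \<kappa> powr (1 - p) * s powr p"
    using False assms by (intro mult_right_mono powr_mono2') auto
  finally show ?thesis using assms by linarith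
next
  case True
  then show ?thesis by (simp add: add_increasing2)
qed

definition Lp_tendsto ::
  "'a measure \<Rightarrow> real \<Rightarrow> (nat \<Rightarrow> 'a \<Rightarrow> 'b::euclidean_space) \<Rightarrow> ('a \<Rightarrow> 'b) \<Rightarrow> bool" where
  "Lp_tendsto N p fn f \<longleftrightarrow> (\<lambda>n. LINT x|N. norm (fn n x - f x) powr p) \<longlonglongrightarrow> 0"

locale sobolev_setting = bounded_open_set +
  fixes p :: real
  assumes p_gt_1: "p > 1"
begin

lemma p_pos: "p > 0" "p \<ge> 0" "p \<noteq> 0" "p \<ge> 1"
  using p_gt_1 by auto

lemma LpD:
  assumes "f \<in> Lp p \<Omega>"
  shows "f \<in> borel_measurable M" "integrable M (\<lambda>x. norm (f x) powr p)"
  using assms by (auto simp: Lp_def)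

lemma LpI:
  "f \<in> borel_measurable M \<Longrightarrow> integrable M (\<lambda>x. norm (f x) powr p) \<Longrightarrow> f \<in> Lp p \<Omega>"
  by (simp add: Lp_def)

lemma Lp_integrable:
  assumes "f \<in> Lp p \<Omega>"
  shows "integrable M f"
proof (rule Bochner_Integration.integrable_bound)
  show "integrable M (\<lambda>x. 1 + norm (f x) powr p)"
    using LpD(2)[OF assms] integrable_const_M by (intro Bochner_Integration.integrable_add)
  show "f \<in> borel_measurable M" by (rule LpD(1)[OF assms])
  show "AE x in M. norm (f x) \<le> norm (1 + norm (f x) powr p)"
  proof (rule AE_I2)
    fix x
    have "norm (f x) \<le> 1 + norm (f x) powr p"
      using le_powr_add[of "norm (f x)" 1 p] p_pos by simp
    then show "norm (f x) \<le> norm (1 + norm (f x) powr p)" by (simp add: add_nonneg_nonneg)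
  qed
qed

lemma Lp_bound:
  fixes f :: "'a \<Rightarrow> 'b::euclidean_space" and g :: "'a \<Rightarrow> 'c::euclidean_space"
  assumes "g \<in> Lp p \<Omega>" "f \<in> borel_measurable M" "AE x in M. norm (f x) \<le> C * norm (g x)"
  shows "f \<in> Lp p \<Omega>"
proof (rule LpI[OF assms(2)], rule Bochner_Integration.integrable_bound)
  show "integrable M (\<lambda>x. \<bar>C\<bar> powr p * norm (g x) powr p)"
    using LpD(2)[OF assms(1)] by simp
  show "(\<lambda>x. norm (f x) powr p) \<in> borel_measurable M" using assms(2) by measurable
  show "AE x in M. norm (norm (f x) powr p) \<le> norm (\<bar>C\<bar> powr p * norm (g x) powr p)"
    using assms(3)
  proof eventually_elim
    case (elim x)
    have "C * norm (g x) \<le> \<bar>C\<bar> * norm (g x)" by (intro mult_right_mono) auto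
    then have "norm (f x) powr p \<le> (\<bar>C\<bar> * norm (g x)) powr p"
      using elim p_pos by (intro powr_mono2) auto
    then show ?case by (simp add: powr_mult)
  qed
qed

lemma Lp_add:
  assumes "f \<in> Lp p \<Omega>" "g \<in> Lp p \<Omega>"
  shows "(\<lambda>x. f x + g x) \<in> Lp p \<Omega>"
proof (rule LpI)
  show m: "(\<lambda>x. f x + g x) \<in> borel_measurable M"
    by (rule borel_measurable_add[OF LpD(1)[OF assms(1)] LpD(1)[OF assms(2)]])
  show "integrable M (\<lambda>x. norm (f x + g x) powr p)"
  proof (rule Bochner_Integration.integrable_bound)
    show "integrable M (\<lambda>x. 2 powr p * norm (f x) powr p + 2 powr p * norm (g x) powr p)"
      using LpD(2)[OF assms(1)] LpD(2)[OF assms(2)] by simp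
    show "(\<lambda>x. norm (f x + g x) powr p) \<in> borel_measurable M" using m by measurable
    show "AE x in M. norm (norm (f x + g x) powr p) \<le> norm (2 powr p * norm (f x) powr p + 2 powr p * norm (g x) powr p)"
      using norm_add_powr_le[of 1 p] p_pos by (intro AE_I2) simp
  qed
qed

lemma Lp_minus: "f \<in> Lp p \<Omega> \<Longrightarrow> (\<lambda>x. - f x) \<in> Lp p \<Omega>"
  by (auto simp: Lp_def)

lemma Lp_diff: "f \<in> Lp p \<Omega> \<Longrightarrow> g \<in> Lp p \<Omega> \<Longrightarrow> (\<lambda>x. f x - g x) \<in> Lp p \<Omega>"
  using Lp_add[of f "\<lambda>x. - g x"] Lp_minus[of g] by simp

lemma Lp_bounded:
  fixes f :: "'a \<Rightarrow> 'b::euclidean_space"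
  assumes "f \<in> borel_measurable M" "AE x in M. norm (f x) \<le> C"
  shows "f \<in> Lp p \<Omega>"
proof (rule Lp_bound[of "\<lambda>x. 1::real" f C])
  show "(\<lambda>x. 1::real) \<in> Lp p \<Omega>" by (simp add: Lp_def integrable_const_M)
qed (use assms in auto)

lemma Lp_AE_cong:
  fixes f g :: "'a \<Rightarrow> 'b::euclidean_space"
  assumes "f \<in> Lp p \<Omega>" "AE x in M. f x = g x" "g \<in> borel_measurable M"
  shows "g \<in> Lp p \<Omega>"
  by (rule Lp_bound[OF assms(1,3), of 1]) (use assms(2) in eventually_elim, simp)

lemma Lp_tendsto_L1:
  assumes "\<And>n. fn n \<in> Lp p \<Omega>" "f \<in> Lp p \<Omega>" "Lp_tendsto M p fn f"
  shows "(\<lambda>n. LINT x|M. norm (fn n x - f x)) \<longlonglongrightarrow> 0"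
proof (rule LIMSEQ_I)
  fix e :: real assume e: "e > 0"
  define V where "V = (LINT x|M. (1::real))"
  have V: "V \<ge> 0" by (simp add: V_def)
  define \<kappa> where "\<kappa> = e / (2 * (V + 1))"
  have \<kappa>: "\<kappa> > 0" using e V by (simp add: \<kappa>_def)
  define K where "K = \<kappa> powr (1 - p)"
  have "(\<lambda>n. K * (LINT x|M. norm (fn n x - f x) powr p)) \<longlonglongrightarrow> 0"
    using assms(3) unfolding Lp_tendsto_def by (rule tendsto_mult_right_zero)
  then have "\<forall>\<^sub>F n in sequentially. K * (LINT x|M. norm (fn n x - f x) powr p) < e / 2"
    using e by (intro order_tendstoD(2)) auto
  then obtain N where N: "\<And>n. n \<ge> N \<Longrightarrow> K * (LINT x|M. norm (fn n x - f x) powr p) < e / 2"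
    unfolding eventually_sequentially by blast
  have "norm ((LINT x|M. norm (fn n x - f x)) - 0) < e" if "n \<ge> N" for n
  proof -
    have d: "(\<lambda>x. fn n x - f x) \<in> Lp p \<Omega>" by (intro Lp_diff assms)
    have "(LINT x|M. norm (fn n x - f x)) \<le> (LINT x|M. \<kappa> * 1 + K * norm (fn n x - f x) powr p)"
    proof (rule integral_mono)
      show "integrable M (\<lambda>x. norm (fn n x - f x))" using Lp_integrable[OF d] by (rule Bochner_Integration.integrable_norm)
      show "integrable M (\<lambda>x. \<kappa> * 1 + K * norm (fn n x - f x) powr p)"
        by (intro Bochner_Integration.integrable_add integrable_mult_right LpD(2)[OF d] integrable_const_M)
      show "norm (fn n x - f x) \<le> \<kappa> * 1 + K * norm (fn n x - f x) powr p" for x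
        using le_powr_add[of "norm (fn n x - f x)" \<kappa> p] \<kappa> p_pos by (simp add: K_def)
    qed
    also have "\<dots> = (LINT x|M. \<kappa> * 1) + (LINT x|M. K * norm (fn n x - f x) powr p)"
      by (intro Bochner_Integration.integral_add integrable_mult_right LpD(2)[OF d] integrable_const_M)
    also have "\<dots> = \<kappa> * V + K * (LINT x|M. norm (fn n x - f x) powr p)"
      unfolding V_def by (simp only: integral_mult_right_zero)
    also have "\<dots> < e / 2 + e / 2"
    proof (rule add_le_less_mono)
      have "\<kappa> * V \<le> \<kappa> * (V + 1)" using \<kappa> by simp
      also have "\<dots> = e / 2" using V unfolding \<kappa>_def by (simp add: divide_simps)
      finally show "\<kappa> * V \<le> e / 2" .
    qed (rule N[OF that])
    finally show ?thesis by simp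
  qed
  then show "\<exists>N. \<forall>n\<ge>N. norm ((LINT x|M. norm (fn n x - f x)) - 0) < e" by blast
qed

lemma Lp_tendsto_AE_subseq:
  assumes "\<And>n. fn n \<in> Lp p \<Omega>" "f \<in> Lp p \<Omega>" "Lp_tendsto M p fn f"
  shows "\<exists>r. strict_mono r \<and> (AE x in M. (\<lambda>n. fn (r n) x) \<longlonglongrightarrow> f x)"
proof -
  have "integrable M (\<lambda>x. fn n x - f x)" for n by (intro Lp_integrable Lp_diff assms)
  from tendsto_L1_AE_subseq[OF this Lp_tendsto_L1[OF assms]]
  obtain r where "strict_mono r" "AE x in M. (\<lambda>n. fn (r n) x - f x) \<longlonglongrightarrow> 0" by blast
  then show ?thesis by (auto simp: LIM_zero_iff)
qed

lemma Lp_tendsto_subseq: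
  "Lp_tendsto M p fn f \<Longrightarrow> strict_mono r \<Longrightarrow> Lp_tendsto M p (\<lambda>n. fn (r n)) f"
  unfolding Lp_tendsto_def using LIMSEQ_subseq_LIMSEQ[of _ 0 r] by (simp add: o_def)

lemma Lp_tendsto_bound:
  assumes "\<And>n. AE x in M. norm (fn n x - f x) powr p \<le> w n x" "\<And>n. integrable M (w n)"
    and "(\<lambda>n. LINT x|M. w n x) \<longlonglongrightarrow> 0"
  shows "Lp_tendsto M p fn f"
  unfolding Lp_tendsto_def
proof (rule tendsto_sandwich[OF _ _ tendsto_const assms(3)])
  show "\<forall>\<^sub>F n in sequentially. 0 \<le> (LINT x|M. norm (fn n x - f x) powr p)" by simp
  have "0 \<le> w n x" if "norm (fn n x - f x) powr p \<le> w n x" for n x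
    using that powr_ge_zero order_trans by blast
  then have "AE x in M. 0 \<le> w n x" for n
    using assms(1)[of n] by (auto elim: eventually_mono)
  then have "(LINT x|M. norm (fn n x - f x) powr p) \<le> (LINT x|M. w n x)" for n
    by (rule integral_mono_AE'[OF assms(2,1)])
  then show "\<forall>\<^sub>F n in sequentially. (LINT x|M. norm (fn n x - f x) powr p) \<le> (LINT x|M. w n x)"
    by simp
qed

lemma Lp_tendsto_add:
  assumes "\<And>n. fn n \<in> Lp p \<Omega>" "f \<in> Lp p \<Omega>" "Lp_tendsto M p fn f"
    and "\<And>n. gn n \<in> Lp p \<Omega>" "g \<in> Lp p \<Omega>" "Lp_tendsto M p gn g"
  shows "Lp_tendsto M p (\<lambda>n x. fn n x + gn n x) (\<lambda>x. f x + g x)"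
proof (rule Lp_tendsto_bound)
  let ?w = "\<lambda>n x. 2 powr p * norm (fn n x - f x) powr p + 2 powr p * norm (gn n x - g x) powr p"
  have i: "integrable M (\<lambda>x. norm (fn n x - f x) powr p)" "integrable M (\<lambda>x. norm (gn n x - g x) powr p)" for n
    by (intro LpD(2) Lp_diff assms)+
  then show "integrable M (?w n)" for n by simp
  have "(\<lambda>n. 2 powr p * (LINT x|M. norm (fn n x - f x) powr p) + 2 powr p * (LINT x|M. norm (gn n x - g x) powr p))
      \<longlonglongrightarrow> 2 powr p * 0 + 2 powr p * 0"
    using assms(3,6) unfolding Lp_tendsto_def by (intro tendsto_add tendsto_mult_left)
  then show "(\<lambda>n. LINT x|M. ?w n x) \<longlonglongrightarrow> 0" using i by simp
  show "AE x in M. norm (fn n x + gn n x - (f x + g x)) powr p \<le> ?w n x" for n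
    using norm_add_powr_le[of 1 p "fn n _ - f _" "gn n _ - g _"] p_pos
    by (intro AE_I2) (simp add: add_diff_add)
qed

text \<open>In a chain rule the outer derivative converges only almost everywhere, but boundedly, while
  the gradients converge in \<open>L\<^sup>p\<close>. Such products converge: in
  \<open>A\<^sub>n (v\<^sub>n - v) + (A\<^sub>n - A) v\<close> the first term is controlled by boundedness and the second by
  dominated convergence.\<close>

lemma Lp_tendsto_scaleR:
  fixes An :: "nat \<Rightarrow> 'a \<Rightarrow> real" and vn :: "nat \<Rightarrow> 'a \<Rightarrow> 'b::euclidean_space"
  assumes An: "\<And>n. An n \<in> borel_measurable M" "\<And>n. AE x in M. \<bar>An n x\<bar> \<le> C"
    and A: "A \<in> borel_measurable M" "AE x in M. (\<lambda>n. An n x) \<longlonglongrightarrow> A x"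
    and v: "\<And>n. vn n \<in> Lp p \<Omega>" "v \<in> Lp p \<Omega>" "Lp_tendsto M p vn v"
  shows "\<And>n. (\<lambda>x. An n x *\<^sub>R vn n x) \<in> Lp p \<Omega>" "(\<lambda>x. A x *\<^sub>R v x) \<in> Lp p \<Omega>"
    "Lp_tendsto M p (\<lambda>n x. An n x *\<^sub>R vn n x) (\<lambda>x. A x *\<^sub>R v x)"
proof -
  have An': "AE x in M. \<forall>n. \<bar>An n x\<bar> \<le> C" using An(2) by (simp add: AE_all_countable)
  have A': "AE x in M. \<bar>A x\<bar> \<le> C"
    using An' A(2)
  proof eventually_elim
    case (elim x)
    have "(\<lambda>n. \<bar>An n x\<bar>) \<longlonglongrightarrow> \<bar>A x\<bar>" using elim(2) by (rule tendsto_rabs)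
    then show ?case by (rule LIMSEQ_le_const2) (use elim in auto)
  qed
  note vm = LpD(1)[OF v(1)] LpD(1)[OF v(2)]
  show "\<And>n. (\<lambda>x. An n x *\<^sub>R vn n x) \<in> Lp p \<Omega>"
  proof (rule Lp_bound[OF v(1)])
    fix n
    show "(\<lambda>x. An n x *\<^sub>R vn n x) \<in> borel_measurable M" using An(1) vm by measurable
    show "AE x in M. norm (An n x *\<^sub>R vn n x) \<le> C * norm (vn n x)"
      using An(2)[of n] by eventually_elim (auto intro: mult_right_mono)
  qed
  show "(\<lambda>x. A x *\<^sub>R v x) \<in> Lp p \<Omega>"
  proof (rule Lp_bound[OF v(2), of _ C])
    show "(\<lambda>x. A x *\<^sub>R v x) \<in> borel_measurable M" using A(1) vm by measurable
    show "AE x in M. norm (A x *\<^sub>R v x) \<le> C * norm (v x)"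
      using A' by eventually_elim (auto intro: mult_right_mono)
  qed
  let ?w1 = "\<lambda>n x. \<bar>C\<bar> powr p * norm (vn n x - v x) powr p"
  let ?w2 = "\<lambda>n x. \<bar>An n x - A x\<bar> powr p * norm (v x) powr p"
  show "Lp_tendsto M p (\<lambda>n x. An n x *\<^sub>R vn n x) (\<lambda>x. A x *\<^sub>R v x)"
  proof (rule Lp_tendsto_bound)
    show "AE x in M. norm (An n x *\<^sub>R vn n x - A x *\<^sub>R v x) powr p \<le> 2 powr p * ?w1 n x + 2 powr p * ?w2 n x" for n
      using An(2)[of n]
    proof eventually_elim
      case (elim x)
      have "An n x *\<^sub>R vn n x - A x *\<^sub>R v x = An n x *\<^sub>R (vn n x - v x) + (An n x - A x) *\<^sub>R v x"
        by (simp add: algebra_simps)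
      then have "norm (An n x *\<^sub>R vn n x - A x *\<^sub>R v x) powr p \<le>
          2 powr p * norm (An n x *\<^sub>R (vn n x - v x)) powr p + 2 powr p * norm ((An n x - A x) *\<^sub>R v x) powr p"
        using norm_add_powr_le[of 1 p "An n x *\<^sub>R (vn n x - v x)" "(An n x - A x) *\<^sub>R v x"] p_pos by simp
      also have "norm ((An n x - A x) *\<^sub>R v x) powr p = ?w2 n x" by (simp add: powr_mult)
      also have "norm (An n x *\<^sub>R (vn n x - v x)) powr p = \<bar>An n x\<bar> powr p * norm (vn n x - v x) powr p"
        by (simp add: powr_mult)
      also have "\<bar>An n x\<bar> powr p * norm (vn n x - v x) powr p \<le> ?w1 n x"
        using elim p_pos by (intro mult_right_mono powr_mono2) auto
      finally show ?case by simp
    qed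
    have i1: "integrable M (?w1 n)" for n using LpD(2)[OF Lp_diff[OF v(1,2)]] by simp
    have m2: "?w2 n \<in> borel_measurable M" for n using An(1)[of n] A(1) vm by measurable
    have bd2: "AE x in M. norm (?w2 n x) \<le> \<bar>2 * C\<bar> powr p * norm (v x) powr p" for n
      using An(2)[of n] A'
    proof eventually_elim
      case (elim x)
      then have "\<bar>An n x - A x\<bar> \<le> \<bar>2 * C\<bar>" by linarith
      then have "\<bar>An n x - A x\<bar> powr p \<le> \<bar>2 * C\<bar> powr p" using p_pos by (intro powr_mono2) auto
      then show ?case by (simp add: mult_right_mono)
    qed
    have iv: "integrable M (\<lambda>x. \<bar>2 * C\<bar> powr p * norm (v x) powr p)" using LpD(2)[OF v(2)] by simp
    have i2: "integrable M (?w2 n)" for n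
      by (rule Bochner_Integration.integrable_bound[OF iv m2]) (use bd2[of n] in \<open>auto elim: eventually_mono\<close>)
    show "integrable M (\<lambda>x. 2 powr p * ?w1 n x + 2 powr p * ?w2 n x)" for n using i1 i2 by simp
    have t1: "(\<lambda>n. LINT x|M. ?w1 n x) \<longlonglongrightarrow> 0"
      using tendsto_mult_right_zero[OF v(3)[unfolded Lp_tendsto_def], of "\<bar>C\<bar> powr p"] by simp
    have "(\<lambda>n. LINT x|M. ?w2 n x) \<longlonglongrightarrow> (LINT x|M. 0)"
    proof (rule integral_dominated_convergence[OF _ m2 iv _ bd2])
      show "AE x in M. (\<lambda>n. ?w2 n x) \<longlonglongrightarrow> 0"
        using A(2)
      proof eventually_elim
        case (elim x)
        have "(\<lambda>n. \<bar>An n x - A x\<bar>) \<longlonglongrightarrow> 0" using elim by (simp add: LIM_zero_iff tendsto_rabs_zero_iff)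
        then have "(\<lambda>n. \<bar>An n x - A x\<bar> powr p) \<longlonglongrightarrow> 0 powr p"
          using p_pos by (intro tendsto_powr') auto
        then show ?case by (simp add: tendsto_mult_left_zero)
      qed
    qed simp
    then have "(\<lambda>n. 2 powr p * (LINT x|M. ?w1 n x) + 2 powr p * (LINT x|M. ?w2 n x)) \<longlonglongrightarrow> 2 powr p * 0 + 2 powr p * 0"
      using t1 by (intro tendsto_add tendsto_mult_left) auto
    then show "(\<lambda>n. LINT x|M. 2 powr p * ?w1 n x + 2 powr p * ?w2 n x) \<longlonglongrightarrow> 0"
      using i1 i2 by simp
  qed
qed

end

section \<open>Chain and product rules in the Sobolev space\<close>

text \<open>Polynomials of test functions are smooth, so this is what turns continuously differentiable
  composites into limits of test functions. Approximating the derivative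
  and integrating gives both estimates at once, and keeps the value at \<open>0\<close>, hence compact
  supports.\<close>

lemma C1_polynomial_approximation:
  fixes F F' :: "real \<Rightarrow> real"
  assumes F: "\<And>t. (F has_real_derivative F' t) (at t)" "continuous_on UNIV F'"
    and R: "R \<ge> 0" and e: "e > 0"
  shows "\<exists>P P'. real_polynomial_function P \<and> (\<forall>t. (P has_real_derivative P' t) (at t)) \<and> continuous_on UNIV P' \<and>
     P 0 = F 0 \<and> (\<forall>t. \<bar>t\<bar> \<le> R \<longrightarrow> \<bar>P t - F t\<bar> \<le> e \<and> \<bar>P' t - F' t\<bar> \<le> e)"
proof -
  define e' where "e' = e / (1 + R)"
  have e': "e' > 0" "e' \<le> e" "e' * R \<le> e"
    using e R by (auto simp: e'_def divide_simps)
  obtain Q where Q: "real_polynomial_function Q" "\<And>t. t \<in> {-R..R} \<Longrightarrow> \<bar>F' t - Q t\<bar> < e'"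
    using Stone_Weierstrass_real_polynomial_function[OF compact_Icc _ e'(1), of "-R" R F']
      continuous_on_subset[OF F(2) subset_UNIV] by blast
  obtain a n where Qa: "Q = (\<lambda>x. \<Sum>i\<le>n. a i * x ^ i)"
    using Q(1) unfolding real_polynomial_function_iff_sum by blast
  define P where "P x = F 0 + (\<Sum>i\<le>n. a i / real (Suc i) * x ^ Suc i)" for x
  have P: "real_polynomial_function P"
    unfolding P_def[abs_def] by (intro real_polynomial_function.intros(2-) real_polynomial_function_sum
       real_polynomial_function_power real_polynomial_function.intros(1) bounded_linear_ident finite_atMost)
  have dP: "(P has_real_derivative Q t) (at t)" for t
  proof -
    have "((\<lambda>x. a i / real (Suc i) * x ^ Suc i) has_real_derivative a i * t ^ i) (at t)" for i
      using DERIV_cmult[OF DERIV_pow[of "Suc i" t UNIV], of "a i / real (Suc i)"] by simp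
    then have "((\<lambda>x. \<Sum>i\<le>n. a i / real (Suc i) * x ^ Suc i) has_real_derivative (\<Sum>i\<le>n. a i * t ^ i)) (at t)"
      by (rule DERIV_sum)
    from DERIV_add[OF DERIV_const this] show ?thesis by (simp add: P_def[abs_def] Qa)
  qed
  have bound: "\<bar>P t - F t\<bar> \<le> e" if "\<bar>t\<bar> \<le> R" for t
  proof -
    have "norm ((P t - F t) - (P 0 - F 0)) \<le> e' * norm (t - 0)"
    proof (rule field_differentiable_bound[where S="{-R..R}" and f'="\<lambda>s. Q s - F' s"])
      show "((\<lambda>t. P t - F t) has_field_derivative Q s - F' s) (at s within {-R..R})" for s
        by (intro DERIV_subset[OF DERIV_diff[OF dP F(1)]]) auto
      show "norm (Q s - F' s) \<le> e'" if "s \<in> {-R..R}" for s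
        using Q(2)[OF that] by (simp add: abs_minus_commute)
    qed (use that in auto)
    moreover have "P 0 = F 0" by (simp add: P_def)
    moreover have "e' * \<bar>t\<bar> \<le> e" using mult_left_mono[OF that, of e'] e' by linarith
    ultimately show ?thesis by simp
  qed
  have "continuous_on UNIV Q" unfolding Qa by (intro continuous_intros)
  moreover have "\<bar>Q t - F' t\<bar> \<le> e" if "\<bar>t\<bar> \<le> R" for t
    using Q(2)[of t] that e'(2) by (auto simp: abs_minus_commute abs_le_iff)
  ultimately show ?thesis
    using P dP bound by (intro exI[of _ P] exI[of _ Q]) (auto simp: P_def)
qed

lemma C1_deriv_continuous:
  fixes F :: "real \<Rightarrow> real"
  assumes "\<And>t. (F has_real_derivative F' t) (at t)"
  shows "continuous_on UNIV F"
  using assms DERIV_isCont continuous_at_imp_continuous_on by blast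

lemma borel_measurable_compose_continuous:
  fixes F :: "real \<Rightarrow> real"
  assumes "continuous_on UNIV F" "f \<in> borel_measurable N"
  shows "(\<lambda>x. F (f x)) \<in> borel_measurable N"
  using measurable_compose[OF assms(2) continuous_borel(1)[OF assms(1)]] .

lemma gradient_eq: "C1_gradient f f' \<Longrightarrow> gradient f = f'"
  by (intro ext) (simp add: gradient_def C1_frechet euclidean_representation)

lemma borel_measurable_lebesgue_on_AE:
  fixes f g :: "'a::euclidean_space \<Rightarrow> 'b::euclidean_space"
  assumes "f \<in> borel_measurable (lebesgue_on S)" "AE x in lebesgue_on S. f x = g x" "S \<in> sets lebesgue"
  shows "g \<in> borel_measurable (lebesgue_on S)"
proof -
  have "(\<lambda>x. if x \<in> S then f x else 0) \<in> borel_measurable lebesgue"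
    using assms(1,3) by (simp add: borel_measurable_if)
  moreover have "AE x in lebesgue. (if x \<in> S then f x else 0) = (if x \<in> S then g x else 0)"
    using assms(2,3) by (auto simp: AE_restrict_space_iff elim!: eventually_mono)
  ultimately have "(\<lambda>x. if x \<in> S then g x else 0) \<in> borel_measurable lebesgue"
    by (rule borel_measurable_AE)
  then show ?thesis using assms(3) by (simp add: borel_measurable_if)
qed

context sobolev_setting
begin

lemma test_function_Lp:
  assumes "\<phi> \<in> test_functions \<Omega>"
  shows "\<phi> \<in> Lp p \<Omega>" "gradient \<phi> \<in> Lp p \<Omega>"
proof -
  obtain B where B: "B > 0" "\<And>x. \<bar>\<phi> x\<bar> \<le> B" "\<And>x. norm (gradient \<phi> x) \<le> B"
    by (rule test_functions_bounded[OF assms]) (rule that)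
  show "\<phi> \<in> Lp p \<Omega>" "gradient \<phi> \<in> Lp p \<Omega>"
    using B by (auto intro!: Lp_bounded[of _ B] test_functions_measurable[OF assms])
qed

lemma is_weak_gradient_test: "\<phi> \<in> test_functions \<Omega> \<Longrightarrow> is_weak_gradient \<Omega> \<phi> (gradient \<phi>)"
  by (intro is_weak_gradient_C1 test_functions_C1)

lemma W1p_weak_gradient:
  assumes "u \<in> W1p p \<Omega>"
  shows "u \<in> Lp p \<Omega>" "is_weak_gradient \<Omega> u (weak_gradient \<Omega> u)" "weak_gradient \<Omega> u \<in> Lp p \<Omega>"
proof -
  obtain g where g: "u \<in> Lp p \<Omega>" "g \<in> Lp p \<Omega>" "is_weak_gradient \<Omega> u g"
    using assms by (auto simp: W1p_def)
  show "u \<in> Lp p \<Omega>" "is_weak_gradient \<Omega> u (weak_gradient \<Omega> u)"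
    using g weak_gradient_AE by auto
  have ae: "AE x in M. g x = weak_gradient \<Omega> u x"
    using weak_gradient_AE(2)[OF g(3)] by (auto elim: eventually_mono)
  show "weak_gradient \<Omega> u \<in> Lp p \<Omega>"
    by (rule Lp_AE_cong[OF g(2) ae borel_measurable_lebesgue_on_AE[OF LpD(1)[OF g(2)] ae sets_\<Omega>]])
qed

text \<open>The norm refers to a chosen weak gradient; by uniqueness it may be computed from any other.\<close>

lemma W1p_norm_diff:
  assumes "\<phi> \<in> test_functions \<Omega>" "u \<in> Lp p \<Omega>" "g \<in> Lp p \<Omega>" "is_weak_gradient \<Omega> u g"
  shows "W1p_norm p \<Omega> (\<lambda>x. \<phi> x - u x) =
    ((LINT x|M. norm (\<phi> x - u x) powr p) + (LINT x|M. norm (gradient \<phi> x - g x) powr p)) powr (1 / p)"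
proof -
  have "is_weak_gradient \<Omega> (\<lambda>x. \<phi> x - u x) (\<lambda>x. gradient \<phi> x - g x)"
    by (intro is_weak_gradient_diff is_weak_gradient_test Lp_integrable test_function_Lp assms)
  note w = weak_gradient_AE[OF this]
  have mg: "(\<lambda>x. gradient \<phi> x - g x) \<in> borel_measurable M"
    using LpD(1)[OF Lp_diff[OF test_function_Lp(2)[OF assms(1)] assms(3)]] .
  have ae: "AE x in M. gradient \<phi> x - g x = weak_gradient \<Omega> (\<lambda>x. \<phi> x - u x) x"
    using w(2) by (auto elim: eventually_mono)
  have mw: "weak_gradient \<Omega> (\<lambda>x. \<phi> x - u x) \<in> borel_measurable M"
    by (rule borel_measurable_lebesgue_on_AE[OF mg ae sets_\<Omega>])
  have "(LINT x|M. norm (weak_gradient \<Omega> (\<lambda>x. \<phi> x - u x) x) powr p) = (LINT x|M. norm (gradient \<phi> x - g x) powr p)"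
  proof (rule integral_cong_AE)
    show "AE x in M. norm (weak_gradient \<Omega> (\<lambda>x. \<phi> x - u x) x) powr p = norm (gradient \<phi> x - g x) powr p"
      using w(2) by eventually_elim simp
  qed (use mg mw in measurable)
  then show ?thesis by (simp add: W1p_norm_def)
qed

lemma W01p_approximation:
  assumes "u \<in> W01p p \<Omega>"
  shows "\<exists>\<psi>. (\<forall>n. \<psi> n \<in> test_functions \<Omega>) \<and> Lp_tendsto M p \<psi> u \<and>
    Lp_tendsto M p (\<lambda>n. gradient (\<psi> n)) (weak_gradient \<Omega> u) \<and> (AE x in M. (\<lambda>n. \<psi> n x) \<longlonglongrightarrow> u x)"
proof -
  have u: "u \<in> W1p p \<Omega>" using assms by (simp add: W01p_def)
  note wg = W1p_weak_gradient[OF u]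
  let ?g = "weak_gradient \<Omega> u"
  define \<kappa> where "\<kappa> n = 1 / real (Suc n)" for n
  have \<kappa>: "\<kappa> n > 0" for n by (simp add: \<kappa>_def)
  have \<kappa>0: "\<kappa> \<longlonglongrightarrow> 0" unfolding \<kappa>_def using LIMSEQ_inverse_real_of_nat by (simp add: inverse_eq_divide)
  have "\<forall>n. \<exists>\<phi>\<in>test_functions \<Omega>. W1p_norm p \<Omega> (\<lambda>x. \<phi> x - u x) < \<kappa> n"
    using assms \<kappa> by (simp add: W01p_def)
  then obtain \<phi> where \<phi>: "\<And>n. \<phi> n \<in> test_functions \<Omega>" "\<And>n. W1p_norm p \<Omega> (\<lambda>x. \<phi> n x - u x) < \<kappa> n"
    by metis
  define S where "S n = (LINT x|M. norm (\<phi> n x - u x) powr p) + (LINT x|M. norm (gradient (\<phi> n) x - ?g x) powr p)" for n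
  have S: "0 \<le> S n" for n by (simp add: S_def)
  have "S n powr (1 / p) < \<kappa> n" for n
    using \<phi>(2)[of n] W1p_norm_diff[OF \<phi>(1) wg(1,3,2)] by (simp add: S_def)
  then have "(S n powr (1 / p)) powr p \<le> \<kappa> n powr p" for n
    using p_pos by (intro powr_mono2) (auto intro: less_imp_le)
  then have Sle: "S n \<le> \<kappa> n powr p" for n using S p_pos by (simp add: powr_powr)
  have "(\<lambda>n. \<kappa> n powr p) \<longlonglongrightarrow> 0 powr p"
    using \<kappa>0 p_pos \<kappa> by (intro tendsto_powr') (auto intro!: always_eventually less_imp_le)
  then have k0: "(\<lambda>n. \<kappa> n powr p) \<longlonglongrightarrow> 0" by simp
  have "Lp_tendsto M p \<phi> u" unfolding Lp_tendsto_def
  proof (rule tendsto_sandwich[OF _ _ tendsto_const k0])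
    have "(LINT x|M. norm (\<phi> n x - u x) powr p) \<le> \<kappa> n powr p" for n
      using Sle[of n] unfolding S_def by (smt (verit) Bochner_Integration.integral_nonneg powr_ge_zero)
    then show "\<forall>\<^sub>F n in sequentially. (LINT x|M. norm (\<phi> n x - u x) powr p) \<le> \<kappa> n powr p" by simp
  qed simp
  moreover have L2: "Lp_tendsto M p (\<lambda>n. gradient (\<phi> n)) ?g" unfolding Lp_tendsto_def
  proof (rule tendsto_sandwich[OF _ _ tendsto_const k0])
    have "(LINT x|M. norm (gradient (\<phi> n) x - ?g x) powr p) \<le> \<kappa> n powr p" for n
      using Sle[of n] unfolding S_def by (smt (verit) Bochner_Integration.integral_nonneg powr_ge_zero)
    then show "\<forall>\<^sub>F n in sequentially. (LINT x|M. norm (gradient (\<phi> n) x - ?g x) powr p) \<le> \<kappa> n powr p" by simp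
  qed simp
  moreover obtain r where r: "strict_mono r" "AE x in M. (\<lambda>n. \<phi> (r n) x) \<longlonglongrightarrow> u x"
    using Lp_tendsto_AE_subseq[OF test_function_Lp(1)[OF \<phi>(1)] wg(1) calculation(1)] by blast
  ultimately show ?thesis
    using Lp_tendsto_subseq[OF _ r(1), of \<phi>] Lp_tendsto_subseq[OF L2 r(1)] \<phi>(1) r(2)
    by (intro exI[of _ "\<lambda>n. \<phi> (r n)"]) auto
qed

lemma is_weak_gradient_Lp_limit:
  assumes "\<And>n. is_weak_gradient \<Omega> (un n) (gn n)" "\<And>n. un n \<in> Lp p \<Omega>" "\<And>n. gn n \<in> Lp p \<Omega>"
    and "u \<in> Lp p \<Omega>" "g \<in> Lp p \<Omega>" "Lp_tendsto M p un u" "Lp_tendsto M p gn g"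
  shows "is_weak_gradient \<Omega> u g"
proof (rule is_weak_gradient_limit[OF assms(1) Lp_integrable[OF assms(2)] Lp_integrable[OF assms(3)]
      Lp_integrable[OF assms(4)] Lp_integrable[OF assms(5)]])
  show "(\<lambda>n. LINT x|M. \<bar>un n x - u x\<bar>) \<longlonglongrightarrow> 0" using Lp_tendsto_L1[OF assms(2,4,6)] by simp
  show "(\<lambda>n. LINT x|M. norm (gn n x - g x)) \<longlonglongrightarrow> 0" by (rule Lp_tendsto_L1[OF assms(3,5,7)])
qed

lemma W01pI:
  assumes \<psi>: "\<And>n. \<psi> n \<in> test_functions \<Omega>" and u: "u \<in> Lp p \<Omega>" "g \<in> Lp p \<Omega>"
    and lim: "Lp_tendsto M p \<psi> u" "Lp_tendsto M p (\<lambda>n. gradient (\<psi> n)) g"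
  shows "u \<in> W01p p \<Omega>" "is_weak_gradient \<Omega> u g"
proof -
  show g: "is_weak_gradient \<Omega> u g"
    by (rule is_weak_gradient_Lp_limit[OF is_weak_gradient_test[OF \<psi>] test_function_Lp[OF \<psi>] u lim])
  show "u \<in> W01p p \<Omega>"
    unfolding W01p_def
  proof (intro CollectI conjI allI impI)
    show "u \<in> W1p p \<Omega>" using u g by (auto simp: W1p_def)
    fix e :: real assume "e > 0"
    define S where "S n = (LINT x|M. norm (\<psi> n x - u x) powr p) + (LINT x|M. norm (gradient (\<psi> n) x - g x) powr p)" for n
    have "S \<longlonglongrightarrow> 0 + 0" unfolding S_def using lim unfolding Lp_tendsto_def by (rule tendsto_add)
    then have "(\<lambda>n. S n powr (1 / p)) \<longlonglongrightarrow> 0 powr (1 / p)"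
      using p_pos by (intro tendsto_powr') (auto simp: S_def[abs_def] intro: add_nonneg_nonneg)
    then have "\<forall>\<^sub>F n in sequentially. S n powr (1 / p) < e" using \<open>e > 0\<close> by (intro order_tendstoD(2)) auto
    then obtain n where "S n powr (1 / p) < e" by (auto simp: eventually_sequentially)
    then show "\<exists>\<phi>\<in>test_functions \<Omega>. W1p_norm p \<Omega> (\<lambda>x. \<phi> x - u x) < e"
      using \<psi>[of n] W1p_norm_diff[OF \<psi>[of n] u g] by (intro bexI[of _ "\<psi> n"]) (auto simp: S_def)
  qed
qed

lemma test_function_W01p: "\<phi> \<in> test_functions \<Omega> \<Longrightarrow> \<phi> \<in> W01p p \<Omega>"
  using W01pI(1)[of "\<lambda>n. \<phi>" \<phi> "gradient \<phi>"] test_function_Lp[of \<phi>] p_pos by (simp add: Lp_tendsto_def)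

lemma W01pD: 
  assumes "u \<in> W01p p \<Omega>"
  shows "u \<in> Lp p \<Omega>" "is_weak_gradient \<Omega> u (weak_gradient \<Omega> u)" "weak_gradient \<Omega> u \<in> Lp p \<Omega>"
  using W1p_weak_gradient[of u] assms by (auto simp: W01p_def)

text \<open>The function \<open>G(\<psi>) F(u)\<close> is the limit of \<open>P\<^sub>n(\<psi>) Q\<^sub>n(\<psi>\<^sub>n)\<close>, where the test functions
  \<open>\<psi>\<^sub>n\<close> approximate \<open>u\<close> and the polynomials \<open>P\<^sub>n\<close>, \<open>Q\<^sub>n\<close> approximate \<open>G\<close>, \<open>F\<close> on the ranges of
  \<open>\<psi>\<close>, \<open>\<psi>\<^sub>n\<close>. The condition \<open>G(0) = 0\<close> makes these products vanish off the support of \<open>\<psi>\<close>.\<close>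

lemma W01p_product_compose:
  fixes F F' G G' :: "real \<Rightarrow> real"
  assumes \<psi>: "\<psi> \<in> test_functions \<Omega>" and u: "u \<in> W01p p \<Omega>"
    and G: "\<And>t. (G has_real_derivative G' t) (at t)" "continuous_on UNIV G'" "G 0 = 0"
    and F: "\<And>t. (F has_real_derivative F' t) (at t)" "continuous_on UNIV F'"
    and bd: "\<And>t. \<bar>F t\<bar> \<le> C" "\<And>t. \<bar>F' t\<bar> \<le> C"
  defines "\<xi> \<equiv> \<lambda>x. G (\<psi> x) * F (u x)"
    and "\<xi>' \<equiv> \<lambda>x. (F (u x) * G' (\<psi> x)) *\<^sub>R gradient \<psi> x + (G (\<psi> x) * F' (u x)) *\<^sub>R weak_gradient \<Omega> u x"
  shows "\<xi> \<in> W01p p \<Omega>" "is_weak_gradient \<Omega> \<xi> \<xi>'" "\<xi>' \<in> Lp p \<Omega>"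
proof -
  note wg = W01pD[OF u]
  let ?g = "weak_gradient \<Omega> u"
  obtain \<psi>n where \<psi>n: "\<And>n. \<psi>n n \<in> test_functions \<Omega>" "Lp_tendsto M p (\<lambda>n. gradient (\<psi>n n)) ?g"
    "AE x in M. (\<lambda>n. \<psi>n n x) \<longlonglongrightarrow> u x"
    using W01p_approximation[OF u] by blast
  define \<kappa> where "\<kappa> n = 1 / real (Suc n)" for n
  have \<kappa>: "\<kappa> n > 0" "\<kappa> n \<le> 1" for n by (auto simp: \<kappa>_def)
  have \<kappa>0: "\<kappa> \<longlonglongrightarrow> 0" unfolding \<kappa>_def using LIMSEQ_inverse_real_of_nat by (simp add: inverse_eq_divide)
  obtain R where R: "R > 0" "\<And>x. \<bar>\<psi> x\<bar> \<le> R" "\<And>x. norm (gradient \<psi> x) \<le> R"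
    by (rule test_functions_bounded[OF \<psi>]) (rule that)
  have "\<exists>R>0. \<forall>x. \<bar>\<psi>n n x\<bar> \<le> R" for n
    by (rule test_functions_bounded[OF \<psi>n(1)[of n]]) blast
  then obtain Rn where Rn: "\<And>n. Rn n > 0" "\<And>n x. \<bar>\<psi>n n x\<bar> \<le> Rn n" by metis
  have "\<forall>n. \<exists>P P'. real_polynomial_function P \<and> (\<forall>t. (P has_real_derivative P' t) (at t)) \<and> continuous_on UNIV P' \<and>
     P 0 = G 0 \<and> (\<forall>t. \<bar>t\<bar> \<le> R \<longrightarrow> \<bar>P t - G t\<bar> \<le> \<kappa> n \<and> \<bar>P' t - G' t\<bar> \<le> \<kappa> n)"
    using C1_polynomial_approximation[OF G(1,2)] R(1) \<kappa>(1) by (simp add: less_imp_le)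
  then obtain Gn Gn' where Gn: "\<And>n. real_polynomial_function (Gn n)"
     "\<And>n t. (Gn n has_real_derivative Gn' n t) (at t)" "\<And>n. continuous_on UNIV (Gn' n)"
     "\<And>n. Gn n 0 = G 0" "\<And>n t. \<bar>t\<bar> \<le> R \<Longrightarrow> \<bar>Gn n t - G t\<bar> \<le> \<kappa> n \<and> \<bar>Gn' n t - G' t\<bar> \<le> \<kappa> n"
    by metis
  have "\<forall>n. \<exists>P P'. real_polynomial_function P \<and> (\<forall>t. (P has_real_derivative P' t) (at t)) \<and> continuous_on UNIV P' \<and>
     P 0 = F 0 \<and> (\<forall>t. \<bar>t\<bar> \<le> Rn n \<longrightarrow> \<bar>P t - F t\<bar> \<le> \<kappa> n \<and> \<bar>P' t - F' t\<bar> \<le> \<kappa> n)"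
    using C1_polynomial_approximation[OF F] Rn(1) \<kappa>(1) by (simp add: less_imp_le)
  then obtain Fn Fn' where Fn: "\<And>n. real_polynomial_function (Fn n)"
     "\<And>n t. (Fn n has_real_derivative Fn' n t) (at t)" "\<And>n. continuous_on UNIV (Fn' n)"
     "\<And>n t. \<bar>t\<bar> \<le> Rn n \<Longrightarrow> \<bar>Fn n t - F t\<bar> \<le> \<kappa> n \<and> \<bar>Fn' n t - F' t\<bar> \<le> \<kappa> n"
    by metis
  have Gc: "continuous_on UNIV G" and Fc: "continuous_on UNIV F"
    using C1_deriv_continuous G(1) F(1) by blast+
  define gn where "gn n x = Gn n (\<psi> x)" for n x
  define gn' where "gn' n x = Gn' n (\<psi> x)" for n x
  define fn where "fn n x = Fn n (\<psi>n n x)" for n x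
  define fn' where "fn' n x = Fn' n (\<psi>n n x)" for n x
  \<comment> \<open>The four scalar factors are bounded uniformly in \<open>n\<close> and converge almost everywhere.\<close>
  have close: "\<bar>gn n x - G (\<psi> x)\<bar> \<le> \<kappa> n" "\<bar>gn' n x - G' (\<psi> x)\<bar> \<le> \<kappa> n"
     "\<bar>fn n x - F (\<psi>n n x)\<bar> \<le> \<kappa> n" "\<bar>fn' n x - F' (\<psi>n n x)\<bar> \<le> \<kappa> n" for n x
    using Gn(5)[OF R(2), of n x] Fn(4)[OF Rn(2), of n x] by (auto simp: gn_def gn'_def fn_def fn'_def)
  have "bounded ((\<lambda>t. max \<bar>G t\<bar> \<bar>G' t\<bar>) ` {-R..R})"
    by (intro compact_imp_bounded compact_continuous_image compact_Icc continuous_intros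
        continuous_on_subset[OF Gc] continuous_on_subset[OF G(2)]) auto
  then obtain CG where "\<forall>t\<in>{-R..R}. norm (max \<bar>G t\<bar> \<bar>G' t\<bar>) \<le> CG"
    unfolding bounded_iff by blast
  then have CG: "max \<bar>G t\<bar> \<bar>G' t\<bar> \<le> CG" if "t \<in> {-R..R}" for t
    using that by force
  have GC: "\<bar>G (\<psi> x)\<bar> \<le> CG" "\<bar>G' (\<psi> x)\<bar> \<le> CG" for x
    using CG[of "\<psi> x"] R(2)[of x] by (auto simp: abs_le_iff)
  have C0: "C \<ge> 0" "CG \<ge> 0" using bd(1)[of 0] GC(1)[of undefined] by linarith+
  have gn_bd: "\<bar>gn n x\<bar> \<le> CG + 1" "\<bar>gn' n x\<bar> \<le> CG + 1" "\<bar>fn n x\<bar> \<le> C + 1" "\<bar>fn' n x\<bar> \<le> C + 1" for n x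
  proof -
    show "\<bar>gn n x\<bar> \<le> CG + 1" using close(1)[of n x] GC(1)[of x] \<kappa>(2)[of n] by linarith
    show "\<bar>gn' n x\<bar> \<le> CG + 1" using close(2)[of n x] GC(2)[of x] \<kappa>(2)[of n] by linarith
    show "\<bar>fn n x\<bar> \<le> C + 1" using close(3)[of n x] bd(1)[of "\<psi>n n x"] \<kappa>(2)[of n] by linarith
    show "\<bar>fn' n x\<bar> \<le> C + 1" using close(4)[of n x] bd(2)[of "\<psi>n n x"] \<kappa>(2)[of n] by linarith
  qed
  \<comment> \<open>A sequence that stays within \<open>\<kappa> n\<close> of a convergent one has the same limit.\<close>
  have lim_aux: "a \<longlonglongrightarrow> l" if "\<And>n. \<bar>a n - b n\<bar> \<le> \<kappa> n" "b \<longlonglongrightarrow> l" for a b :: "nat \<Rightarrow> real" and l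
  proof -
    have "\<forall>n. norm (a n - b n) \<le> \<kappa> n" using that(1) by simp
    from Lim_null_comparison[OF always_eventually[OF this] \<kappa>0] have "(\<lambda>n. a n - b n) \<longlonglongrightarrow> 0" .
    from tendsto_add[OF this that(2)] show ?thesis by simp
  qed
  have lim_g: "(\<lambda>n. gn n x) \<longlonglongrightarrow> G (\<psi> x)" "(\<lambda>n. gn' n x) \<longlonglongrightarrow> G' (\<psi> x)" for x
    using lim_aux[OF close(1) tendsto_const] lim_aux[OF close(2) tendsto_const] by auto
  have lim_f: "AE x in M. (\<lambda>n. fn n x) \<longlonglongrightarrow> F (u x) \<and> (\<lambda>n. fn' n x) \<longlonglongrightarrow> F' (u x)"
    using \<psi>n(3)
  proof eventually_elim
    case (elim x)
    have "isCont F (u x)" "isCont F' (u x)" using Fc F(2) by (auto simp: continuous_on_eq_continuous_at)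
    then have "(\<lambda>n. F (\<psi>n n x)) \<longlonglongrightarrow> F (u x)" "(\<lambda>n. F' (\<psi>n n x)) \<longlonglongrightarrow> F' (u x)"
      using elim isCont_tendsto_compose by blast+
    then show ?case
      using lim_aux[of "\<lambda>n. fn n x" "\<lambda>n. F (\<psi>n n x)", OF close(3)]
        lim_aux[of "\<lambda>n. fn' n x" "\<lambda>n. F' (\<psi>n n x)", OF close(4)] by blast
  qed
  define \<xi>n where "\<xi>n n x = gn n x * fn n x" for n x
  have \<xi>n: "\<xi>n n \<in> test_functions \<Omega>" for n
  proof -
    obtain K where K: "compact K" "K \<subseteq> \<Omega>" "\<And>x. x \<notin> K \<Longrightarrow> \<psi> x = 0"
      by (rule test_functions_support[OF \<psi>]) (rule that)
    show ?thesis
    proof (rule test_functionsI[OF _ K(1,2)])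
      show "smooth (\<xi>n n)" unfolding \<xi>n_def[abs_def] gn_def fn_def
        by (rule smooth_mult[OF smooth_polynomial[OF Gn(1) test_functions_smooth[OF \<psi>]]
            smooth_polynomial[OF Fn(1) test_functions_smooth[OF \<psi>n(1)]]])
      show "\<xi>n n x = 0" if "x \<notin> K" for x using K(3)[OF that] Gn(4) G(3) by (simp add: \<xi>n_def gn_def)
    qed
  qed
  have grad: "gradient (\<xi>n n) = (\<lambda>x. (fn n x * gn' n x) *\<^sub>R gradient \<psi> x + (gn n x * fn' n x) *\<^sub>R gradient (\<psi>n n) x)" for n
  proof -
    have "C1_gradient (\<lambda>x. Gn n (\<psi> x) * Fn n (\<psi>n n x))
      (\<lambda>x. Gn n (\<psi> x) *\<^sub>R (Fn' n (\<psi>n n x) *\<^sub>R gradient (\<psi>n n) x) + Fn n (\<psi>n n x) *\<^sub>R (Gn' n (\<psi> x) *\<^sub>R gradient \<psi> x))"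
      by (rule C1_mult[OF C1_chain[OF test_functions_C1[OF \<psi>] Gn(2,3)] C1_chain[OF test_functions_C1[OF \<psi>n(1)] Fn(2,3)]])
    from gradient_eq[OF this] show ?thesis
      by (simp add: \<xi>n_def[abs_def] gn_def gn'_def fn_def fn'_def add.commute)
  qed
  have m\<psi>: "\<psi> \<in> borel_measurable M" "\<psi>n n \<in> borel_measurable M" "u \<in> borel_measurable M" for n
    using test_functions_measurable[OF \<psi>] test_functions_measurable[OF \<psi>n(1)] LpD(1)[OF wg(1)] by auto
  have m: "gn n \<in> borel_measurable M" "gn' n \<in> borel_measurable M" "fn n \<in> borel_measurable M" "fn' n \<in> borel_measurable M" for n
    unfolding gn_def[abs_def] gn'_def[abs_def] fn_def[abs_def] fn'_def[abs_def]
    by (rule borel_measurable_compose_continuous[OF C1_deriv_continuous[OF Gn(2)] m\<psi>(1)]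
        borel_measurable_compose_continuous[OF Gn(3) m\<psi>(1)]
        borel_measurable_compose_continuous[OF C1_deriv_continuous[OF Fn(2)] m\<psi>(2)]
        borel_measurable_compose_continuous[OF Fn(3) m\<psi>(2)])+
  note mG = borel_measurable_compose_continuous[OF Gc m\<psi>(1)] borel_measurable_compose_continuous[OF G(2) m\<psi>(1)]
    borel_measurable_compose_continuous[OF Fc m\<psi>(3)] borel_measurable_compose_continuous[OF F(2) m\<psi>(3)]
  define K where "K = (CG + 1) * (C + 1)"
  have bdK: "\<bar>gn n x * fn n x\<bar> \<le> K" "\<bar>fn n x * gn' n x\<bar> \<le> K" "\<bar>gn n x * fn' n x\<bar> \<le> K" for n x
    using gn_bd[of n x] C0 unfolding K_def abs_mult
    by (auto intro!: mult_mono simp: mult.commute[of "\<bar>fn n x\<bar>"])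
  have one: "(\<lambda>x. 1::real) \<in> Lp p \<Omega>" "Lp_tendsto M p (\<lambda>n x. 1::real) (\<lambda>x. 1)"
    using p_pos by (auto simp: Lp_tendsto_def intro!: Lp_bounded[of _ 1])
  have lim0: "AE x in M. (\<lambda>n. gn n x * fn n x) \<longlonglongrightarrow> G (\<psi> x) * F (u x)"
    and lim1: "AE x in M. (\<lambda>n. fn n x * gn' n x) \<longlonglongrightarrow> F (u x) * G' (\<psi> x)"
    and lim2: "AE x in M. (\<lambda>n. gn n x * fn' n x) \<longlonglongrightarrow> G (\<psi> x) * F' (u x)"
    using lim_f by (eventually_elim, intro tendsto_mult lim_g, simp)+
  have tconst: "Lp_tendsto M p (\<lambda>n. gradient \<psi>) (gradient \<psi>)" using p_pos by (simp add: Lp_tendsto_def)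
  note mt = borel_measurable_times
  note L0 = Lp_tendsto_scaleR[OF mt[OF m(1,3)] AE_I2[OF bdK(1)] mt[OF mG(1,3)] lim0 one(1) one(1) one(2)]
  note L1 = Lp_tendsto_scaleR[OF mt[OF m(3,2)] AE_I2[OF bdK(2)] mt[OF mG(3,2)] lim1
      test_function_Lp(2)[OF \<psi>] test_function_Lp(2)[OF \<psi>] tconst]
  note L2 = Lp_tendsto_scaleR[OF mt[OF m(1,4)] AE_I2[OF bdK(3)] mt[OF mG(1,4)] lim2
      test_function_Lp(2)[OF \<psi>n(1)] wg(3) \<psi>n(2)]
  show \<xi>': "\<xi>' \<in> Lp p \<Omega>" unfolding \<xi>'_def by (rule Lp_add[OF L1(2) L2(2)])
  have \<xi>: "\<xi> \<in> Lp p \<Omega>" using L0(2) by (simp add: \<xi>_def)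
  have T1: "Lp_tendsto M p \<xi>n \<xi>" using L0(3) by (simp add: \<xi>_def \<xi>n_def[abs_def])
  have T2: "Lp_tendsto M p (\<lambda>n. gradient (\<xi>n n)) \<xi>'"
    unfolding grad \<xi>'_def by (rule Lp_tendsto_add[OF L1 L2])
  show "\<xi> \<in> W01p p \<Omega>" "is_weak_gradient \<Omega> \<xi> \<xi>'"
    by (rule W01pI[OF \<xi>n \<xi> \<xi>' T1 T2])+
qed

text \<open>Here \<open>F\<close> may be unbounded, as the logarithm is; its Lipschitz continuity yields convergence in \<open>L\<^sup>p\<close>.\<close>

lemma is_weak_gradient_compose:
  fixes F F' :: "real \<Rightarrow> real"
  assumes u: "u \<in> W01p p \<Omega>"
    and F: "\<And>t. (F has_real_derivative F' t) (at t)" "continuous_on UNIV F'" "\<And>t. \<bar>F' t\<bar> \<le> C"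
  shows "is_weak_gradient \<Omega> (\<lambda>x. F (u x)) (\<lambda>x. F' (u x) *\<^sub>R weak_gradient \<Omega> u x)"
    "(\<lambda>x. F (u x)) \<in> Lp p \<Omega>" "(\<lambda>x. F' (u x) *\<^sub>R weak_gradient \<Omega> u x) \<in> Lp p \<Omega>"
proof -
  note wg = W01pD[OF u]
  let ?g = "weak_gradient \<Omega> u"
  obtain \<psi>n where \<psi>n: "\<And>n. \<psi>n n \<in> test_functions \<Omega>" "Lp_tendsto M p \<psi>n u" "Lp_tendsto M p (\<lambda>n. gradient (\<psi>n n)) ?g"
    "AE x in M. (\<lambda>n. \<psi>n n x) \<longlonglongrightarrow> u x"
    using W01p_approximation[OF u] by blast
  have Fc: "continuous_on UNIV F" using C1_deriv_continuous F(1) by blast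
  have lip: "\<bar>F s - F t\<bar> \<le> C * \<bar>s - t\<bar>" for s t
    using field_differentiable_bound[of UNIV F F' C s t] F by auto
  have m: "\<psi>n n \<in> borel_measurable M" "u \<in> borel_measurable M" for n
    using test_functions_measurable[OF \<psi>n(1)] LpD(1)[OF wg(1)] by auto
  have FLp: "(\<lambda>x. F (w x)) \<in> Lp p \<Omega>" if w: "w \<in> Lp p \<Omega>" for w
  proof -
    have "(\<lambda>x. F (w x) - F 0) \<in> Lp p \<Omega>"
    proof (rule Lp_bound[OF w, of _ C])
      show "(\<lambda>x. F (w x) - F 0) \<in> borel_measurable M"
        using borel_measurable_compose_continuous[OF Fc LpD(1)[OF w]] by simp
      show "AE x in M. norm (F (w x) - F 0) \<le> C * norm (w x)" using lip[of _ 0] by simp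
    qed
    then have "(\<lambda>x. (F (w x) - F 0) + F 0) \<in> Lp p \<Omega>"
      by (rule Lp_add) (auto intro!: Lp_bounded[of _ "\<bar>F 0\<bar>"])
    then show ?thesis by simp
  qed
  show Fu: "(\<lambda>x. F (u x)) \<in> Lp p \<Omega>" by (rule FLp[OF wg(1)])
  have T1: "Lp_tendsto M p (\<lambda>n x. F (\<psi>n n x)) (\<lambda>x. F (u x))"
  proof (rule Lp_tendsto_bound)
    show "AE x in M. norm (F (\<psi>n n x) - F (u x)) powr p \<le> \<bar>C\<bar> powr p * norm (\<psi>n n x - u x) powr p" for n
    proof (rule AE_I2)
      fix x
      have "C * \<bar>\<psi>n n x - u x\<bar> \<le> \<bar>C\<bar> * \<bar>\<psi>n n x - u x\<bar>" by (intro mult_right_mono) auto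
      then have "norm (F (\<psi>n n x) - F (u x)) powr p \<le> (\<bar>C\<bar> * \<bar>\<psi>n n x - u x\<bar>) powr p"
        using lip[of "\<psi>n n x" "u x"] p_pos by (intro powr_mono2) auto
      then show "norm (F (\<psi>n n x) - F (u x)) powr p \<le> \<bar>C\<bar> powr p * norm (\<psi>n n x - u x) powr p"
        by (simp add: powr_mult)
    qed
    show "integrable M (\<lambda>x. \<bar>C\<bar> powr p * norm (\<psi>n n x - u x) powr p)" for n
      by (intro integrable_mult_right LpD(2) Lp_diff test_function_Lp \<psi>n wg)
    show "(\<lambda>n. LINT x|M. \<bar>C\<bar> powr p * norm (\<psi>n n x - u x) powr p) \<longlonglongrightarrow> 0"
      using tendsto_mult_right_zero[OF \<psi>n(2)[unfolded Lp_tendsto_def], of "\<bar>C\<bar> powr p"] by simp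
  qed
  have lim: "AE x in M. (\<lambda>n. F' (\<psi>n n x)) \<longlonglongrightarrow> F' (u x)"
    using \<psi>n(4)
  proof eventually_elim
    case (elim x)
    have "isCont F' (u x)" using F(2) by (auto simp: continuous_on_eq_continuous_at)
    then show ?case using elim isCont_tendsto_compose by blast
  qed
  note mF = borel_measurable_compose_continuous[OF F(2) m(1)] borel_measurable_compose_continuous[OF F(2) m(2)]
  note T2 = Lp_tendsto_scaleR[OF mF(1) AE_I2[OF F(3)] mF(2) lim test_function_Lp(2)[OF \<psi>n(1)] wg(3) \<psi>n(3)]
  show "(\<lambda>x. F' (u x) *\<^sub>R ?g x) \<in> Lp p \<Omega>" by (rule T2(2))
  show "is_weak_gradient \<Omega> (\<lambda>x. F (u x)) (\<lambda>x. F' (u x) *\<^sub>R ?g x)"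
  proof (rule is_weak_gradient_Lp_limit[OF _ FLp[OF test_function_Lp(1)[OF \<psi>n(1)]] T2(1) Fu T2(2) T1 T2(3)])
    show "is_weak_gradient \<Omega> (\<lambda>x. F (\<psi>n n x)) (\<lambda>x. F' (\<psi>n n x) *\<^sub>R gradient (\<psi>n n) x)" for n
      by (intro is_weak_gradient_C1 C1_chain[OF test_functions_C1[OF \<psi>n(1)] F(1,2)])
  qed
qed

end

section \<open>The inequality of Picone\<close>

text \<open>The value \<open>s = 1\<close> gives the sharp constant in Picone's inequality; for \<open>s < 1\<close> a part of the term
  with \<open>X\<close> is left over, which yields the logarithmic energy estimate.\<close>

lemma weighted_Young:
  fixes p s b X :: real
  assumes "p > 1" "s > 0" "b \<ge> 0" "X \<ge> 0"
  shows "p * b * X powr (p - 1) \<le> s powr (1 - p) * b powr p + (p - 1) * s * X powr p"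
proof -
  define q where "q = p / (p - 1)"
  have q: "q > 1" "1 / p + 1 / q = 1" using assms by (auto simp: q_def divide_simps)
  define a where "a = s powr ((1 - p) / p) * b"
  define c where "c = s powr ((p - 1) / p) * X powr (p - 1)"
  have ac: "a * c = b * X powr (p - 1)"
  proof -
    have "s powr ((1 - p) / p) * s powr ((p - 1) / p) = s powr ((1 - p) / p + (p - 1) / p)"
      by (simp add: powr_add)
    also have "(1 - p) / p + (p - 1) / p = 0" by (simp add: diff_divide_distrib)
    finally show ?thesis using assms by (simp add: a_def c_def algebra_simps)
  qed
  have ap: "a powr p = s powr (1 - p) * b powr p"
    using assms by (simp add: a_def powr_mult powr_powr)
  have cq: "c powr q = s * X powr p"
  proof -
    have "c powr q = s powr ((p - 1) / p * q) * X powr ((p - 1) * q)"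
      using assms by (simp add: c_def powr_mult powr_powr)
    moreover have "(p - 1) / p * q = 1" "(p - 1) * q = p" using assms by (auto simp: q_def)
    ultimately show ?thesis using assms by simp
  qed
  have "a * c \<le> a powr p / p + c powr q / q"
    using assms q by (intro Youngs_inequality) (auto simp: a_def c_def)
  then have "p * (a * c) \<le> p * (a powr p / p + c powr q / q)" using assms by (intro mult_left_mono) auto
  also have "\<dots> = a powr p + (p - 1) * c powr q" using assms by (simp add: q_def field_simps)
  finally show ?thesis by (simp add: ac ap cq mult.assoc)
qed

text \<open>Functions that are only needed on the positive half line are continued across \<open>0\<close> by
  reflection, which keeps them continuously differentiable. Such a continuation is necessary because
  the test functions approximating a nonnegative Sobolev function may change sign.\<close>

definition odd_extension :: "(real \<Rightarrow> real) \<Rightarrow> real \<Rightarrow> real" where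
  "odd_extension f t = (if t \<ge> 0 then f t else 2 * f 0 - f (- t))"

lemma odd_extension_has_derivative:
  assumes f: "\<And>t. t \<ge> 0 \<Longrightarrow> (f has_real_derivative f' t) (at t)"
  shows "(odd_extension f has_real_derivative f' \<bar>t\<bar>) (at t)"
proof -
  have neg: "((\<lambda>t. 2 * f 0 - f (- t)) has_real_derivative f' (- t)) (at t)" if "t \<le> 0" for t
  proof -
    have "(f has_real_derivative f' (- t)) (at (- t))" using f that by simp
    then have "((\<lambda>t. f (- t)) has_real_derivative f' (- t) * -1) (at t)"
      by (rule DERIV_chain2) (auto intro!: derivative_eq_intros)
    from DERIV_diff[OF DERIV_const this] show ?thesis by simp
  qed
  consider "t > 0" | "t < 0" | "t = 0" by linarith
  then show ?thesis
  proof cases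
    case 1
    then show ?thesis
      using has_field_derivative_transform_within_open[OF f[of t], of "{0<..}" "odd_extension f"]
      by (simp add: odd_extension_def)
  next
    case 2
    then show ?thesis
      using has_field_derivative_transform_within_open[OF neg[of t], of "{..<0}" "odd_extension f"]
      by (simp add: odd_extension_def)
  next
    case 3
    have r: "((\<lambda>y. (f y - f 0) / (y - 0)) \<longlongrightarrow> f' 0) (at_right 0)"
      using f[of 0] unfolding has_field_derivative_iff by (auto simp: filterlim_at_split)
    have l: "((\<lambda>y. ((2 * f 0 - f (- y)) - f 0) / (y - 0)) \<longlongrightarrow> f' 0) (at_left 0)"
      using neg[of 0] unfolding has_field_derivative_iff by (auto simp: filterlim_at_split)
    have "((\<lambda>y. (odd_extension f y - odd_extension f 0) / (y - 0)) \<longlongrightarrow> f' 0) (at_right 0)"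
      using r by (rule Lim_transform_eventually) (auto simp: odd_extension_def eventually_at_filter)
    moreover have "((\<lambda>y. (odd_extension f y - odd_extension f 0) / (y - 0)) \<longlongrightarrow> f' 0) (at_left 0)"
      using l by (rule Lim_transform_eventually) (auto simp: odd_extension_def eventually_at_filter)
    ultimately show ?thesis using 3 unfolding has_field_derivative_iff by (simp add: filterlim_at_split)
  qed
qed

text \<open>The function \<open>(t + \<delta>)\<^sup>1\<^sup>-\<^sup>p\<close>, continued to negative arguments.\<close>

definition damp :: "real \<Rightarrow> real \<Rightarrow> real \<Rightarrow> real" where
  "damp p \<delta> = odd_extension (\<lambda>t. (t + \<delta>) powr (1 - p))"

definition damp' :: "real \<Rightarrow> real \<Rightarrow> real \<Rightarrow> real" where
  "damp' p \<delta> t = (1 - p) * (\<bar>t\<bar> + \<delta>) powr (- p)"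

lemma damp_nonneg_eq: "t \<ge> 0 \<Longrightarrow> damp p \<delta> t = (t + \<delta>) powr (1 - p)"
  by (simp add: damp_def odd_extension_def)

lemma damp_has_derivative:
  assumes "\<delta> > 0"
  shows "(damp p \<delta> has_real_derivative damp' p \<delta> t) (at t)"
proof -
  have "((\<lambda>t. (t + \<delta>) powr (1 - p)) has_real_derivative (1 - p) * (t + \<delta>) powr (- p)) (at t)" if "t \<ge> 0" for t
  proof -
    have "((\<lambda>z. z powr (1 - p)) has_real_derivative (1 - p) * (t + \<delta>) powr (1 - p - 1)) (at (t + \<delta>))"
      using that assms by (intro has_real_derivative_powr) auto
    moreover have "((\<lambda>t. t + \<delta>) has_real_derivative 1) (at t)" by (auto intro!: derivative_eq_intros)
    ultimately show ?thesis using DERIV_chain2 by fastforce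
  qed
  from odd_extension_has_derivative[of "\<lambda>t. (t + \<delta>) powr (1 - p)", OF this]
  show ?thesis by (simp add: damp_def damp'_def)
qed

lemma damp'_continuous: "\<delta> > 0 \<Longrightarrow> continuous_on UNIV (damp' p \<delta>)"
  unfolding damp'_def[abs_def] by (intro continuous_intros) auto

lemma damp_bounded:
  assumes "\<delta> > 0" "p > 1"
  shows "\<exists>C. (\<forall>t. \<bar>damp p \<delta> t\<bar> \<le> C) \<and> (\<forall>t. \<bar>damp' p \<delta> t\<bar> \<le> C)"
proof -
  have a: "(s + \<delta>) powr (1 - p) \<le> \<delta> powr (1 - p)" "(s + \<delta>) powr (- p) \<le> \<delta> powr (- p)" if "s \<ge> 0" for s
    using assms that by (auto intro!: powr_mono2')
  have "\<bar>damp p \<delta> t\<bar> \<le> 2 * \<delta> powr (1 - p)" for t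
  proof -
    have "0 \<le> (\<bar>t\<bar> + \<delta>) powr (1 - p)" "(\<bar>t\<bar> + \<delta>) powr (1 - p) \<le> \<delta> powr (1 - p)"
      using a(1)[of "\<bar>t\<bar>"] by auto
    moreover have "damp p \<delta> t = (\<bar>t\<bar> + \<delta>) powr (1 - p) \<or>
        damp p \<delta> t = 2 * \<delta> powr (1 - p) - (\<bar>t\<bar> + \<delta>) powr (1 - p)"
      by (auto simp: damp_def odd_extension_def)
    ultimately show ?thesis by linarith
  qed
  moreover have "\<bar>damp' p \<delta> t\<bar> \<le> (p - 1) * \<delta> powr (- p)" for t
    using mult_left_mono[OF a(2)[of "\<bar>t\<bar>"], of "p - 1"] assms by (simp add: damp'_def abs_mult)
  ultimately show ?thesis
    by (intro exI[of _ "max (2 * \<delta> powr (1 - p)) ((p - 1) * \<delta> powr (- p))"]) (auto simp: le_max_iff_disj)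
qed

lemma abs_powr_has_derivative:
  assumes "p > 1"
  shows "((\<lambda>s::real. \<bar>s\<bar> powr p) has_real_derivative p * (\<bar>s\<bar> powr (p - 1) * sgn s)) (at s)"
proof -
  consider "s > 0" | "s < 0" | "s = 0" by linarith
  then show ?thesis
  proof cases
    case 1
    have "((\<lambda>s. s powr p) has_real_derivative p * (\<bar>s\<bar> powr (p - 1) * sgn s)) (at s)"
      using 1 by (auto intro!: derivative_eq_intros)
    then show ?thesis
      by (rule has_field_derivative_transform_within_open[where S="{0<..}"]) (use 1 in auto)
  next
    case 2
    have "((\<lambda>s. (- s) powr p) has_real_derivative p * (\<bar>s\<bar> powr (p - 1) * sgn s)) (at s)"
      using 2 by (auto intro!: derivative_eq_intros)
    then show ?thesis
      by (rule has_field_derivative_transform_within_open[where S="{..<0}"]) (use 2 in auto)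
  next
    case 3
    have "((\<lambda>h::real. \<bar>h\<bar> powr (p - 1)) \<longlongrightarrow> \<bar>0\<bar> powr (p - 1)) (at 0)"
      using assms by (intro tendsto_powr' tendsto_intros) auto
    then have t: "((\<lambda>h::real. \<bar>h\<bar> powr (p - 1)) \<longlongrightarrow> 0) (at 0)" using assms by simp
    have "((\<lambda>h::real. (\<bar>h\<bar> powr p - \<bar>0\<bar> powr p) / (h - 0)) \<longlongrightarrow> 0) (at 0)"
    proof (rule Lim_null_comparison[OF _ t])
      show "\<forall>\<^sub>F h::real in at 0. norm ((\<bar>h\<bar> powr p - \<bar>0\<bar> powr p) / (h - 0)) \<le> \<bar>h\<bar> powr (p - 1)"
        using assms by (auto simp: eventually_at_filter powr_diff intro!: always_eventually)
    qed
    then show ?thesis using 3 by (simp add: has_field_derivative_iff)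
  qed
qed

lemma abs_powr_derivative_continuous:
  fixes p :: real
  assumes "p > 1"
  shows "continuous_on UNIV (\<lambda>s::real. p * (\<bar>s\<bar> powr (p - 1) * sgn s))"
proof -
  have "isCont (\<lambda>s::real. \<bar>s\<bar> powr (p - 1) * sgn s) s" for s
  proof (cases "s = 0")
    case True
    have "((\<lambda>h::real. \<bar>h\<bar> powr (p - 1)) \<longlongrightarrow> \<bar>0\<bar> powr (p - 1)) (at 0)"
      using assms by (intro tendsto_powr' tendsto_intros) auto
    then have t: "((\<lambda>h::real. \<bar>h\<bar> powr (p - 1)) \<longlongrightarrow> 0) (at 0)" using assms by simp
    have "((\<lambda>s::real. \<bar>s\<bar> powr (p - 1) * sgn s) \<longlongrightarrow> 0) (at 0)"
      by (rule Lim_null_comparison[OF _ t]) (auto simp: abs_mult sgn_real_def intro!: always_eventually)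
    then show ?thesis using True by (simp add: isCont_def)
  next
    case False
    then show ?thesis by (intro continuous_intros) auto
  qed
  then have "continuous_on UNIV (\<lambda>s::real. \<bar>s\<bar> powr (p - 1) * sgn s)"
    by (simp add: continuous_at_imp_continuous_on)
  then show ?thesis by (rule continuous_on_mult[OF continuous_on_const])
qed

text \<open>Composition with a contraction that fixes \<open>0\<close> does not increase \<open>\<integral> |\<nabla>\<psi>|\<^sup>p\<close>. Both
  truncations and the identity are used.\<close>

definition contraction :: "(real \<Rightarrow> real) \<Rightarrow> (real \<Rightarrow> real) \<Rightarrow> bool" where
  "contraction T T' \<longleftrightarrow> (\<forall>t. (T has_real_derivative T' t) (at t)) \<and> continuous_on UNIV T' \<and> T 0 = 0 \<and> (\<forall>t. \<bar>T' t\<bar> \<le> 1)"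

lemma contraction_abs_le: assumes "contraction T T'" shows "\<bar>T t\<bar> \<le> \<bar>t\<bar>"
  using field_differentiable_bound[of UNIV T T' 1 t 0] assms by (auto simp: contraction_def)

lemma contraction_continuous: "contraction T T' \<Longrightarrow> continuous_on UNIV T"
  unfolding contraction_def using DERIV_isCont continuous_at_imp_continuous_on by blast

context sobolev_setting
begin

text \<open>The test function \<open>\<phi>\<^sup>p / (u + \<delta>)\<^sup>p\<^sup>-\<^sup>1\<close> with \<open>\<phi> = |T(\<psi>)|\<close>.\<close>

definition picone_test :: "(real \<Rightarrow> real) \<Rightarrow> real \<Rightarrow> ('a \<Rightarrow> real) \<Rightarrow> ('a \<Rightarrow> real) \<Rightarrow> 'a \<Rightarrow> real" where
  "picone_test T \<delta> \<psi> u x = \<bar>T (\<psi> x)\<bar> powr p * damp p \<delta> (u x)"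

lemma picone_test_W01p:
  assumes u: "u \<in> W01p p \<Omega>" and \<psi>: "\<psi> \<in> test_functions \<Omega>" and T: "contraction T T'" and \<delta>: "\<delta> > 0"
  defines "\<xi>' \<equiv> \<lambda>x. (damp p \<delta> (u x) * (p * (\<bar>T (\<psi> x)\<bar> powr (p - 1) * sgn (T (\<psi> x))) * T' (\<psi> x))) *\<^sub>R gradient \<psi> x +
      (\<bar>T (\<psi> x)\<bar> powr p * damp' p \<delta> (u x)) *\<^sub>R weak_gradient \<Omega> u x"
  shows "picone_test T \<delta> \<psi> u \<in> W01p p \<Omega>" "\<xi>' \<in> Lp p \<Omega>"
    "AE x in M. weak_gradient \<Omega> (picone_test T \<delta> \<psi> u) x = \<xi>' x"
proof -
  obtain C where C: "\<And>t. \<bar>damp p \<delta> t\<bar> \<le> C" "\<And>t. \<bar>damp' p \<delta> t\<bar> \<le> C"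
    using damp_bounded[OF \<delta> p_gt_1] by blast
  have T': "\<And>t. (T has_real_derivative T' t) (at t)" "continuous_on UNIV T'" "T 0 = 0"
    using T by (auto simp: contraction_def)
  have G: "((\<lambda>t. \<bar>T t\<bar> powr p) has_real_derivative p * (\<bar>T t\<bar> powr (p - 1) * sgn (T t)) * T' t) (at t)" for t
    by (rule DERIV_chain2[OF abs_powr_has_derivative[OF p_gt_1] T'(1)])
  have Gc: "continuous_on UNIV (\<lambda>t. p * (\<bar>T t\<bar> powr (p - 1) * sgn (T t)) * T' t)"
    by (rule continuous_on_mult[OF continuous_on_compose2[OF abs_powr_derivative_continuous[OF p_gt_1]
            contraction_continuous[OF T] subset_UNIV] T'(2)])
  have G0: "\<bar>T 0\<bar> powr p = 0" using T'(3) by simp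
  note W = W01p_product_compose[OF \<psi> u G Gc G0 damp_has_derivative[OF \<delta>] damp'_continuous[OF \<delta>] C]
  have eq: "picone_test T \<delta> \<psi> u = (\<lambda>x. \<bar>T (\<psi> x)\<bar> powr p * damp p \<delta> (u x))"
    by (simp add: picone_test_def[abs_def])
  show "picone_test T \<delta> \<psi> u \<in> W01p p \<Omega>" "\<xi>' \<in> Lp p \<Omega>"
    "AE x in M. weak_gradient \<Omega> (picone_test T \<delta> \<psi> u) x = \<xi>' x"
    unfolding eq \<xi>'_def using W weak_gradient_AE(2)[OF W(2)] by blast+
qed

text \<open>With \<open>X = |\<tau>| |g| / w\<close> the left-hand side is at most \<open>p |h| X\<^sup>p\<^sup>-\<^sup>1 - (p - 1) X\<^sup>p\<close> by the
  Cauchy-Schwarz inequality, and Young's inequality applies.\<close>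

lemma picone_pointwise:
  fixes g h :: 'a
  assumes w: "w > 0" and s: "s > 0" and d: "\<bar>d\<bar> \<le> 1"
  shows "norm g powr (p - 2) * (g \<bullet> ((w powr (1 - p) * (p * (\<bar>\<tau>\<bar> powr (p - 1) * sgn \<tau>) * d)) *\<^sub>R h +
      (\<bar>\<tau>\<bar> powr p * ((1 - p) * w powr (- p))) *\<^sub>R g))
    \<le> s powr (1 - p) * norm h powr p - (p - 1) * (1 - s) * (\<bar>\<tau>\<bar> * norm g / w) powr p"
proof (cases "g = 0")
  case True
  then show ?thesis using p_pos by simp
next
  case False
  define X where "X = \<bar>\<tau>\<bar> * norm g / w"
  have X: "X \<ge> 0" using w by (simp add: X_def)
  have Xp: "X powr r = \<bar>\<tau>\<bar> powr r * norm g powr r * w powr (- r)" for r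
    using w by (simp add: X_def powr_divide powr_mult powr_minus_divide)
  have n2: "norm g powr (p - 2) * (g \<bullet> g) = norm g powr p"
  proof -
    have "norm g powr p = norm g powr (p - 2) * norm g powr 2"
      using powr_add[of "norm g" "p - 2" 2] by simp
    then show ?thesis using False by (simp add: dot_square_norm)
  qed
  have n1: "norm g powr (p - 2) * \<bar>g \<bullet> h\<bar> \<le> norm g powr (p - 1) * norm h"
  proof -
    have "norm g powr (p - 2) * \<bar>g \<bullet> h\<bar> \<le> norm g powr (p - 2) * (norm g * norm h)"
      by (intro mult_left_mono Cauchy_Schwarz_ineq2) auto
    also have "\<dots> = (norm g powr (p - 2) * norm g powr 1) * norm h" using False by simp
    also have "norm g powr (p - 2) * norm g powr 1 = norm g powr (p - 1)"
      using powr_add[of "norm g" "p - 2" 1] by simp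
    finally show ?thesis .
  qed
  define A where "A = w powr (1 - p) * (p * (\<bar>\<tau>\<bar> powr (p - 1) * sgn \<tau>) * d)"
  have A: "\<bar>A\<bar> \<le> p * \<bar>\<tau>\<bar> powr (p - 1) * w powr (1 - p)"
  proof -
    have sd: "\<bar>sgn \<tau>\<bar> * \<bar>d\<bar> \<le> 1" using d by (auto simp: sgn_real_def)
    have "\<bar>A\<bar> = (p * \<bar>\<tau>\<bar> powr (p - 1) * w powr (1 - p)) * (\<bar>sgn \<tau>\<bar> * \<bar>d\<bar>)"
      using p_pos by (simp add: A_def abs_mult)
    also have "\<dots> \<le> (p * \<bar>\<tau>\<bar> powr (p - 1) * w powr (1 - p)) * 1"
      using p_pos by (intro mult_left_mono sd) auto
    finally show ?thesis by simp
  qed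
  have "norm g powr (p - 2) * (A * (g \<bullet> h)) \<le> \<bar>A\<bar> * (norm g powr (p - 2) * \<bar>g \<bullet> h\<bar>)"
    using mult_left_mono[OF abs_ge_self[of "A * (g \<bullet> h)"], of "norm g powr (p - 2)"]
    by (simp add: abs_mult mult.left_commute)
  also have "\<dots> \<le> (p * \<bar>\<tau>\<bar> powr (p - 1) * w powr (1 - p)) * (norm g powr (p - 1) * norm h)"
    using p_pos by (intro mult_mono A n1) auto
  also have "\<dots> = p * norm h * X powr (p - 1)" by (simp add: Xp)
  also have "\<dots> \<le> s powr (1 - p) * norm h powr p + (p - 1) * s * X powr p"
    by (rule weighted_Young[OF p_gt_1 s _ X]) simp
  finally have 1: "norm g powr (p - 2) * (A * (g \<bullet> h)) \<le> s powr (1 - p) * norm h powr p + (p - 1) * s * X powr p" .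
  have 2: "norm g powr (p - 2) * ((\<bar>\<tau>\<bar> powr p * ((1 - p) * w powr (- p))) * (g \<bullet> g)) = - ((p - 1) * X powr p)"
  proof -
    have "norm g powr (p - 2) * ((\<bar>\<tau>\<bar> powr p * ((1 - p) * w powr (- p))) * (g \<bullet> g)) =
      (norm g powr (p - 2) * (g \<bullet> g)) * (\<bar>\<tau>\<bar> powr p * ((1 - p) * w powr (- p)))" by simp
    also have "\<dots> = - ((p - 1) * X powr p)" unfolding n2 Xp by (simp add: algebra_simps)
    finally show ?thesis .
  qed
  show ?thesis
    unfolding A_def[symmetric] X_def[symmetric] inner_add_right inner_scaleR_right distrib_left
    using 1 2 by (simp add: algebra_simps)
qed

text \<open>Young's inequality with parameter \<open>s\<close>, integrated. The quantity \<open>X\<close> is \<open>|T(\<psi>)|\<close> times the length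
  of the gradient of \<open>ln (u + \<delta>)\<close>.\<close>

lemma picone_inequality:
  assumes u: "u \<in> W01p p \<Omega>" "\<And>x. x \<in> \<Omega> \<Longrightarrow> u x \<ge> 0" and \<psi>: "\<psi> \<in> test_functions \<Omega>"
    and T: "contraction T T'" and \<delta>: "\<delta> > 0" and s: "s > 0"
  defines "X \<equiv> \<lambda>x. \<bar>T (\<psi> x)\<bar> * norm (weak_gradient \<Omega> u x) / (u x + \<delta>)"
  shows "integrable M (\<lambda>x. X x powr p)"
    "(LINT x|M. norm (weak_gradient \<Omega> u x) powr (p - 2) * (weak_gradient \<Omega> u x \<bullet> weak_gradient \<Omega> (picone_test T \<delta> \<psi> u) x))
      \<le> s powr (1 - p) * (LINT x|M. norm (gradient \<psi> x) powr p) - (p - 1) * (1 - s) * (LINT x|M. X x powr p)"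
proof -
  let ?g = "weak_gradient \<Omega> u"
  let ?\<xi>' = "weak_gradient \<Omega> (picone_test T \<delta> \<psi> u)"
  note wg = W01pD[OF u(1)]
  note W = picone_test_W01p[OF u(1) \<psi> T \<delta>]
  note \<xi>Lp = W01pD(3)[OF W(1)]
  have d: "\<bar>T' t\<bar> \<le> 1" for t using T by (simp add: contraction_def)
  obtain R where R: "R > 0" "\<And>x. \<bar>\<psi> x\<bar> \<le> R" "\<And>x. norm (gradient \<psi> x) \<le> R"
    by (rule test_functions_bounded[OF \<psi>]) (rule that)
  have mT: "(\<lambda>x. T (\<psi> x)) \<in> borel_measurable M"
    by (rule borel_measurable_compose_continuous[OF contraction_continuous[OF T] test_functions_measurable(1)[OF \<psi>]])
  have mX: "X \<in> borel_measurable M"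
    unfolding X_def using mT LpD(1)[OF wg(1)] LpD(1)[OF wg(3)] by measurable
  have XLp: "X \<in> Lp p \<Omega>"
  proof (rule Lp_bound[OF wg(3) mX, of "R / \<delta>"], rule AE_I2)
    fix x assume "x \<in> space M"
    then have ux: "u x \<ge> 0" using u(2) by simp
    have "\<bar>T (\<psi> x)\<bar> \<le> R" using contraction_abs_le[OF T, of "\<psi> x"] R(2)[of x] by linarith
    then have "\<bar>T (\<psi> x)\<bar> / (u x + \<delta>) \<le> R / \<delta>" using ux \<delta> R(1) by (intro frac_le) auto
    from mult_right_mono[OF this, of "norm (?g x)"] show "norm (X x) \<le> R / \<delta> * norm (?g x)"
      using ux \<delta> by (simp add: X_def abs_mult)
  qed
  have X0: "X x \<ge> 0" if "x \<in> \<Omega>" for x using u(2)[OF that] \<delta> by (simp add: X_def)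
  show iX: "integrable M (\<lambda>x. X x powr p)"
  proof -
    have "integrable M (\<lambda>x. norm (X x) powr p) \<longleftrightarrow> integrable M (\<lambda>x. X x powr p)"
      by (rule Bochner_Integration.integrable_cong) (auto simp: X0)
    then show ?thesis using LpD(2)[OF XLp] by simp
  qed
  have iD: "integrable M (\<lambda>x. norm (gradient \<psi> x) powr p)" by (rule LpD(2)[OF test_function_Lp(2)[OF \<psi>]])
  have "(LINT x|M. norm (?g x) powr (p - 2) * (?g x \<bullet> ?\<xi>' x)) \<le>
     (LINT x|M. s powr (1 - p) * norm (gradient \<psi> x) powr p - (p - 1) * (1 - s) * X x powr p)"
  proof (rule integral_mono_AE)
    show "integrable M (\<lambda>x. norm (?g x) powr (p - 2) * (?g x \<bullet> ?\<xi>' x))"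
    proof (rule Bochner_Integration.integrable_bound)
      show "integrable M (\<lambda>x. norm (?g x) powr p + norm (?\<xi>' x) powr p)"
        using LpD(2)[OF wg(3)] LpD(2)[OF \<xi>Lp] by simp
      show "(\<lambda>x. norm (?g x) powr (p - 2) * (?g x \<bullet> ?\<xi>' x)) \<in> borel_measurable M"
        using LpD(1)[OF wg(3)] LpD(1)[OF \<xi>Lp] by measurable
      show "AE x in M. norm (norm (?g x) powr (p - 2) * (?g x \<bullet> ?\<xi>' x)) \<le> norm (norm (?g x) powr p + norm (?\<xi>' x) powr p)"
      proof (rule AE_I2)
        fix x
        define \<mu> where "\<mu> = max (norm (?g x)) (norm (?\<xi>' x))"
        have "norm (?g x) powr (p - 2) * \<bar>?g x \<bullet> ?\<xi>' x\<bar> \<le> \<mu> powr p"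
        proof (cases "?g x = 0")
          case False
          have "norm (?g x) powr (p - 2) * \<bar>?g x \<bullet> ?\<xi>' x\<bar> \<le> norm (?g x) powr (p - 2) * (norm (?g x) * norm (?\<xi>' x))"
            by (intro mult_left_mono Cauchy_Schwarz_ineq2) auto
          also have "\<dots> = (norm (?g x) powr (p - 2) * norm (?g x) powr 1) * norm (?\<xi>' x)" using False by simp
          also have "norm (?g x) powr (p - 2) * norm (?g x) powr 1 = norm (?g x) powr (p - 1)"
            using powr_add[of "norm (?g x)" "p - 2" 1] by simp
          also have "norm (?g x) powr (p - 1) * norm (?\<xi>' x) \<le> \<mu> powr (p - 1) * \<mu> powr 1"
            using p_gt_1 False by (intro mult_mono powr_mono2) (auto simp: \<mu>_def)
          also have "\<dots> = \<mu> powr p" using powr_add[of \<mu> "p - 1" 1] by simp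
          finally show ?thesis .
        qed simp
        also have "\<mu> powr p \<le> norm (?g x) powr p + norm (?\<xi>' x) powr p" by (simp add: \<mu>_def max_def)
        finally show "norm (norm (?g x) powr (p - 2) * (?g x \<bullet> ?\<xi>' x)) \<le> norm (norm (?g x) powr p + norm (?\<xi>' x) powr p)"
          by (simp add: abs_mult)
      qed
    qed
    show "integrable M (\<lambda>x. s powr (1 - p) * norm (gradient \<psi> x) powr p - (p - 1) * (1 - s) * X x powr p)"
      using iD iX by simp
    show "AE x in M. norm (?g x) powr (p - 2) * (?g x \<bullet> ?\<xi>' x) \<le>
        s powr (1 - p) * norm (gradient \<psi> x) powr p - (p - 1) * (1 - s) * X x powr p"
      using W(3) AE_space
    proof eventually_elim
      case (elim x)
      then have ux: "u x \<ge> 0" "u x + \<delta> > 0" using u(2)[of x] \<delta> by auto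
      show ?case
        using picone_pointwise[OF ux(2) s d[of "\<psi> x"], of "?g x" "T (\<psi> x)" "gradient \<psi> x"] ux(1)
        unfolding elim(1) by (simp add: X_def damp'_def damp_nonneg_eq)
    qed
  qed
  also have "\<dots> = s powr (1 - p) * (LINT x|M. norm (gradient \<psi> x) powr p) - (p - 1) * (1 - s) * (LINT x|M. X x powr p)"
    using iD iX by simp
  finally show "(LINT x|M. norm (?g x) powr (p - 2) * (?g x \<bullet> ?\<xi>' x)) \<le>
      s powr (1 - p) * (LINT x|M. norm (gradient \<psi> x) powr p) - (p - 1) * (1 - s) * (LINT x|M. X x powr p)" .
qed

end

section \<open>Supersolutions\<close>

text \<open>Only test functions supported in \<open>S\<close> are used; this makes it possible to treat a source
  term of the wrong sign as absent, by staying away from its support.\<close>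

definition supersolution ::
  "'a::euclidean_space set \<Rightarrow> real \<Rightarrow> 'a set \<Rightarrow> real \<Rightarrow> ('a \<Rightarrow> real) \<Rightarrow> ('a \<Rightarrow> real) \<Rightarrow> bool" where
  "supersolution \<Omega> p S lam m u \<longleftrightarrow> u \<in> W01p p \<Omega> \<and> (\<forall>x\<in>\<Omega>. u x \<ge> 0) \<and>
    (\<forall>\<xi>\<in>W01p p \<Omega>. (\<forall>x\<in>\<Omega>. \<xi> x \<ge> 0) \<longrightarrow> (\<forall>x\<in>\<Omega> - S. \<xi> x = 0) \<longrightarrow>
      lam * (LINT x|lebesgue_on \<Omega>. m x * \<bar>u x\<bar> powr (p - 2) * u x * \<xi> x) \<le>
      (LINT x|lebesgue_on \<Omega>. norm (weak_gradient \<Omega> u x) powr (p - 2) * (weak_gradient \<Omega> u x \<bullet> weak_gradient \<Omega> \<xi> x)))"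

context sobolev_setting
begin

text \<open>Since \<open>u\<^sup>p\<^sup>-\<^sup>1 (u + \<delta>)\<^sup>1\<^sup>-\<^sup>p\<close> lies between \<open>0\<close> and \<open>1\<close>, the weight \<open>m\<close> is only multiplied by a bounded
  function.\<close>

lemma supersolution_picone:
  assumes u: "supersolution \<Omega> p S lam m u" and \<psi>: "\<psi> \<in> test_functions \<Omega>"
    and S: "\<And>x. x \<in> \<Omega> \<Longrightarrow> \<psi> x \<noteq> 0 \<Longrightarrow> x \<in> S"
    and T: "contraction T T'" and \<delta>: "\<delta> > 0" and s: "s > 0"
  shows "lam * (LINT x|M. m x * \<bar>T (\<psi> x)\<bar> powr p * (u x / (u x + \<delta>)) powr (p - 1)) +
      (p - 1) * (1 - s) * (LINT x|M. (\<bar>T (\<psi> x)\<bar> * norm (weak_gradient \<Omega> u x) / (u x + \<delta>)) powr p)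
      \<le> s powr (1 - p) * (LINT x|M. norm (gradient \<psi> x) powr p)"
proof -
  have W: "u \<in> W01p p \<Omega>" and u0: "\<And>x. x \<in> \<Omega> \<Longrightarrow> u x \<ge> 0" using u by (auto simp: supersolution_def)
  have "T 0 = 0" using T by (simp add: contraction_def)
  moreover have "\<psi> x = 0" if "x \<in> \<Omega> - S" for x using S that by blast
  ultimately have "\<forall>x\<in>\<Omega> - S. picone_test T \<delta> \<psi> u x = 0"
    by (simp add: picone_test_def)
  moreover have "\<forall>x\<in>\<Omega>. picone_test T \<delta> \<psi> u x \<ge> 0"
    using u0 by (auto simp: picone_test_def damp_nonneg_eq)
  ultimately have "lam * (LINT x|M. m x * \<bar>u x\<bar> powr (p - 2) * u x * picone_test T \<delta> \<psi> u x) \<le>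
      (LINT x|M. norm (weak_gradient \<Omega> u x) powr (p - 2) * (weak_gradient \<Omega> u x \<bullet> weak_gradient \<Omega> (picone_test T \<delta> \<psi> u) x))"
    using u picone_test_W01p(1)[OF W \<psi> T \<delta>] unfolding supersolution_def by blast
  moreover have "(LINT x|M. m x * \<bar>u x\<bar> powr (p - 2) * u x * picone_test T \<delta> \<psi> u x) =
      (LINT x|M. m x * \<bar>T (\<psi> x)\<bar> powr p * (u x / (u x + \<delta>)) powr (p - 1))"
  proof (rule Bochner_Integration.integral_cong[OF refl])
    fix x assume "x \<in> space M"
    then have ux: "u x \<ge> 0" using u0 by simp
    show "m x * \<bar>u x\<bar> powr (p - 2) * u x * picone_test T \<delta> \<psi> u x =
        m x * \<bar>T (\<psi> x)\<bar> powr p * (u x / (u x + \<delta>)) powr (p - 1)"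
    proof (cases "u x = 0")
      case True
      then show ?thesis using p_gt_1 by simp
    next
      case False
      then have "\<bar>u x\<bar> powr (p - 2) * u x = u x powr (p - 1)"
        using ux powr_add[of "u x" "p - 2" 1] by simp
      moreover have "u x powr (p - 1) * damp p \<delta> (u x) = (u x / (u x + \<delta>)) powr (p - 1)"
        using ux \<delta> powr_minus_divide[of "u x + \<delta>" "p - 1"] by (simp add: damp_nonneg_eq powr_divide)
      ultimately show ?thesis by (simp add: picone_test_def mult.assoc)
    qed
  qed
  ultimately have "lam * (LINT x|M. m x * \<bar>T (\<psi> x)\<bar> powr p * (u x / (u x + \<delta>)) powr (p - 1)) \<le>
      (LINT x|M. norm (weak_gradient \<Omega> u x) powr (p - 2) * (weak_gradient \<Omega> u x \<bullet> weak_gradient \<Omega> (picone_test T \<delta> \<psi> u) x))"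
    by simp
  then show ?thesis
    using picone_inequality(2)[OF W u0 \<psi> T \<delta> s] by linarith
qed

lemma test_function_cut_bound:
  assumes \<psi>: "\<psi> \<in> test_functions \<Omega>" and T: "contraction T T'"
  shows "\<exists>B. \<forall>x. \<bar>T (\<psi> x)\<bar> powr p \<le> B" "(\<lambda>x. \<bar>T (\<psi> x)\<bar> powr p) \<in> borel_measurable M"
proof -
  obtain R where R: "R > 0" "\<And>x. \<bar>\<psi> x\<bar> \<le> R" "\<And>x. norm (gradient \<psi> x) \<le> R"
    by (rule test_functions_bounded[OF \<psi>]) (rule that)
  have "\<bar>T (\<psi> x)\<bar> powr p \<le> R powr p" for x
    using contraction_abs_le[OF T, of "\<psi> x"] R(2)[of x] p_pos by (intro powr_mono2) auto
  then show "\<exists>B. \<forall>x. \<bar>T (\<psi> x)\<bar> powr p \<le> B" by blast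
  have "(\<lambda>x. T (\<psi> x)) \<in> borel_measurable M"
    by (rule borel_measurable_compose_continuous[OF contraction_continuous[OF T] test_functions_measurable(1)[OF \<psi>]])
  then show "(\<lambda>x. \<bar>T (\<psi> x)\<bar> powr p) \<in> borel_measurable M" by measurable
qed

text \<open>As \<open>\<delta>\<close> tends to \<open>0\<close>, the factor \<open>(u / (u + \<delta>))\<^sup>p\<^sup>-\<^sup>1\<close> tends to \<open>1\<close> exactly where \<open>u\<close> is
  positive; this is where positivity almost everywhere enters.\<close>

lemma supersolution_eigenvalue_bound:
  assumes u: "supersolution \<Omega> p S lam m u" and pos: "AE x in M. u x > 0"
    and \<psi>: "\<psi> \<in> test_functions \<Omega>" and S: "\<And>x. x \<in> \<Omega> \<Longrightarrow> \<psi> x \<noteq> 0 \<Longrightarrow> x \<in> S"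
    and T: "contraction T T'" and m: "integrable M m"
  shows "lam * (LINT x|M. m x * \<bar>T (\<psi> x)\<bar> powr p) \<le> (LINT x|M. norm (gradient \<psi> x) powr p)"
proof -
  have W: "u \<in> W01p p \<Omega>" and u0: "\<And>x. x \<in> \<Omega> \<Longrightarrow> u x \<ge> 0" using u by (auto simp: supersolution_def)
  have mu: "u \<in> borel_measurable M" by (rule LpD(1)[OF W01pD(1)[OF W]])
  obtain B where B: "\<And>x. \<bar>T (\<psi> x)\<bar> powr p \<le> B" using test_function_cut_bound(1)[OF \<psi> T] by blast
  note mT = test_function_cut_bound(2)[OF \<psi> T]
  have iT: "integrable M (\<lambda>x. m x * \<bar>T (\<psi> x)\<bar> powr p)"
    by (rule integrable_mult_bounded[OF m mT, of B]) (simp add: B)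
  define \<delta> where "\<delta> n = 1 / real (Suc n)" for n
  have \<delta>: "\<delta> n > 0" for n by (simp add: \<delta>_def)
  have \<delta>0: "\<delta> \<longlonglongrightarrow> 0" unfolding \<delta>_def using LIMSEQ_inverse_real_of_nat by (simp add: inverse_eq_divide)
  define h where "h n x = m x * \<bar>T (\<psi> x)\<bar> powr p * (u x / (u x + \<delta> n)) powr (p - 1)" for n x
  have lim: "(\<lambda>n. LINT x|M. h n x) \<longlonglongrightarrow> (LINT x|M. m x * \<bar>T (\<psi> x)\<bar> powr p)"
  proof (rule integral_dominated_convergence[where w="\<lambda>x. \<bar>m x * \<bar>T (\<psi> x)\<bar> powr p\<bar>"])
    show "(\<lambda>x. m x * \<bar>T (\<psi> x)\<bar> powr p) \<in> borel_measurable M" using iT by simp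
    then show "h n \<in> borel_measurable M" for n unfolding h_def using mu by measurable
    show "integrable M (\<lambda>x. \<bar>m x * \<bar>T (\<psi> x)\<bar> powr p\<bar>)" using iT by simp
    show "AE x in M. (\<lambda>n. h n x) \<longlonglongrightarrow> m x * \<bar>T (\<psi> x)\<bar> powr p"
      using pos
    proof eventually_elim
      case (elim x)
      have "(\<lambda>n. (u x / (u x + \<delta> n)) powr (p - 1)) \<longlonglongrightarrow> (u x / (u x + 0)) powr (p - 1)"
        using elim by (intro tendsto_powr tendsto_divide tendsto_add tendsto_const \<delta>0) auto
      then have "(\<lambda>n. m x * \<bar>T (\<psi> x)\<bar> powr p * (u x / (u x + \<delta> n)) powr (p - 1)) \<longlonglongrightarrow> m x * \<bar>T (\<psi> x)\<bar> powr p * 1"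
        using elim by (intro tendsto_mult_left) simp
      then show ?case by (simp add: h_def)
    qed
    show "AE x in M. norm (h n x) \<le> \<bar>m x * \<bar>T (\<psi> x)\<bar> powr p\<bar>" for n
    proof (rule AE_I2)
      fix x assume "x \<in> space M"
      then have "u x \<ge> 0" using u0 by simp
      then have "(u x / (u x + \<delta> n)) powr (p - 1) \<le> 1 powr (p - 1)"
        using \<delta>[of n] p_gt_1 by (intro powr_mono2) auto
      then have "\<bar>m x * \<bar>T (\<psi> x)\<bar> powr p\<bar> * (u x / (u x + \<delta> n)) powr (p - 1) \<le> \<bar>m x * \<bar>T (\<psi> x)\<bar> powr p\<bar> * 1"
        by (intro mult_left_mono) auto
      then show "norm (h n x) \<le> \<bar>m x * \<bar>T (\<psi> x)\<bar> powr p\<bar>"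
        by (simp add: h_def abs_mult)
    qed
  qed
  have "lam * (LINT x|M. h n x) \<le> (LINT x|M. norm (gradient \<psi> x) powr p)" for n
    using supersolution_picone[OF u \<psi> S T \<delta>[of n], of 1] by (simp add: h_def)
  then show ?thesis
    using LIMSEQ_le_const2[OF tendsto_mult_left[OF lim, of lam]] by blast
qed

text \<open>The choice \<open>s = 1 / 2\<close> leaves half of the energy of \<open>ln (u + \<delta>)\<close> on the left-hand side, and all
  other terms are bounded independently of \<open>\<delta>\<close>.\<close>

lemma supersolution_log_energy:
  assumes u: "supersolution \<Omega> p UNIV lam m u" and lam: "lam \<ge> 0" and \<psi>: "\<psi> \<in> test_functions \<Omega>"
    and m: "integrable M m"
  shows "\<exists>C. \<forall>\<delta>>0. (LINT x|M. (\<bar>\<psi> x\<bar> * norm (weak_gradient \<Omega> u x) / (u x + \<delta>)) powr p) \<le> C"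
proof -
  have u0: "\<And>x. x \<in> \<Omega> \<Longrightarrow> u x \<ge> 0" using u by (auto simp: supersolution_def)
  have T: "contraction (\<lambda>t. t) (\<lambda>t. 1)" by (auto simp: contraction_def)
  obtain B where B: "\<And>x. \<bar>\<psi> x\<bar> powr p \<le> B" using test_function_cut_bound(1)[OF \<psi> T] by blast
  note mT = test_function_cut_bound(2)[OF \<psi> T]
  have iT: "integrable M (\<lambda>x. m x * \<bar>\<psi> x\<bar> powr p)"
    by (rule integrable_mult_bounded[OF m mT, of B]) (simp add: B)
  define D where "D = (1 / 2) powr (1 - p) * (LINT x|M. norm (gradient \<psi> x) powr p)"
  define I where "I = (LINT x|M. \<bar>m x * \<bar>\<psi> x\<bar> powr p\<bar>)"
  have "(LINT x|M. (\<bar>\<psi> x\<bar> * norm (weak_gradient \<Omega> u x) / (u x + \<delta>)) powr p) \<le> 2 / (p - 1) * (D + lam * I)"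
    if \<delta>: "\<delta> > 0" for \<delta>
  proof -
    define J where "J = (LINT x|M. m x * \<bar>\<psi> x\<bar> powr p * (u x / (u x + \<delta>)) powr (p - 1))"
    have "\<bar>J\<bar> \<le> (LINT x|M. \<bar>m x * \<bar>\<psi> x\<bar> powr p * (u x / (u x + \<delta>)) powr (p - 1)\<bar>)"
      unfolding J_def by (rule integral_abs_bound)
    also have "\<dots> \<le> I" unfolding I_def
    proof (rule integral_mono')
      fix x assume "x \<in> space M"
      then have "u x \<ge> 0" using u0 by simp
      then have "(u x / (u x + \<delta>)) powr (p - 1) \<le> 1 powr (p - 1)"
        using \<delta> p_gt_1 by (intro powr_mono2) auto
      then have "\<bar>m x * \<bar>\<psi> x\<bar> powr p\<bar> * (u x / (u x + \<delta>)) powr (p - 1) \<le> \<bar>m x * \<bar>\<psi> x\<bar> powr p\<bar> * 1"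
        by (intro mult_left_mono) auto
      then show "\<bar>m x * \<bar>\<psi> x\<bar> powr p * (u x / (u x + \<delta>)) powr (p - 1)\<bar> \<le> \<bar>m x * \<bar>\<psi> x\<bar> powr p\<bar>"
        by (simp add: abs_mult)
    qed (use iT in auto)
    finally have "- (lam * I) \<le> lam * J"
      using mult_left_mono[of "-I" J lam] lam by (simp add: abs_le_iff)
    moreover have "lam * J + (p - 1) * (1 - 1 / 2) * (LINT x|M. (\<bar>\<psi> x\<bar> * norm (weak_gradient \<Omega> u x) / (u x + \<delta>)) powr p) \<le> D"
      using supersolution_picone[OF u \<psi> _ T \<delta>, of "1/2"] by (simp add: J_def D_def)
    ultimately show ?thesis
      using p_gt_1 by (simp add: field_simps)
  qed
  then show ?thesis by blast
qed

end

section \<open>The strong maximum principle\<close>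

lemma ln_extension_has_derivative:
  assumes "\<delta> > 0"
  shows "(odd_extension (\<lambda>t. ln (1 + t / \<delta>)) has_real_derivative 1 / (\<bar>t\<bar> + \<delta>)) (at t)"
proof (rule odd_extension_has_derivative[of "\<lambda>t. ln (1 + t / \<delta>)" "\<lambda>t. 1 / (t + \<delta>)"])
  fix t :: real assume "t \<ge> 0"
  moreover have "1 + t / \<delta> > 0" using assms \<open>t \<ge> 0\<close> by (simp add: add_pos_nonneg)
  ultimately show "((\<lambda>t. ln (1 + t / \<delta>)) has_real_derivative 1 / (t + \<delta>)) (at t)"
    using assms by (auto intro!: derivative_eq_intros simp: field_simps)
qed

text \<open>Both logarithms are asymptotic to \<open>ln (1 / \<delta>)\<close>, so dividing by it and letting \<open>\<delta>\<close> tend to \<open>0\<close>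
  gives \<open>I \<le> I'\<close>.\<close>

lemma log_comparison:
  assumes "c > 0" "Mx > 0" "I' \<le> I" "I' \<ge> 0"
    and le: "\<And>\<delta>. \<delta> > 0 \<Longrightarrow> ln (1 + c / \<delta>) * I \<le> ln (1 + Mx / \<delta>) * I' + C"
  shows "I = (I'::real)"
proof (rule ccontr)
  assume "I \<noteq> I'"
  with assms have d: "I - I' > 0" by simp
  define E where "E = ln (1 + Mx / c) * I' + C"
  define k where "k = (\<bar>E\<bar> + 1) / (I - I')"
  have k: "k > 0" using d by (simp add: k_def)
  \<comment> \<open>Chosen so that \<open>ln (1 + c / \<delta>) = k\<close>.\<close>
  define \<delta> where "\<delta> = c / (exp k - 1)"
  have \<delta>: "\<delta> > 0" using k assms by (simp add: \<delta>_def)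
  have "1 + c / \<delta> = exp k" using assms k by (simp add: \<delta>_def)
  then have lk: "ln (1 + c / \<delta>) = k" by simp
  have "1 + Mx / \<delta> \<le> (1 + c / \<delta>) * (1 + Mx / c)"
    using assms \<delta> by (simp add: algebra_simps)
  moreover have p1: "0 < 1 + Mx / \<delta>" "0 < 1 + c / \<delta>" "0 < 1 + Mx / c"
    using assms \<delta> by (auto intro!: add_pos_pos divide_pos_pos)
  ultimately have "ln (1 + Mx / \<delta>) \<le> ln ((1 + c / \<delta>) * (1 + Mx / c))" by simp
  also have "\<dots> = k + ln (1 + Mx / c)" using p1 lk by (simp add: ln_mult)
  finally have "ln (1 + Mx / \<delta>) * I' \<le> (k + ln (1 + Mx / c)) * I'" using assms by (intro mult_right_mono)
  with le[OF \<delta>] have "k * (I - I') \<le> E" by (simp add: lk E_def algebra_simps)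
  moreover have "k * (I - I') = \<bar>E\<bar> + 1" using d by (simp add: k_def)
  ultimately show False by linarith
qed

context bounded_open_set
begin

lemma weak_gradient_direction:
  assumes "is_weak_gradient \<Omega> u g" "integrable M u" "integrable M g" "\<phi> \<in> test_functions \<Omega>"
  shows "(LINT x|M. u x * (gradient \<phi> x \<bullet> h)) = - (LINT x|M. (g x \<bullet> h) * \<phi> x)"
proof -
  note \<phi>C = test_functions_C1[OF assms(4)]
  obtain B where B: "B > 0" "\<And>x. \<bar>\<phi> x\<bar> \<le> B" "\<And>x. norm (gradient \<phi> x) \<le> B"
    by (rule test_functions_bounded[OF assms(4)]) (rule that)
  have i1: "integrable M (\<lambda>x. u x * (gradient \<phi> x \<bullet> b))" if b: "b \<in> Basis" for b
  proof (rule integrable_mult_bounded[OF assms(2), where B=B])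
    show "(\<lambda>x. gradient \<phi> x \<bullet> b) \<in> borel_measurable M" using test_functions_measurable(2)[OF assms(4)] by measurable
    show "AE x in M. \<bar>gradient \<phi> x \<bullet> b\<bar> \<le> B"
      using order_trans[OF Basis_le_norm[OF b] B(3)] by (intro AE_I2)
  qed
  have i2: "integrable M (\<lambda>x. (g x \<bullet> b) * \<phi> x)" for b
    by (rule integrable_mult_bounded[OF _ test_functions_measurable(1)[OF assms(4)], where B=B])
      (use assms(3) B(2) in auto)
  have expand: "y \<bullet> h = (\<Sum>b\<in>Basis. (h \<bullet> b) * (y \<bullet> b))" for y
    by (subst euclidean_inner) (simp add: mult.commute)
  have "(LINT x|M. u x * (gradient \<phi> x \<bullet> h)) = (LINT x|M. (\<Sum>b\<in>Basis. (h \<bullet> b) * (u x * (gradient \<phi> x \<bullet> b))))"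
    by (simp add: expand sum_distrib_left mult.left_commute)
  also have "\<dots> = (\<Sum>b\<in>Basis. (h \<bullet> b) * (LINT x|M. u x * (gradient \<phi> x \<bullet> b)))"
    using i1 by (subst Bochner_Integration.integral_sum) auto
  also have "\<dots> = (\<Sum>b\<in>Basis. (h \<bullet> b) * - (LINT x|M. (g x \<bullet> b) * \<phi> x))"
    using assms(1,4) by (intro sum.cong) (auto simp: is_weak_gradient_def C1_frechet[OF \<phi>C])
  also have "\<dots> = - (\<Sum>b\<in>Basis. LINT x|M. (h \<bullet> b) * ((g x \<bullet> b) * \<phi> x))"
    by (simp add: sum_negf)
  also have "(\<Sum>b\<in>Basis. LINT x|M. (h \<bullet> b) * ((g x \<bullet> b) * \<phi> x)) = (LINT x|M. (\<Sum>b\<in>Basis. (h \<bullet> b) * ((g x \<bullet> b) * \<phi> x)))"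
    using i2 by (subst Bochner_Integration.integral_sum) auto
  also have "\<dots> = (LINT x|M. (g x \<bullet> h) * \<phi> x)"
    by (simp add: expand sum_distrib_right mult.assoc)
  finally show ?thesis .
qed

lemma open_not_AE_avoided:
  assumes "open U" "U \<subseteq> \<Omega>" "U \<noteq> {}"
  shows "\<not> (AE x in M. x \<notin> U)"
proof
  assume "AE x in M. x \<notin> U"
  then have "AE x in lebesgue. x \<notin> U"
    using assms(2) by (auto simp: AE_restrict_space_iff elim!: eventually_mono)
  then have "U \<in> null_sets lebesgue" using assms(1) by (simp add: AE_iff_null_sets)
  then show False using assms(1,3) open_not_negligible[of U] by (simp add: negligible_iff_null_sets)
qed

lemma bump_translate: "bump c r (x - h) = bump (c + h) r x"
  by (simp add: bump_def dist_norm algebra_simps)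

text \<open>Moving a bump function along a segment changes its integral against \<open>v\<close> by at most the
  integral of the weak gradient over the region swept out.\<close>

lemma bump_transport:
  assumes v: "is_weak_gradient \<Omega> v g" "integrable M v" "integrable M g"
    and r: "r > 0" and sub: "\<And>t. t \<in> {0..1} \<Longrightarrow> cball (z + t *\<^sub>R h) r \<subseteq> K" and K: "K \<subseteq> \<Omega>" "K \<in> sets lebesgue"
  shows "\<bar>(LINT x|M. v x * bump (z + h) r x) - (LINT x|M. v x * bump z r x)\<bar>
    \<le> norm h * (LINT x|M. norm (g x) * indicator K x)"
proof -
  define \<beta> where "\<beta> t x = bump z r (x - t *\<^sub>R h)" for t x
  have \<beta>b: "\<beta> t = bump (z + t *\<^sub>R h) r" for t by (simp add: \<beta>_def bump_translate fun_eq_iff)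
  define J where "J t = (LINT x|M. v x * \<beta> t x)" for t
  have C: "C1_gradient (bump z r) (gradient (bump z r))" by (rule smooth_C1[OF smooth_bump])
  have \<beta>C: "C1_gradient (\<beta> t) (\<lambda>x. gradient (bump z r) (x - t *\<^sub>R h))" for t
  proof -
    have "(\<beta> t has_derivative (\<lambda>v. gradient (bump z r) (x - t *\<^sub>R h) \<bullet> v)) (at x)" for x
    proof -
      have "((\<lambda>x. x - t *\<^sub>R h) has_derivative (\<lambda>v. v)) (at x)" by (auto intro!: derivative_eq_intros)
      from has_derivative_compose[OF this C1_has_derivative[OF C]] show ?thesis by (simp add: \<beta>_def[abs_def])
    qed
    moreover have "continuous_on UNIV (\<lambda>x. gradient (bump z r) (x - t *\<^sub>R h))"
      by (rule continuous_on_compose2[OF C1_continuous_gradient[OF C]]) (auto intro: continuous_intros)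
    ultimately show ?thesis by (simp add: C1_gradient_def)
  qed
  have "bump z r \<in> test_functions UNIV" by (rule bump_in_test_functions[OF r]) simp
  then obtain B where B: "B > 0" "\<And>x. \<bar>bump z r x\<bar> \<le> B" "\<And>x. norm (gradient (bump z r) x) \<le> B"
    by (rule test_functions_bounded) (rule that)
  have \<beta>m: "\<beta> t \<in> borel_measurable M" for t by (rule continuous_borel(3)[OF C1_continuous[OF \<beta>C]])
  have iJ: "integrable M (\<lambda>x. v x * \<beta> t x)" for t
    by (rule integrable_mult_bounded[OF v(2) \<beta>m, where B=1]) (auto simp: \<beta>b bump_le_1 bump_nonneg)
  define d where "d t x = - (gradient (bump z r) (x - t *\<^sub>R h) \<bullet> h)" for t x
  have \<beta>_der: "((\<lambda>t. \<beta> t x) has_real_derivative d t x) (at t)" for t x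
  proof -
    have "((\<lambda>t. x - t *\<^sub>R h) has_derivative (\<lambda>s. - (s *\<^sub>R h))) (at t)"
      by (auto intro!: derivative_eq_intros)
    from has_derivative_compose[OF this C1_has_derivative[OF C]]
    have "((\<lambda>t. \<beta> t x) has_derivative (\<lambda>s. s * d t x)) (at t)"
      by (simp add: \<beta>_def[abs_def] d_def)
    then show ?thesis by (simp add: has_field_derivative_def mult.commute[of _ "d t x"])
  qed
  have d_bd: "\<bar>d t x\<bar> \<le> B * norm h" for t x
    using Cauchy_Schwarz_ineq2[of "gradient (bump z r) (x - t *\<^sub>R h)" h] mult_right_mono[OF B(3), of "norm h"]
    by (simp add: d_def) (meson order_trans norm_ge_zero)
  have d_m: "d t \<in> borel_measurable M" for t
    unfolding d_def[abs_def] using C1_continuous_gradient[OF \<beta>C[of t]]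
    by (intro continuous_borel continuous_on_minus continuous_on_inner continuous_on_const)
  have J_der: "(J has_real_derivative (LINT x|M. v x * d t x)) (at t)" for t
    unfolding has_field_derivative_iff tendsto_at_iff_sequentially
  proof (intro allI impI)
    fix X :: "nat \<Rightarrow> real"
    assume X: "\<forall>i. X i \<in> UNIV - {t}" "X \<longlonglongrightarrow> t"
    define q where "q n x = v x * ((\<beta> (X n) x - \<beta> t x) / (X n - t))" for n x
    have "(\<lambda>n. LINT x|M. q n x) \<longlonglongrightarrow> (LINT x|M. v x * d t x)"
    proof (rule integral_dominated_convergence[where w="\<lambda>x. (B * norm h) * \<bar>v x\<bar>"])
      show "(\<lambda>x. v x * d t x) \<in> borel_measurable M" using v(2) d_m[of t] by measurable
      show "q n \<in> borel_measurable M" for n unfolding q_def using v(2) \<beta>m[of "X n"] \<beta>m[of t] by measurable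
      show "integrable M (\<lambda>x. (B * norm h) * \<bar>v x\<bar>)" using v(2) by simp
      show "AE x in M. (\<lambda>n. q n x) \<longlonglongrightarrow> v x * d t x"
      proof (intro AE_I2)
        fix x
        have "(\<lambda>n. (\<beta> (X n) x - \<beta> t x) / (X n - t)) \<longlonglongrightarrow> d t x"
          using \<beta>_der[where t=t and x=x] X unfolding has_field_derivative_iff tendsto_at_iff_sequentially
          by (auto simp: o_def)
        then show "(\<lambda>n. q n x) \<longlonglongrightarrow> v x * d t x" unfolding q_def by (rule tendsto_mult_left)
      qed
      show "AE x in M. norm (q n x) \<le> (B * norm h) * \<bar>v x\<bar>" for n
      proof (intro AE_I2)
        fix x
        have "norm (\<beta> (X n) x - \<beta> t x) \<le> (B * norm h) * norm (X n - t)"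
          by (rule field_differentiable_bound[of UNIV "\<lambda>t. \<beta> t x" "\<lambda>t. d t x"]) (auto simp: \<beta>_der d_bd)
        moreover have "X n - t \<noteq> 0" using X by auto
        ultimately have "\<bar>(\<beta> (X n) x - \<beta> t x) / (X n - t)\<bar> \<le> B * norm h"
          by (simp add: abs_divide pos_divide_le_eq)
        from mult_left_mono[OF this, of "\<bar>v x\<bar>"] show "norm (q n x) \<le> (B * norm h) * \<bar>v x\<bar>"
          by (simp add: q_def abs_mult mult.commute)
      qed
    qed
    moreover have "(LINT x|M. q n x) = (J (X n) - J t) / (X n - t)" for n
    proof -
      have "(LINT x|M. q n x) = (LINT x|M. (v x * \<beta> (X n) x - v x * \<beta> t x) / (X n - t))"
        by (simp add: q_def right_diff_distrib)
      then show ?thesis using iJ by (simp add: J_def)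
    qed
    ultimately show "((\<lambda>y. (J y - J t) / (y - t)) \<circ> X) \<longlonglongrightarrow> (LINT x|M. v x * d t x)"
      by (simp add: o_def)
  qed
  have J'_bd: "norm (LINT x|M. v x * d t x) \<le> norm h * (LINT x|M. norm (g x) * indicator K x)" if t: "t \<in> {0..1}" for t
  proof -
    have tst: "\<beta> t \<in> test_functions \<Omega>"
      unfolding \<beta>b using sub[OF t] K(1) by (intro bump_in_test_functions[OF r]) auto
    have "d t x = - (gradient (\<beta> t) x \<bullet> h)" for x
      using gradient_eq[OF \<beta>C[of t]] by (simp add: d_def)
    then have "(LINT x|M. v x * d t x) = (LINT x|M. (g x \<bullet> h) * \<beta> t x)"
      using weak_gradient_direction[OF v tst, of h] by simp
    also have "norm \<dots> \<le> (LINT x|M. norm ((g x \<bullet> h) * \<beta> t x))" by (rule integral_norm_bound)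
    also have "\<dots> \<le> (LINT x|M. norm h * (norm (g x) * indicator K x))"
    proof (rule integral_mono')
      have "integrable M (\<lambda>x. norm (g x) * indicator K x)"
      proof (rule integrable_mult_bounded[where B=1])
        show "integrable M (\<lambda>x. norm (g x))" using v(3) by simp
        show "(indicator K :: 'a \<Rightarrow> real) \<in> borel_measurable M"
          using K by (intro measurable_restrict_space1) auto
      qed auto
      then show "integrable M (\<lambda>x. norm h * (norm (g x) * indicator K x))" by simp
      fix x
      show "norm ((g x \<bullet> h) * \<beta> t x) \<le> norm h * (norm (g x) * indicator K x)"
      proof (cases "x \<in> K")
        case True
        have "\<bar>g x \<bullet> h\<bar> * \<bar>\<beta> t x\<bar> \<le> (norm (g x) * norm h) * 1"
          by (intro mult_mono Cauchy_Schwarz_ineq2) (auto simp: \<beta>b bump_le_1 bump_nonneg)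
        then show ?thesis using True by (simp add: abs_mult mult.commute)
      next
        case False
        then have "x \<notin> ball (z + t *\<^sub>R h) r" using sub[OF t] ball_subset_cball by blast
        then have "\<beta> t x = 0" unfolding \<beta>b using bump_nonzero_iff[OF r] by blast
        then show ?thesis using False by simp
      qed
    qed auto
    finally show ?thesis by simp
  qed
  have "norm (J 1 - J 0) \<le> (norm h * (LINT x|M. norm (g x) * indicator K x)) * norm (1 - 0 :: real)"
    by (rule field_differentiable_bound[of "{0..1}" J "\<lambda>t. LINT x|M. v x * d t x"])
      (use J'_bd in \<open>auto intro: has_field_derivative_at_within[OF J_der]\<close>)
  then show ?thesis by (simp add: J_def \<beta>b)
qed

end

context sobolev_setting
begin

text \<open>Positivity spreads from \<open>y\<close> to \<open>z\<close>: near \<open>y\<close> the function \<open>ln (1 + u / \<delta>)\<close> is of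
  size \<open>ln (1 / \<delta>)\<close>, and by the bound on the logarithmic energy its averages near \<open>y\<close> and \<open>z\<close>
  differ by a bounded amount only; but the zero set of \<open>u\<close> does not contribute to the average
  near \<open>z\<close>.\<close>

lemma supersolution_positivity_spreads:
  assumes u: "supersolution \<Omega> p UNIV lam m u" and lam: "lam \<ge> 0" and m: "integrable M m"
    and cont: "continuous_on \<Omega> u"
    and R: "R > 0" "cball z (3 * R) \<subseteq> \<Omega>" and y: "y \<in> ball z R" "u y > 0"
  shows "\<exists>r>0. AE x in M. x \<in> ball z r \<longrightarrow> u x > 0"
proof -
  have W: "u \<in> W01p p \<Omega>" and u0: "\<And>x. x \<in> \<Omega> \<Longrightarrow> u x \<ge> 0" using u by (auto simp: supersolution_def)
  let ?g = "weak_gradient \<Omega> u"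
  note wg = W01pD[OF W]
  have mu: "u \<in> borel_measurable M" "?g \<in> borel_measurable M" by (rule LpD(1)[OF wg(1)], rule LpD(1)[OF wg(3)])
  define h where "h = y - z"
  have h: "norm h < R" using y(1) by (simp add: h_def dist_norm norm_minus_commute)
  define K where "K = cball z (2 * R)"
  have K: "K \<subseteq> \<Omega>" "compact K" "K \<in> sets lebesgue" using R by (auto simp: K_def)
  have yK: "y \<in> \<Omega>" using y(1) R by auto
  define c where "c = u y / 2"
  have c: "c > 0" using y(2) by (simp add: c_def)
  have "isCont u y" using cont open_\<Omega> yK by (simp add: continuous_on_eq_continuous_at)
  then have "\<forall>\<^sub>F x in at y. dist (u x) (u y) < c" using c unfolding isCont_def by (rule tendstoD)
  then obtain r0 where r0: "r0 > 0" "\<And>x. dist x y < r0 \<Longrightarrow> x \<noteq> y \<Longrightarrow> dist (u x) (u y) < c"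
    unfolding eventually_at by auto
  define r where "r = min R r0"
  have r: "r > 0" "r \<le> R" "r \<le> r0" using R r0 by (auto simp: r_def)
  have uc: "u x \<ge> c" if "x \<in> ball y r" for x
  proof (cases "x = y")
    case False
    have "\<bar>u x - u y\<bar> < u y / 2"
      using r0(2)[OF _ False] that r by (simp add: dist_commute dist_real_def c_def)
    then show ?thesis unfolding c_def by linarith
  qed (use c in \<open>simp add: c_def\<close>)
  have sub: "cball (z + t *\<^sub>R h) r \<subseteq> K" if "t \<in> {0..1}" for t
  proof
    fix x assume "x \<in> cball (z + t *\<^sub>R h) r"
    then have "norm (x - (z + t *\<^sub>R h)) \<le> R" using r by (simp add: dist_norm norm_minus_commute)
    moreover have "norm (t *\<^sub>R h) \<le> R" using that h mult_left_le_one_le[of "norm h" t] by simp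
    ultimately have "norm ((x - (z + t *\<^sub>R h)) + t *\<^sub>R h) \<le> R + R" by (rule norm_triangle_mono)
    then show "x \<in> K" by (simp add: K_def dist_norm norm_minus_commute)
  qed
  \<comment> \<open>Bound for the gradient of the logarithm on the ball \<open>K\<close>.\<close>
  define \<psi> where "\<psi> = bump z (3 * R)"
  have \<psi>: "\<psi> \<in> test_functions \<Omega>" unfolding \<psi>_def using R by (intro bump_in_test_functions) auto
  have "z \<in> K" using R by (simp add: K_def)
  then obtain x0 where x0: "x0 \<in> K" "\<And>x. x \<in> K \<Longrightarrow> \<psi> x0 \<le> \<psi> x"
    using continuous_attains_inf[OF K(2) _ continuous_on_subset[OF smooth_continuous[OF test_functions_smooth[OF \<psi>]] subset_UNIV]] by blast
  define c0 where "c0 = \<psi> x0"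
  have c0: "c0 > 0"
  proof -
    have "x0 \<in> ball z (3 * R)" using x0(1) R by (simp add: K_def)
    then show ?thesis using R by (simp add: c0_def \<psi>_def bump_pos_iff)
  qed
  obtain C where C: "\<And>\<delta>. \<delta> > 0 \<Longrightarrow> (LINT x|M. (\<bar>\<psi> x\<bar> * norm (?g x) / (u x + \<delta>)) powr p) \<le> C"
    using supersolution_log_energy[OF u lam \<psi> m] by blast
  define V where "V = (LINT x|M. (1::real))"
  define C1 where "C1 = norm h * ((V + C) / c0)"
  have T: "contraction (\<lambda>t. t) (\<lambda>t. 1)" by (auto simp: contraction_def)
  have grad: "(LINT x|M. norm ((1 / (\<bar>u x\<bar> + \<delta>)) *\<^sub>R ?g x) * indicator K x) \<le> (V + C) / c0" if \<delta>: "\<delta> > 0" for \<delta>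
  proof -
    let ?X = "\<lambda>x. \<bar>\<psi> x\<bar> * norm (?g x) / (u x + \<delta>)"
    have iX: "integrable M (\<lambda>x. ?X x powr p)" using picone_inequality(1)[OF W u0 \<psi> T \<delta>, of 1] by simp
    have "(LINT x|M. norm ((1 / (\<bar>u x\<bar> + \<delta>)) *\<^sub>R ?g x) * indicator K x) \<le> (LINT x|M. (1 / c0) * (1 + ?X x powr p))"
    proof (rule integral_mono')
      show "integrable M (\<lambda>x. (1 / c0) * (1 + ?X x powr p))"
        using iX integrable_const_M by (intro integrable_mult_right Bochner_Integration.integrable_add)
      fix x assume x: "x \<in> space M"
      then have ux: "u x \<ge> 0" using u0 by simp
      have X0: "?X x \<ge> 0" using ux \<delta> by simp
      show "0 \<le> (1 / c0) * (1 + ?X x powr p)" using c0 by (simp add: add_nonneg_nonneg)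
      show "norm ((1 / (\<bar>u x\<bar> + \<delta>)) *\<^sub>R ?g x) * indicator K x \<le> (1 / c0) * (1 + ?X x powr p)"
      proof (cases "x \<in> K")
        case True
        have "c0 * (norm (?g x) / (u x + \<delta>)) \<le> \<bar>\<psi> x\<bar> * (norm (?g x) / (u x + \<delta>))"
          using x0(2)[OF True] ux \<delta> by (intro mult_right_mono) (auto simp: c0_def)
        also have "\<dots> \<le> 1 + ?X x powr p" using le_powr_add[OF X0, of 1 p] p_pos by simp
        finally have "norm (?g x) / (u x + \<delta>) \<le> (1 / c0) * (1 + ?X x powr p)"
          using c0 by (simp add: field_simps)
        then show ?thesis using True ux \<delta> by simp
      next
        case False
        then show ?thesis using c0 by (simp add: add_nonneg_nonneg)
      qed
    qed
    also have "\<dots> = (1 / c0) * (V + (LINT x|M. ?X x powr p))"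
      unfolding V_def using iX integrable_const_M by simp
    also have "\<dots> \<le> (1 / c0) * (V + C)" using C[OF \<delta>] c0 by (intro mult_left_mono) auto
    finally show ?thesis by simp
  qed
  \<comment> \<open>Comparison of the two averages.\<close>
  have bumpz: "bump z r \<in> test_functions \<Omega>" "bump y r \<in> test_functions \<Omega>"
    using sub[of 0] sub[of 1] K(1) r by (auto simp: h_def intro!: bump_in_test_functions)
  note mb = test_functions_measurable(1)[OF bumpz(1)] test_functions_measurable(1)[OF bumpz(2)]
  have ib: "integrable M (bump z r)" "integrable M (bump y r)"
    by (intro integrable_continuous_M smooth_continuous smooth_bump)+
  define I where "I = (LINT x|M. bump z r x)"
  have balls: "ball z r \<subseteq> \<Omega>" "ball y r \<subseteq> \<Omega>"
  proof -
    have "cball z r \<subseteq> K" "cball y r \<subseteq> K" using sub[of 0] sub[of 1] by (simp_all add: h_def)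
    then show "ball z r \<subseteq> \<Omega>" "ball y r \<subseteq> \<Omega>" using K(1) ball_subset_cball by blast+
  qed
  have I_eq: "(LINT x|M. bump y r x) = I"
  proof -
    have "(LINT x|M. bump y r x) = (LINT x|lebesgue. bump y r x)"
      by (rule integral_M_eq_lebesgue(1)[of "ball y r"]) (use balls bump_nonzero_iff[OF r(1)] in blast)+
    also have "\<dots> = (LINT x|lebesgue. bump y r (x + h))"
      by (rule integral_translate[symmetric]) (rule smooth_continuous[OF smooth_bump])
    also have "\<dots> = (LINT x|lebesgue. bump z r x)"
    proof -
      have "bump y r (x + h) = bump z r x" for x by (simp add: bump_def dist_norm h_def algebra_simps)
      then show ?thesis by simp
    qed
    also have "\<dots> = (LINT x|M. bump z r x)"
      by (rule integral_M_eq_lebesgue(1)[of "ball z r", symmetric]) (use balls bump_nonzero_iff[OF r(1)] in blast)+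
    finally show ?thesis by (simp add: I_def)
  qed
  define P where "P = {x \<in> \<Omega>. u x > 0}"
  have Pm: "(\<lambda>x. bump z r x * indicator P x) \<in> borel_measurable M"
  proof -
    have "(\<lambda>x. if u x > 0 then bump z r x else 0) \<in> borel_measurable M" using mu(1) mb(1) by measurable
    moreover have "(\<lambda>x. if u x > 0 then bump z r x else 0) \<in> borel_measurable M \<longleftrightarrow> (\<lambda>x. bump z r x * indicator P x) \<in> borel_measurable M"
      by (rule measurable_cong) (auto simp: P_def)
    ultimately show ?thesis by simp
  qed
  have iP: "integrable M (\<lambda>x. bump z r x * indicator P x)"
    by (rule integrable_bounded_M[OF Pm, of 1]) (auto simp: bump_le_1 bump_nonneg indicator_def)
  define I' where "I' = (LINT x|M. bump z r x * indicator P x)"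
  have I': "I' \<le> I" "I' \<ge> 0"
    unfolding I'_def I_def using iP ib(1)
    by (auto intro!: integral_mono Bochner_Integration.integral_nonneg simp: bump_nonneg indicator_def)
  have "bounded (u ` K)" by (intro compact_imp_bounded compact_continuous_image K continuous_on_subset[OF cont])
  then obtain Mx where Mx: "Mx > 0" "\<And>x. x \<in> K \<Longrightarrow> norm (u x) \<le> Mx" by (auto simp: bounded_pos)
  have "I = I'"
  proof (rule log_comparison[OF c Mx(1) I'])
    fix \<delta> :: real assume \<delta>: "\<delta> > 0"
    define L where "L = odd_extension (\<lambda>t. ln (1 + t / \<delta>))"
    have L: "L t = ln (1 + t / \<delta>)" if "t \<ge> 0" for t using that by (simp add: L_def odd_extension_def)
    have dL: "(L has_real_derivative 1 / (\<bar>t\<bar> + \<delta>)) (at t)" for t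
      unfolding L_def by (rule ln_extension_has_derivative[OF \<delta>])
    have cL: "continuous_on UNIV (\<lambda>t. 1 / (\<bar>t\<bar> + \<delta>))" using \<delta> by (intro continuous_intros) auto
    have bL: "\<bar>1 / (\<bar>t\<bar> + \<delta>)\<bar> \<le> 1 / \<delta>" for t using \<delta> by (simp add: field_simps)
    note comp = is_weak_gradient_compose[OF W dL cL bL]
    note tr = bump_transport[OF comp(1) Lp_integrable[OF comp(2)] Lp_integrable[OF comp(3)] r(1) sub K(1,3)]
    have zh: "z + h = y" by (simp add: h_def)
    have "norm h * (LINT x|M. norm ((1 / (\<bar>u x\<bar> + \<delta>)) *\<^sub>R ?g x) * indicator K x) \<le> C1"
      unfolding C1_def by (intro mult_left_mono grad[OF \<delta>]) simp
    with tr have t: "(LINT x|M. L (u x) * bump y r x) \<le> (LINT x|M. L (u x) * bump z r x) + C1"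
      unfolding zh by linarith
    have iL: "integrable M (\<lambda>x. L (u x) * bump y r x)" "integrable M (\<lambda>x. L (u x) * bump z r x)"
      by (intro integrable_mult_bounded[OF Lp_integrable[OF comp(2)] mb(2), where B=1]
          integrable_mult_bounded[OF Lp_integrable[OF comp(2)] mb(1), where B=1]; simp add: bump_le_1 bump_nonneg)+
    have "ln (1 + c / \<delta>) * I = (LINT x|M. ln (1 + c / \<delta>) * bump y r x)" by (simp add: I_eq)
    also have "\<dots> \<le> (LINT x|M. L (u x) * bump y r x)"
    proof (rule integral_mono)
      fix x assume x: "x \<in> space M"
      show "ln (1 + c / \<delta>) * bump y r x \<le> L (u x) * bump y r x"
      proof (cases "x \<in> ball y r")
        case True
        have "ln (1 + c / \<delta>) \<le> ln (1 + u x / \<delta>)"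
          using uc[OF True] c \<delta> by (simp add: add_pos_pos divide_right_mono)
        then show ?thesis using uc[OF True] c by (intro mult_right_mono) (auto simp: L bump_nonneg)
      next
        case False
        then have "bump y r x = 0" using bump_nonzero_iff[OF r(1)] by blast
        then show ?thesis by simp
      qed
    qed (use ib iL in auto)
    also note t
    also have "(LINT x|M. L (u x) * bump z r x) \<le> (LINT x|M. ln (1 + Mx / \<delta>) * (bump z r x * indicator P x))"
    proof (rule integral_mono)
      fix x assume x: "x \<in> space M"
      then have ux: "u x \<ge> 0" using u0 by simp
      show "L (u x) * bump z r x \<le> ln (1 + Mx / \<delta>) * (bump z r x * indicator P x)"
      proof (cases "x \<in> ball z r \<and> u x > 0")
        case True
        then have "x \<in> K" using sub[of 0] by auto
        then have "u x \<le> Mx" using Mx(2)[of x] by simp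
        then have "ln (1 + u x / \<delta>) \<le> ln (1 + Mx / \<delta>)"
          using True \<delta> by (simp add: add_pos_pos divide_right_mono)
        then have "L (u x) * bump z r x \<le> ln (1 + Mx / \<delta>) * bump z r x"
          using ux by (intro mult_right_mono) (auto simp: L bump_nonneg)
        then show ?thesis using True x by (simp add: P_def)
      next
        case False
        then have "bump z r x = 0 \<or> u x = 0" using bump_nonzero_iff[OF r(1)] ux by force
        then show ?thesis
          using L[of 0] Mx(1) \<delta> by (auto simp: bump_nonneg indicator_def)
      qed
    qed (use iP iL in auto)
    finally show "ln (1 + c / \<delta>) * I \<le> ln (1 + Mx / \<delta>) * I' + C1" by (simp add: I'_def)
  qed
  then have "(LINT x|M. bump z r x - bump z r x * indicator P x) = 0"
    using ib(1) iP by (simp add: I_def I'_def)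
  moreover have "AE x in M. 0 \<le> bump z r x - bump z r x * indicator P x"
    by (auto simp: indicator_def bump_nonneg)
  ultimately have "AE x in M. bump z r x - bump z r x * indicator P x = 0"
    using ib(1) iP by (subst (asm) integral_nonneg_eq_0_iff_AE) auto
  then have "AE x in M. x \<in> ball z r \<longrightarrow> u x > 0"
  proof eventually_elim
    case (elim x)
    show ?case
    proof
      assume "x \<in> ball z r"
      then have "bump z r x \<noteq> 0" using bump_nonzero_iff[OF r(1)] by blast
      with elim have "x \<in> P" by (auto simp: indicator_def split: if_splits)
      then show "u x > 0" by (simp add: P_def)
    qed
  qed
  then show ?thesis using r(1) by blast
qed

text \<open>The set of points near which \<open>u\<close> is positive almost everywhere and the set of points near which
  \<open>u\<close> vanishes are open and disjoint; since positivity spreads, they cover \<open>\<Omega>\<close>.\<close>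

theorem strong_maximum_principle:
  assumes u: "supersolution \<Omega> p UNIV lam m u" and lam: "lam \<ge> 0" and m: "integrable M m"
    and cont: "continuous_on \<Omega> u" and conn: "connected \<Omega>"
  shows "(\<forall>x\<in>\<Omega>. u x = 0) \<or> (AE x in M. u x > 0)"
proof -
  have u0: "\<And>x. x \<in> \<Omega> \<Longrightarrow> u x \<ge> 0" using u by (auto simp: supersolution_def)
  define Q where "Q z r \<longleftrightarrow> r > 0 \<and> (AE x in M. x \<in> ball z r \<longrightarrow> u x > 0)" for z r
  define A where "A = (\<Union>z. \<Union>r\<in>{r. Q z r}. ball z r)"
  define B where "B = (\<Union>z. \<Union>r\<in>{r. ball z r \<subseteq> \<Omega> \<and> (\<forall>x\<in>ball z r. u x = 0)}. ball z r)"
  have AB: "open A" "open B" unfolding A_def B_def by (intro open_UN ballI open_ball)+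
  have AE_A: "AE x in M. x \<in> A \<longrightarrow> u x > 0"
  proof -
    define F where "F = {ball z r |z r. Q z r}"
    have "\<And>S. S \<in> F \<Longrightarrow> open S" by (auto simp: F_def)
    then obtain F' where F': "F' \<subseteq> F" "countable F'" "\<Union>F' = \<Union>F" using Lindelof[of F] by blast
    have "AE x in M. \<forall>S\<in>F'. x \<in> S \<longrightarrow> u x > 0"
      using F'(1) by (subst AE_ball_countable[OF F'(2)]) (auto simp: F_def Q_def)
    moreover have "A = \<Union>F'" unfolding F'(3) by (auto simp: A_def F_def)
    ultimately show ?thesis by (auto elim!: eventually_mono)
  qed
  have cover: "\<Omega> \<subseteq> A \<union> B"
  proof
    fix z assume z: "z \<in> \<Omega>"
    obtain e where e: "e > 0" "cball z e \<subseteq> \<Omega>" using open_\<Omega> z open_contains_cball by blast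
    define R where "R = e / 3"
    have R: "R > 0" "cball z (3 * R) \<subseteq> \<Omega>" "ball z R \<subseteq> cball z e" using e by (auto simp: R_def)
    show "z \<in> A \<union> B"
    proof (cases "\<exists>y\<in>ball z R. u y > 0")
      case True
      then obtain y where "y \<in> ball z R" "u y > 0" by blast
      then obtain r where "Q z r"
        using supersolution_positivity_spreads[OF u lam m cont R(1,2)] unfolding Q_def by blast
      then have "z \<in> A" unfolding A_def Q_def by (auto intro!: exI[of _ z] exI[of _ r])
      then show ?thesis by simp
    next
      case False
      then have "\<forall>x\<in>ball z R. u x = 0" using u0 R e by (meson not_le order_antisym subsetD)
      then have "z \<in> B" unfolding B_def using R e by (auto intro!: exI[of _ z] exI[of _ R])
      then show ?thesis by simp
    qed
  qed
  have disj: "A \<inter> B \<inter> \<Omega> = {}"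
  proof (rule ccontr)
    assume "A \<inter> B \<inter> \<Omega> \<noteq> {}"
    then obtain z r where zr: "ball z r \<subseteq> \<Omega>" "\<And>x. x \<in> ball z r \<Longrightarrow> u x = 0" "A \<inter> ball z r \<noteq> {}"
      unfolding B_def by blast
    define U where "U = A \<inter> ball z r"
    have U: "open U" "U \<noteq> {}" "U \<subseteq> \<Omega>" using AB zr by (auto simp: U_def)
    have "AE x in M. x \<notin> U"
      using AE_A by eventually_elim (use zr(2) in \<open>auto simp: U_def\<close>)
    with open_not_AE_avoided[OF U(1,3,2)] show False by contradiction
  qed
  from connectedD[OF conn AB disj cover] consider "A \<inter> \<Omega> = {}" | "B \<inter> \<Omega> = {}" by blast
  then show ?thesis
  proof cases
    case 1
    then have "\<Omega> \<subseteq> B" using cover by blast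
    then have "\<forall>x\<in>\<Omega>. u x = 0" by (auto simp: B_def)
    then show ?thesis by blast
  next
    case 2
    then have "\<Omega> \<subseteq> A" using cover by blast
    then have "AE x in M. u x > 0" by (intro AE_mp[OF AE_A AE_I2]) auto
    then show ?thesis by blast
  qed
qed

end

section \<open>Test functions with small Rayleigh quotient\<close>

text \<open>A smooth truncation at height \<open>k \<pi> / 2\<close>.\<close>

definition arctan_cut :: "real \<Rightarrow> real \<Rightarrow> real" where
  "arctan_cut k t = k * arctan (t / k)"

lemma arctan_cut_contraction:
  assumes "k > 0"
  shows "contraction (arctan_cut k) (\<lambda>t. 1 / (1 + (t / k)\<^sup>2))"
  unfolding contraction_def
proof (intro conjI allI)
  fix t
  have "((\<lambda>t. k * arctan (t / k)) has_real_derivative k * (inverse (1 + (t / k)\<^sup>2) * (1 / k))) (at t)"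
    by (intro DERIV_cmult DERIV_chain2[OF DERIV_arctan] DERIV_cdivide DERIV_ident)
  then show "(arctan_cut k has_real_derivative 1 / (1 + (t / k)\<^sup>2)) (at t)"
    using assms by (simp add: arctan_cut_def[abs_def] inverse_eq_divide)
  show "\<bar>1 / (1 + (t / k)\<^sup>2)\<bar> \<le> 1" by (simp add: divide_le_eq_1 add_pos_nonneg)
  show "continuous_on UNIV (\<lambda>t. 1 / (1 + (t / k)\<^sup>2))"
  proof (intro continuous_intros ballI)
    show "k \<noteq> 0" using assms by simp
    show "1 + (t / k)\<^sup>2 \<noteq> 0" for t using zero_le_power2[of "t / k"] by linarith
  qed
qed (simp add: arctan_cut_def)

lemma arctan_cut_bounded: "k > 0 \<Longrightarrow> \<bar>arctan_cut k t\<bar> \<le> k * (pi / 2)"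
  using arctan_bounded[of "t / k"] by (auto simp: arctan_cut_def abs_mult intro!: mult_left_mono)

lemma arctan_cut_tendsto: "(\<lambda>n. arctan_cut (real (Suc n)) t) \<longlonglongrightarrow> t"
proof (cases "t = 0")
  case False
  have "((\<lambda>h. (arctan (0 + h) - arctan 0) / h) \<longlongrightarrow> inverse (1 + 0\<^sup>2)) (at 0)"
    using DERIV_arctan[of 0] unfolding DERIV_def .
  then have d: "((\<lambda>h::real. arctan h / h) \<longlongrightarrow> 1) (at 0)" by simp
  have "filterlim (\<lambda>n. t / real (Suc n)) (at 0) sequentially"
    unfolding filterlim_at using False tendsto_mult_right_zero[OF LIMSEQ_inverse_real_of_nat, of t]
    by (auto simp: divide_inverse)
  from filterlim_compose[OF d this]
  have "(\<lambda>n. t * (arctan (t / real (Suc n)) / (t / real (Suc n)))) \<longlonglongrightarrow> t * 1"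
    by (rule tendsto_mult_left)
  then show ?thesis using False by (simp add: arctan_cut_def mult.commute)
qed (simp add: arctan_cut_def)

context sobolev_setting
begin

lemma Lp_tendsto_integral_less:
  fixes fn :: "nat \<Rightarrow> 'a \<Rightarrow> 'b::euclidean_space"
  assumes "\<And>n. fn n \<in> Lp p \<Omega>" "f \<in> Lp p \<Omega>" "Lp_tendsto M p fn f"
    and less: "(LINT x|M. norm (f x) powr p) < c"
  shows "\<exists>c'<c. \<forall>\<^sub>F n in sequentially. (LINT x|M. norm (fn n x) powr p) < c'"
proof -
  define D where "D = (LINT x|M. norm (f x) powr p)"
  define c' where "c' = (D + c) / 2"
  have c': "D < c'" "c' < c" using less by (auto simp: c'_def D_def)
  define \<kappa> where "\<kappa> n = 1 / real (Suc n)" for n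
  have \<kappa>: "\<kappa> n > 0" for n by (simp add: \<kappa>_def)
  have \<kappa>0: "\<kappa> \<longlonglongrightarrow> 0" unfolding \<kappa>_def using LIMSEQ_inverse_real_of_nat by (simp add: inverse_eq_divide)
  have "(\<lambda>n. (1 + \<kappa> n) powr p * D) \<longlonglongrightarrow> (1 + 0) powr p * D"
    by (intro tendsto_mult_right tendsto_powr tendsto_add tendsto_const \<kappa>0) simp
  then have "\<forall>\<^sub>F n in sequentially. (1 + \<kappa> n) powr p * D < c'" using c' by (intro order_tendstoD(2)) auto
  then obtain N where N: "(1 + \<kappa> N) powr p * D < c'" by (auto simp: eventually_sequentially)
  define A where "A = (1 + 1 / \<kappa> N) powr p"
  have "(\<lambda>n. (1 + \<kappa> N) powr p * D + A * (LINT x|M. norm (fn n x - f x) powr p)) \<longlonglongrightarrow> (1 + \<kappa> N) powr p * D + A * 0"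
    using assms(3) unfolding Lp_tendsto_def by (intro tendsto_add tendsto_mult_left tendsto_const)
  then have "\<forall>\<^sub>F n in sequentially. (1 + \<kappa> N) powr p * D + A * (LINT x|M. norm (fn n x - f x) powr p) < c'"
    using N by (intro order_tendstoD(2)) auto
  moreover have "(LINT x|M. norm (fn n x) powr p) \<le> (1 + \<kappa> N) powr p * D + A * (LINT x|M. norm (fn n x - f x) powr p)" for n
  proof -
    have i: "integrable M (\<lambda>x. norm (f x) powr p)" "integrable M (\<lambda>x. norm (fn n x - f x) powr p)"
      by (intro LpD(2) Lp_diff assms)+
    have "(LINT x|M. norm (fn n x) powr p) \<le> (LINT x|M. (1 + \<kappa> N) powr p * norm (f x) powr p + A * norm (fn n x - f x) powr p)"
    proof (rule integral_mono)
      show "norm (fn n x) powr p \<le> (1 + \<kappa> N) powr p * norm (f x) powr p + A * norm (fn n x - f x) powr p" for x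
        using norm_add_powr_le[OF \<kappa>[of N] p_pos(1), of "f x" "fn n x - f x"] by (simp add: A_def)
    qed (use i LpD(2)[OF assms(1)] in auto)
    then show ?thesis using i by (simp add: D_def)
  qed
  ultimately show ?thesis
    using c'(2) by (intro exI[of _ c'] conjI) (auto elim!: eventually_mono intro: le_less_trans)
qed

text \<open>Convergence of \<open>\<psi>\<^sub>n\<close> to \<open>u\<close> in the Sobolev norm says nothing immediate about
  \<open>\<integral> m |\<psi>\<^sub>n|\<^sup>p\<close>. After truncation at a fixed height a multiple of \<open>|m|\<close> is an integrable majorant,
  and as the height grows \<open>|m| |u|\<^sup>p\<close> is one, so two dominated limits suffice.
  Truncation does no harm to the numerator of the quotient, where it is simply omitted.\<close>

lemma rayleigh_quotient_test_function:
  assumes u: "u \<in> W01p p \<Omega>" and m: "integrable M m" and \<Lambda>: "\<Lambda> > 0"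
    and pos: "(LINT x|M. m x * \<bar>u x\<bar> powr p) > 0"
    and less: "(LINT x|M. norm (weak_gradient \<Omega> u x) powr p) < \<Lambda> * (LINT x|M. m x * \<bar>u x\<bar> powr p)"
  shows "\<exists>\<psi>\<in>test_functions \<Omega>. \<exists>k>0. (LINT x|M. norm (gradient \<psi> x) powr p) <
     \<Lambda> * (LINT x|M. m x * \<bar>arctan_cut k (\<psi> x)\<bar> powr p)"
proof -
  note wg = W01pD[OF u]
  let ?D = "LINT x|M. norm (weak_gradient \<Omega> u x) powr p"
  have mm: "m \<in> borel_measurable M" "u \<in> borel_measurable M" using m LpD(1)[OF wg(1)] by auto
  have iu: "integrable M (\<lambda>x. m x * \<bar>u x\<bar> powr p)" using pos not_integrable_integral_eq by fastforce
  have cutm: "(\<lambda>x. arctan_cut k (w x)) \<in> borel_measurable M" if "w \<in> borel_measurable M" "k > 0" for k w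
    by (rule borel_measurable_compose_continuous[OF contraction_continuous[OF arctan_cut_contraction[OF that(2)]] that(1)])
  have pl: "(\<lambda>n. \<bar>a n\<bar> powr p) \<longlonglongrightarrow> \<bar>l\<bar> powr p" if "a \<longlonglongrightarrow> l" for a :: "nat \<Rightarrow> real" and l
    using p_pos by (intro tendsto_powr' tendsto_rabs that) auto
  have "(\<lambda>n. LINT x|M. m x * \<bar>arctan_cut (real (Suc n)) (u x)\<bar> powr p) \<longlonglongrightarrow> (LINT x|M. m x * \<bar>u x\<bar> powr p)"
  proof (rule integral_dominated_convergence[where w="\<lambda>x. \<bar>m x * \<bar>u x\<bar> powr p\<bar>"])
    show "(\<lambda>x. m x * \<bar>u x\<bar> powr p) \<in> borel_measurable M" using mm by measurable
    show "(\<lambda>x. m x * \<bar>arctan_cut (real (Suc n)) (u x)\<bar> powr p) \<in> borel_measurable M" for n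
      using mm(1) cutm[OF mm(2), of "real (Suc n)"] by measurable
    show "integrable M (\<lambda>x. \<bar>m x * \<bar>u x\<bar> powr p\<bar>)" using iu by simp
    show "AE x in M. (\<lambda>n. m x * \<bar>arctan_cut (real (Suc n)) (u x)\<bar> powr p) \<longlonglongrightarrow> m x * \<bar>u x\<bar> powr p"
      by (intro AE_I2 tendsto_mult_left pl arctan_cut_tendsto)
    show "AE x in M. norm (m x * \<bar>arctan_cut (real (Suc n)) (u x)\<bar> powr p) \<le> \<bar>m x * \<bar>u x\<bar> powr p\<bar>" for n
    proof (rule AE_I2)
      fix x
      have "\<bar>arctan_cut (real (Suc n)) (u x)\<bar> powr p \<le> \<bar>u x\<bar> powr p"
        using contraction_abs_le[OF arctan_cut_contraction] p_pos by (intro powr_mono2) auto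
      from mult_left_mono[OF this, of "\<bar>m x\<bar>"]
      show "norm (m x * \<bar>arctan_cut (real (Suc n)) (u x)\<bar> powr p) \<le> \<bar>m x * \<bar>u x\<bar> powr p\<bar>" by (simp add: abs_mult)
    qed
  qed
  from tendsto_mult_left[OF this, of \<Lambda>] less
  have "\<forall>\<^sub>F n in sequentially. ?D < \<Lambda> * (LINT x|M. m x * \<bar>arctan_cut (real (Suc n)) (u x)\<bar> powr p)"
    by (rule order_tendstoD(1))
  then obtain n where n: "?D < \<Lambda> * (LINT x|M. m x * \<bar>arctan_cut (real (Suc n)) (u x)\<bar> powr p)"
    by (auto simp: eventually_sequentially)
  define k where "k = real (Suc n)"
  have k: "k > 0" by (simp add: k_def)
  obtain \<psi> where \<psi>: "\<And>n. \<psi> n \<in> test_functions \<Omega>" "Lp_tendsto M p (\<lambda>n. gradient (\<psi> n)) (weak_gradient \<Omega> u)"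
    "AE x in M. (\<lambda>n. \<psi> n x) \<longlonglongrightarrow> u x"
    using W01p_approximation[OF u] by blast
  obtain c where c: "c < \<Lambda> * (LINT x|M. m x * \<bar>arctan_cut k (u x)\<bar> powr p)"
    "\<forall>\<^sub>F n in sequentially. (LINT x|M. norm (gradient (\<psi> n) x) powr p) < c"
    using Lp_tendsto_integral_less[OF test_function_Lp(2)[OF \<psi>(1)] wg(3) \<psi>(2) n[folded k_def]] by blast
  have "(\<lambda>n. LINT x|M. m x * \<bar>arctan_cut k (\<psi> n x)\<bar> powr p) \<longlonglongrightarrow> (LINT x|M. m x * \<bar>arctan_cut k (u x)\<bar> powr p)"
  proof (rule integral_dominated_convergence[where w="\<lambda>x. (k * (pi / 2)) powr p * \<bar>m x\<bar>"])
    show "(\<lambda>x. m x * \<bar>arctan_cut k (u x)\<bar> powr p) \<in> borel_measurable M"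
      using mm(1) cutm[OF mm(2) k] by measurable
    show "(\<lambda>x. m x * \<bar>arctan_cut k (\<psi> n x)\<bar> powr p) \<in> borel_measurable M" for n
      using mm(1) cutm[OF test_functions_measurable(1)[OF \<psi>(1)] k] by measurable
    show "integrable M (\<lambda>x. (k * (pi / 2)) powr p * \<bar>m x\<bar>)" using m by simp
    show "AE x in M. (\<lambda>n. m x * \<bar>arctan_cut k (\<psi> n x)\<bar> powr p) \<longlonglongrightarrow> m x * \<bar>arctan_cut k (u x)\<bar> powr p"
      using \<psi>(3)
    proof eventually_elim
      case (elim x)
      have "isCont (arctan_cut k) (u x)"
        using contraction_continuous[OF arctan_cut_contraction[OF k]] by (simp add: continuous_on_eq_continuous_at)
      from isCont_tendsto_compose[OF this elim] show ?case by (intro tendsto_mult_left pl)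
    qed
    show "AE x in M. norm (m x * \<bar>arctan_cut k (\<psi> n x)\<bar> powr p) \<le> (k * (pi / 2)) powr p * \<bar>m x\<bar>" for n
    proof (rule AE_I2)
      fix x
      have "\<bar>arctan_cut k (\<psi> n x)\<bar> powr p \<le> (k * (pi / 2)) powr p"
        using arctan_cut_bounded[OF k] p_pos by (intro powr_mono2) auto
      from mult_left_mono[OF this, of "\<bar>m x\<bar>"]
      show "norm (m x * \<bar>arctan_cut k (\<psi> n x)\<bar> powr p) \<le> (k * (pi / 2)) powr p * \<bar>m x\<bar>"
        by (simp add: abs_mult mult.commute)
    qed
  qed
  from tendsto_mult_left[OF this, of \<Lambda>] c(1)
  have "\<forall>\<^sub>F n in sequentially. c < \<Lambda> * (LINT x|M. m x * \<bar>arctan_cut k (\<psi> n x)\<bar> powr p)"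
    by (rule order_tendstoD(1))
  with c(2) have "\<forall>\<^sub>F n in sequentially. (LINT x|M. norm (gradient (\<psi> n) x) powr p) <
      \<Lambda> * (LINT x|M. m x * \<bar>arctan_cut k (\<psi> n x)\<bar> powr p)"
    by eventually_elim simp
  then obtain j where "(LINT x|M. norm (gradient (\<psi> j) x) powr p) <
      \<Lambda> * (LINT x|M. m x * \<bar>arctan_cut k (\<psi> j x)\<bar> powr p)"
    by (auto simp: eventually_sequentially)
  then show ?thesis using \<psi>(1) k by blast
qed

text \<open>The infimum defining the eigenvalue is thus taken over a nonempty set.\<close>

lemma exists_admissible_test_function:
  assumes m: "integrable M m" and pos: "\<not> (AE x in M. max (m x) 0 = 0)"
  shows "\<exists>\<phi>\<in>test_functions \<Omega>. (LINT x|M. m x * \<bar>\<phi> x\<bar> powr p) > 0"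
proof (rule ccontr)
  assume "\<not> ?thesis"
  then have "(LINT x|M. m x * \<bar>\<phi> x\<bar> powr p) \<le> 0" if "\<phi> \<in> test_functions \<Omega>" for \<phi>
    using that by (meson not_le)
  then have "(LINT x|M. m x * \<phi> x powr p) \<le> 0" if "\<phi> \<in> test_functions \<Omega>" "\<And>x. 0 \<le> \<phi> x" for \<phi>
    using that(1)[THEN \<open>\<And>\<phi>. \<phi> \<in> test_functions \<Omega> \<Longrightarrow> _\<close>] that(2) by simp
  then have "AE x in M. m x \<le> 0"
    using nonpos_if_tests_nonpos[OF locally_integrableI[OF m], of p] p_pos by blast
  then have "AE x in M. max (m x) 0 = 0" by eventually_elim simp
  with pos show False by contradiction
qed

lemma rayleigh_near_lambda1:
  assumes m: "integrable M m" and pos: "\<not> (AE x in M. max (m x) 0 = 0)" and e: "\<epsilon> > 0"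
  shows "lambda1 p \<Omega> m \<ge> 0"
    and "\<exists>\<psi>\<in>test_functions \<Omega>. \<exists>k>0. (LINT x|M. norm (gradient \<psi> x) powr p) <
     (lambda1 p \<Omega> m + \<epsilon>) * (LINT x|M. m x * \<bar>arctan_cut k (\<psi> x)\<bar> powr p)"
proof -
  define S where "S = {(LINT x|M. norm (weak_gradient \<Omega> u x) powr p) / (LINT x|M. m x * \<bar>u x\<bar> powr p) | u.
     u \<in> W01p p \<Omega> \<and> (LINT x|M. m x * \<bar>u x\<bar> powr p) > 0}"
  have l: "lambda1 p \<Omega> m = Inf S" by (simp add: lambda1_def S_def)
  have ne: "S \<noteq> {}" using exists_admissible_test_function[OF m pos] test_function_W01p by (auto simp: S_def)
  have S0: "s \<ge> 0" if "s \<in> S" for s using that by (auto simp: S_def)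
  show l0: "lambda1 p \<Omega> m \<ge> 0" unfolding l by (rule cInf_greatest[OF ne S0])
  have "Inf S < lambda1 p \<Omega> m + \<epsilon>" using e by (simp add: l)
  then obtain s where "s \<in> S" "s < lambda1 p \<Omega> m + \<epsilon>"
    using cInf_lessD[OF ne] by blast
  then obtain u where u: "u \<in> W01p p \<Omega>" "(LINT x|M. m x * \<bar>u x\<bar> powr p) > 0"
    "(LINT x|M. norm (weak_gradient \<Omega> u x) powr p) / (LINT x|M. m x * \<bar>u x\<bar> powr p) < lambda1 p \<Omega> m + \<epsilon>"
    by (auto simp: S_def)
  show "\<exists>\<psi>\<in>test_functions \<Omega>. \<exists>k>0. (LINT x|M. norm (gradient \<psi> x) powr p) <
     (lambda1 p \<Omega> m + \<epsilon>) * (LINT x|M. m x * \<bar>arctan_cut k (\<psi> x)\<bar> powr p)"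
    by (rule rayleigh_quotient_test_function[OF u(1) m _ u(2)]) (use u l0 e in \<open>auto simp: pos_divide_less_eq\<close>)
qed

section \<open>Signed solutions are supersolutions\<close>

lemma W01p_minus:
  assumes u: "u \<in> W01p p \<Omega>"
  shows "(\<lambda>x. - u x) \<in> W01p p \<Omega>" "AE x in M. weak_gradient \<Omega> (\<lambda>x. - u x) x = - weak_gradient \<Omega> u x"
proof -
  note wg = W01pD[OF u]
  obtain \<psi> where \<psi>: "\<And>n. \<psi> n \<in> test_functions \<Omega>" "Lp_tendsto M p \<psi> u"
    "Lp_tendsto M p (\<lambda>n. gradient (\<psi> n)) (weak_gradient \<Omega> u)"
    using W01p_approximation[OF u] by blast
  have t: "(\<lambda>x. \<psi> n x * -1) \<in> test_functions \<Omega>" for n by (rule test_functions_mult[OF \<psi>(1)]) simp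
  have g: "gradient (\<lambda>x. \<psi> n x * -1) = (\<lambda>x. - gradient (\<psi> n) x)" for n
  proof -
    have "C1_gradient (\<lambda>x::'a. -1) (\<lambda>x. 0)" by (simp add: C1_gradient_def)
    from gradient_eq[OF C1_mult[OF test_functions_C1[OF \<psi>(1)] this]] show ?thesis by simp
  qed
  have n: "norm (- a - - b) = norm (a - b)" for a b :: "'c::real_normed_vector"
    by (metis minus_diff_eq minus_diff_minus norm_minus_cancel)
  have l: "Lp_tendsto M p (\<lambda>n x. \<psi> n x * -1) (\<lambda>x. - u x)"
    "Lp_tendsto M p (\<lambda>n. gradient (\<lambda>x. \<psi> n x * -1)) (\<lambda>x. - weak_gradient \<Omega> u x)"
    using \<psi>(2,3) unfolding g Lp_tendsto_def by (simp_all only: mult_minus_right mult_1_right n)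
  note W = W01pI[OF t Lp_minus[OF wg(1)] Lp_minus[OF wg(3)] l]
  show "(\<lambda>x. - u x) \<in> W01p p \<Omega>" by (rule W(1))
  show "AE x in M. weak_gradient \<Omega> (\<lambda>x. - u x) x = - weak_gradient \<Omega> u x" by (rule weak_gradient_AE(2)[OF W(2)])
qed

text \<open>The terms with \<open>a\<close> and \<open>f\<close> are nonnegative and can be dropped.\<close>

lemma nonneg_solution_supersolution:
  assumes u: "weak_solution \<Omega> p q m a f lam eta u" and u0: "\<And>x. x \<in> \<Omega> \<Longrightarrow> u x \<ge> 0"
    and a: "AE x in M. a x \<ge> 0" and eta: "eta \<ge> 0" and f: "\<And>x. x \<in> \<Omega> \<Longrightarrow> f x \<ge> 0"
  shows "supersolution \<Omega> p UNIV lam m u"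
  unfolding supersolution_def
proof (intro conjI ballI impI)
  show "u \<in> W01p p \<Omega>" using u by (simp add: weak_solution_def)
  show "u x \<ge> 0" if "x \<in> \<Omega>" for x by (rule u0[OF that])
  fix \<xi> assume \<xi>: "\<xi> \<in> W01p p \<Omega>" "\<forall>x\<in>\<Omega>. \<xi> x \<ge> 0"
  have "AE x in M. 0 \<le> a x * \<bar>u x\<bar> powr (q - 2) * u x * \<xi> x"
    using a AE_space by eventually_elim (use u0 \<xi>(2) in auto)
  then have "0 \<le> (LINT x|M. a x * \<bar>u x\<bar> powr (q - 2) * u x * \<xi> x)" by (rule integral_nonneg_AE)
  then have "0 \<le> eta * (LINT x|M. a x * \<bar>u x\<bar> powr (q - 2) * u x * \<xi> x)" using eta by simp
  moreover have "0 \<le> (LINT x|M. f x * \<xi> x)"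
    using f \<xi>(2) by (intro Bochner_Integration.integral_nonneg) auto
  ultimately show "lam * (LINT x|M. m x * \<bar>u x\<bar> powr (p - 2) * u x * \<xi> x) \<le>
      (LINT x|M. norm (weak_gradient \<Omega> u x) powr (p - 2) * (weak_gradient \<Omega> u x \<bullet> weak_gradient \<Omega> \<xi> x))"
    using u \<xi>(1) unfolding weak_solution_def by fastforce
qed

text \<open>The function \<open>- u\<close> solves the equation with source \<open>- f\<close>, which is harmless for test functions
  that vanish wherever \<open>f\<close> does not.\<close>

lemma negative_solution_supersolution:
  assumes u: "weak_solution \<Omega> p q m a f lam eta u" and u0: "\<And>x. x \<in> \<Omega> \<Longrightarrow> u x \<le> 0"
    and a: "AE x in M. a x \<ge> 0" and eta: "eta \<ge> 0"
  shows "supersolution \<Omega> p {x. f x = 0} lam m (\<lambda>x. - u x)"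
  unfolding supersolution_def
proof (intro conjI ballI impI)
  have W: "u \<in> W01p p \<Omega>" using u by (simp add: weak_solution_def)
  note Wm = W01p_minus[OF W]
  show "(\<lambda>x. - u x) \<in> W01p p \<Omega>" by (rule Wm(1))
  show "- u x \<ge> 0" if "x \<in> \<Omega>" for x using u0[OF that] by simp
  fix \<xi> assume \<xi>: "\<xi> \<in> W01p p \<Omega>" "\<forall>x\<in>\<Omega>. \<xi> x \<ge> 0" "\<forall>x\<in>\<Omega> - {x. f x = 0}. \<xi> x = 0"
  let ?g = "weak_gradient \<Omega> u" and ?h = "weak_gradient \<Omega> \<xi>"
  have mg: "?g \<in> borel_measurable M" "?h \<in> borel_measurable M" "weak_gradient \<Omega> (\<lambda>x. - u x) \<in> borel_measurable M"
    by (intro LpD(1) W01pD(3) W \<xi>(1) Wm(1))+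
  have "AE x in M. 0 \<le> - (a x * \<bar>u x\<bar> powr (q - 2) * u x * \<xi> x)"
    using a AE_space by eventually_elim (use u0 \<xi>(2) in \<open>auto simp: mult_nonneg_nonpos mult_nonpos_nonneg\<close>)
  then have "0 \<le> (LINT x|M. - (a x * \<bar>u x\<bar> powr (q - 2) * u x * \<xi> x))" by (rule integral_nonneg_AE)
  then have e: "eta * (LINT x|M. a x * \<bar>u x\<bar> powr (q - 2) * u x * \<xi> x) \<le> 0"
    using eta by (simp add: mult_nonneg_nonpos)
  have "(LINT x|M. f x * \<xi> x) = (LINT x|M. 0)"
    using \<xi>(3) by (intro Bochner_Integration.integral_cong) auto
  then have f0: "(LINT x|M. f x * \<xi> x) = 0" by simp
  have eq: "(LINT x|M. norm (?g x) powr (p - 2) * (?g x \<bullet> ?h x)) =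
      lam * (LINT x|M. m x * \<bar>u x\<bar> powr (p - 2) * u x * \<xi> x) +
      eta * (LINT x|M. a x * \<bar>u x\<bar> powr (q - 2) * u x * \<xi> x) + (LINT x|M. f x * \<xi> x)"
    using u \<xi>(1) by (simp add: weak_solution_def)
  have "(LINT x|M. norm (weak_gradient \<Omega> (\<lambda>x. - u x) x) powr (p - 2) * (weak_gradient \<Omega> (\<lambda>x. - u x) x \<bullet> ?h x)) =
      (LINT x|M. - (norm (?g x) powr (p - 2) * (?g x \<bullet> ?h x)))"
  proof (rule integral_cong_AE)
    show "AE x in M. norm (weak_gradient \<Omega> (\<lambda>x. - u x) x) powr (p - 2) * (weak_gradient \<Omega> (\<lambda>x. - u x) x \<bullet> ?h x) =
      - (norm (?g x) powr (p - 2) * (?g x \<bullet> ?h x))"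
      using Wm(2) by eventually_elim simp
  qed (use mg in measurable)
  then show "lam * (LINT x|M. m x * \<bar>- u x\<bar> powr (p - 2) * - u x * \<xi> x) \<le>
      (LINT x|M. norm (weak_gradient \<Omega> (\<lambda>x. - u x) x) powr (p - 2) * (weak_gradient \<Omega> (\<lambda>x. - u x) x \<bullet> ?h x))"
    using eq e f0 by simp
qed

end

section \<open>Nonexistence of solutions of one sign\<close>

lemma compact_proper_subset_of_bounded_open:
  fixes \<Omega> :: "'a::euclidean_space set"
  assumes "open \<Omega>" "bounded \<Omega>" "\<Omega> \<noteq> {}" "compact K" "K \<subseteq> \<Omega>"
  shows "\<Omega> - K \<noteq> {}"
proof
  assume "\<Omega> - K = {}"
  then have "\<Omega> = K" using assms by blast
  then have "closed \<Omega>" using assms compact_imp_closed by blast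
  then have "\<Omega> = UNIV" using assms clopen by blast
  then show False using assms not_bounded_UNIV by metis
qed

theorem theorem2p12:
  fixes \<Omega> :: "(real ^ 'n) set" and p q \<gamma> :: real and m a :: "real ^ 'n \<Rightarrow> real"
  assumes "bounded_domain \<Omega>"
    and "1 < q" and "q < p"
    and "real CARD('n) \<ge> p \<Longrightarrow> \<gamma> > real CARD('n) / p"
    and "real CARD('n) < p \<Longrightarrow> \<gamma> = 1"
    and "m \<in> Lp \<gamma> \<Omega>" and "a \<in> Lp \<gamma> \<Omega>"
    and "\<not> (AE x in lebesgue_on \<Omega>. max (m x) 0 = 0)"
    and "\<not> (AE x in lebesgue_on \<Omega>. a x = 0)"
    and "AE x in lebesgue_on \<Omega>. a x \<ge> 0"
  shows "\<forall>\<epsilon>>0. \<exists>f\<in>test_functions \<Omega>. f \<noteq> (\<lambda>x. 0) \<and> (\<forall>x\<in>\<Omega>. f x \<ge> 0) \<and>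
    (\<forall>lam eta. lam \<ge> lambda1 p \<Omega> m + \<epsilon> \<and> eta \<ge> 0 \<longrightarrow>
       \<not> (\<exists>u. solution \<Omega> p q m a f lam eta u \<and> (\<forall>x\<in>\<Omega>. u x \<ge> 0)) \<and>
       \<not> (\<exists>u. solution \<Omega> p q m a f lam eta u \<and> (\<forall>x\<in>\<Omega>. u x < 0)))"
proof (intro allI impI)
  fix \<epsilon> :: real
  assume \<epsilon>: "\<epsilon> > 0"
  have dom: "open \<Omega>" "connected \<Omega>" "\<Omega> \<noteq> {}" "bounded \<Omega>" using assms(1) by (auto simp: bounded_domain_def)
  interpret sobolev_setting \<Omega> p
    using dom assms(2,3) by unfold_locales auto
  have \<gamma>: "\<gamma> \<ge> 1"
  proof (cases "real CARD('n) \<ge> p")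
    case True
    then have "1 \<le> real CARD('n) / p" using p_pos by simp
    then show ?thesis using assms(4)[OF True] by linarith
  qed (use assms(5) in auto)
  have m: "integrable M m"
  proof (rule Bochner_Integration.integrable_bound)
    show "integrable M (\<lambda>x. 1 + norm (m x) powr \<gamma>)"
      using assms(6) integrable_const_M by (auto simp: Lp_def)
    show "m \<in> borel_measurable M" using assms(6) by (simp add: Lp_def)
    show "AE x in M. norm (m x) \<le> norm (1 + norm (m x) powr \<gamma>)"
      using le_powr_add[of "norm (m _)" 1 \<gamma>] \<gamma> by (intro AE_I2) (simp add: add_nonneg_nonneg)
  qed
  note l0 = rayleigh_near_lambda1(1)[OF m assms(8) \<epsilon>]
  define \<Lambda> where "\<Lambda> = lambda1 p \<Omega> m + \<epsilon>"
  have \<Lambda>: "\<Lambda> > 0" using l0 \<epsilon> by (simp add: \<Lambda>_def)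
  obtain \<psi> k where \<psi>: "\<psi> \<in> test_functions \<Omega>" and k: "k > 0"
    and less: "(LINT x|M. norm (gradient \<psi> x) powr p) < \<Lambda> * (LINT x|M. m x * \<bar>arctan_cut k (\<psi> x)\<bar> powr p)"
    using rayleigh_near_lambda1(2)[OF m assms(8) \<epsilon>] unfolding \<Lambda>_def by blast
  define I where "I = (LINT x|M. m x * \<bar>arctan_cut k (\<psi> x)\<bar> powr p)"
  have I: "I > 0"
  proof -
    have "0 \<le> (LINT x|M. norm (gradient \<psi> x) powr p)" by simp
    also note less
    finally have "0 < \<Lambda> * I" by (simp only: I_def)
    then show ?thesis using \<Lambda> by (simp add: zero_less_mult_iff)
  qed
  \<comment> \<open>The contradiction common to both signs.\<close>
  have no_super: False
    if "lam \<ge> \<Lambda>" "supersolution \<Omega> p S lam m v" "AE x in M. v x > 0" "\<And>x. x \<in> \<Omega> \<Longrightarrow> \<psi> x \<noteq> 0 \<Longrightarrow> x \<in> S" for lam S v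
  proof -
    have "lam * I \<le> (LINT x|M. norm (gradient \<psi> x) powr p)"
      unfolding I_def
      by (rule supersolution_eigenvalue_bound[OF that(2,3) \<psi> that(4) arctan_cut_contraction[OF k] m])
    also have "\<dots> < \<Lambda> * I" using less by (simp add: I_def)
    also have "\<dots> \<le> lam * I" using that(1) I by simp
    finally show False by simp
  qed
  obtain K where K: "compact K" "K \<subseteq> \<Omega>" "\<And>x. x \<notin> K \<Longrightarrow> \<psi> x = 0"
    by (rule test_functions_support[OF \<psi>]) (rule that)
  have "open (\<Omega> - K)" "\<Omega> - K \<noteq> {}"
    using dom K compact_imp_closed compact_proper_subset_of_bounded_open[OF dom(1,4,3) K(1,2)] by (auto intro: open_Diff)
  then obtain c r where cr: "r > 0" "cball c r \<subseteq> \<Omega> - K" by (metis all_not_in_conv open_contains_cball)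
  define f where "f = bump c r"
  have f: "f \<in> test_functions \<Omega>" unfolding f_def using cr by (intro bump_in_test_functions) auto
  have f0: "f x \<ge> 0" for x by (simp add: f_def bump_nonneg)
  have fpos: "f x > 0 \<longleftrightarrow> x \<in> ball c r" for x unfolding f_def by (rule bump_pos_iff[OF cr(1)])
  have f\<psi>: "f x = 0" if "\<psi> x \<noteq> 0" for x
  proof -
    have "x \<in> K" using that K(3) by blast
    then have "x \<notin> ball c r" using cr(2) ball_subset_cball by blast
    then show ?thesis using fpos[of x] f0[of x] by linarith
  qed
  have "f c > 0" using fpos[of c] cr by simp
  then have fne: "f \<noteq> (\<lambda>x. 0)" by auto
  have ball: "ball c r \<subseteq> \<Omega>" "ball c r \<noteq> {}"
    using cr(2) ball_subset_cball[of c r] cr(1) by (blast, simp)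
  have no_nonneg: "\<not> (solution \<Omega> p q m a f lam eta u \<and> (\<forall>x\<in>\<Omega>. u x \<ge> 0))"
    if lam: "lam \<ge> \<Lambda>" and eta: "eta \<ge> 0" for lam eta u
  proof
    assume "solution \<Omega> p q m a f lam eta u \<and> (\<forall>x\<in>\<Omega>. u x \<ge> 0)"
    then have u: "weak_solution \<Omega> p q m a f lam eta u" "continuous_on \<Omega> u" "\<And>x. x \<in> \<Omega> \<Longrightarrow> u x \<ge> 0"
      by (auto simp: solution_def)
    have super: "supersolution \<Omega> p UNIV lam m u"
      by (rule nonneg_solution_supersolution[OF u(1,3) assms(10) eta f0])
    from strong_maximum_principle[OF super _ m u(2) dom(2)] lam \<Lambda>
    consider "\<forall>x\<in>\<Omega>. u x = 0" | "AE x in M. u x > 0" by auto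
    then show False
    proof cases
      case 2
      then show False using no_super[OF lam super] by simp
    next
      case 1
      have W: "u \<in> W01p p \<Omega>" using u(1) by (simp add: weak_solution_def)
      have "is_weak_gradient \<Omega> u (\<lambda>x. 0)"
        unfolding is_weak_gradient_def
      proof (intro conjI ballI)
        show "locally_integrable \<Omega> u" by (rule locally_integrableI[OF Lp_integrable[OF W01pD(1)[OF W]]])
        show "locally_integrable \<Omega> (\<lambda>x. 0 :: real ^ 'n)" by (simp add: locally_integrable_def)
        fix \<phi> :: "real ^ 'n \<Rightarrow> real" and b :: "real ^ 'n"
        have "(LINT x|M. u x * frechet_derivative \<phi> (at x) b) = (LINT x|M. 0)"
          using 1 by (intro Bochner_Integration.integral_cong) auto
        then show "(LINT x|M. u x * frechet_derivative \<phi> (at x) b) = - (LINT x|M. (0 \<bullet> b) * \<phi> x)" by simp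
      qed
      from weak_gradient_AE(2)[OF this]
      have "AE x in M. norm (weak_gradient \<Omega> u x) powr (p - 2) * (weak_gradient \<Omega> u x \<bullet> weak_gradient \<Omega> f x) = 0"
        by eventually_elim simp
      then have L: "(LINT x|M. norm (weak_gradient \<Omega> u x) powr (p - 2) * (weak_gradient \<Omega> u x \<bullet> weak_gradient \<Omega> f x)) = 0"
        by (rule integral_eq_zero_AE)
      have "(LINT x|M. m x * \<bar>u x\<bar> powr (p - 2) * u x * f x) = (LINT x|M. 0)"
        "(LINT x|M. a x * \<bar>u x\<bar> powr (q - 2) * u x * f x) = (LINT x|M. 0)"
        using 1 by (intro Bochner_Integration.integral_cong; simp)+
      then have "(LINT x|M. f x * f x) = 0"
        using u(1) test_function_W01p[OF f] L by (simp add: weak_solution_def)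
      moreover have "integrable M (\<lambda>x. f x * f x)"
        by (intro integrable_continuous_M continuous_on_mult smooth_continuous test_functions_smooth[OF f])
      ultimately have "AE x in M. f x * f x = 0"
        using integral_nonneg_eq_0_iff_AE[of M "\<lambda>x. f x * f x"] by simp
      then have "AE x in M. x \<notin> ball c r"
        by eventually_elim (metis fpos less_irrefl mult_eq_0_iff)
      with open_not_AE_avoided[OF open_ball ball] show False by contradiction
    qed
  qed
  have no_negative: "\<not> (solution \<Omega> p q m a f lam eta u \<and> (\<forall>x\<in>\<Omega>. u x < 0))"
    if lam: "lam \<ge> \<Lambda>" and eta: "eta \<ge> 0" for lam eta u
  proof
    assume "solution \<Omega> p q m a f lam eta u \<and> (\<forall>x\<in>\<Omega>. u x < 0)"
    then have u: "weak_solution \<Omega> p q m a f lam eta u" "\<And>x. x \<in> \<Omega> \<Longrightarrow> u x < 0"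
      by (auto simp: solution_def)
    have "supersolution \<Omega> p {x. f x = 0} lam m (\<lambda>x. - u x)"
      by (rule negative_solution_supersolution[OF u(1) _ assms(10) eta]) (use u(2) in \<open>auto intro: less_imp_le\<close>)
    moreover have "AE x in M. - u x > 0" using u(2) by (intro AE_I2) simp
    ultimately show False using no_super[OF lam] f\<psi> by blast
  qed
  show "\<exists>f\<in>test_functions \<Omega>. f \<noteq> (\<lambda>x. 0) \<and> (\<forall>x\<in>\<Omega>. f x \<ge> 0) \<and>
    (\<forall>lam eta. lam \<ge> lambda1 p \<Omega> m + \<epsilon> \<and> eta \<ge> 0 \<longrightarrow>
       \<not> (\<exists>u. solution \<Omega> p q m a f lam eta u \<and> (\<forall>x\<in>\<Omega>. u x \<ge> 0)) \<and>
       \<not> (\<exists>u. solution \<Omega> p q m a f lam eta u \<and> (\<forall>x\<in>\<Omega>. u x < 0)))"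
    using no_nonneg no_negative f fne f0 unfolding \<Lambda>_def by (intro bexI[of _ f]) auto
qed

end
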